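(* Let $V=V_1\oplus\cdots\oplus V_d$ be the vector representation of dimension $2d$ of $U_q(\mathfrak{gl}_2^{\oplus d})$. There is a surjective morphism of algebras $$\Psi\colon\mathrm{BT}^{\mathrm{TL}}_n\to\operatorname{End}_{U_q(\mathfrak{gl}_2^{\oplus d})\rtimes\mathfrak{S}_d}(V^{\otimes n}),$$ given by $\tilde s_i\mapsto\sigma_i$, $\tilde E_i\mapsto\varepsilon_i$ ($1\le i\le n-1$). It is an isomorphism if and only if $n\leq d$.
   Context: $q$ is an indeterminate, $\Bbbk=\mathbb{C}(q)$, $d\ge1$, $n\ge1$. $U_q(\mathfrak{gl}_2^{\oplus d})\cong U_q(\mathfrak{gl}_2)^{\boxtimes d}$ (componentwise structure). $V_b$ is a copy of the $2$-dimensional vector representation on which the $b$-th factor acts, the other factors acting through their counits. $\mathfrak{S}_d$ acts on $U_q(\mathfrak{gl}_2)^{\boxtimes d}$ by permuting tensor factors, $\sigma\cdot(x_1\otimes\cdots\otimes x_d)=x_{\sigma^{-1}(1)}\otimes\cdots\otimes x_{\sigma^{-1}(d)}$, and $U_q(\mathfrak{gl}_2^{\oplus d})\rtimes\mathfrak{S}_d$ is the smash product. $\mathfrak{S}_d$ acts on $V$ by permuting the $d$ summands ($V_b\to V_{\sigma(b)}$ by the identity) and diagonally on $V^{\otimes n}$. $\check R$ is the action of the $R$-matrix (composed with the flip) on the tensor square of the vector representation of $U_q(\mathfrak{gl}_2)$, normalized so that $\check R^2=(q-q^{-1})\check R+1$, with eigenvalue $q$ on the $q$-symmetric square and $-q^{-1}$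 on the $q$-antisymmetric square. On $V^{\otimes n}$, $\sigma_i$ acts on factors $i,i+1$ by $v\otimes w\mapsto w\otimes v$ if $v\in V_b,w\in V_c$, $b\ne c$, and by $\check R$ on $V_b\otimes V_b$; $\varepsilon_i$ acts on factors $i,i+1$ as the identity on $V_b\otimes V_b$ and as $0$ on $V_b\otimes V_c$, $b\neq c$. The tied braid algebra $\mathrm{TB}_n$ is the $\Bbbk$-algebra with invertible generators $\tilde s_1,\dots,\tilde s_{n-1}$ satisfying the braid relations ($\tilde s_i\tilde s_j=\tilde s_j\tilde s_i$ if $|i-j|>1$, $\tilde s_i\tilde s_j\tilde s_i=\tilde s_j\tilde s_i\tilde s_j$ if $|i-j|=1$), and generators $\tilde E_1,\dots,\tilde E_{n-1}$ with relations: $\tilde E_i\tilde E_j=\tilde E_j\tilde E_i$; $\tilde E_i^2=\tilde E_i$; $\tilde s_i\tilde E_i=\tilde E_i\tilde s_i$; $\tilde s_i\tilde E_j=\tilde E_j\tilde s_i$ for $|i-j|>1$; and, for $|i-j|=1$: $\tilde E_i\tilde s_j\tilde s_i=\tilde s_j\tilde s_i\tilde E_j$, $\tilde E_i\tilde s_j\tilde s_i^{-1}=\tilde s_j\tilde s_i^{-1}\tilde E_j$, $\tilde E_i\tilde E_j\tilde s_i=\tilde E_j\tilde s_i\tilde E_j=\tilde s_i\tilde E_j\tilde E_i$. The Temperley–Lieb algebra of braids and ties $\mathrm{BT}^{\mathrm{TL}}_n$ is the quotient of $\mathrm{TB}_n$ by the relations $\tilde s_i^2=(q-q^{-1})\tilde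 s_i\tilde E_i+1$ for all $i$ and (when $n>2$) $$\tilde E_1\tilde E_2\bigl(1-q^{-1}\tilde s_1-q^{-1}\tilde s_2+q^{-2}\tilde s_1\tilde s_2+q^{-2}\tilde s_2\tilde s_1-q^{-3}\tilde s_1\tilde s_2\tilde s_1\bigr)=0.$$ *)

theory Defs
  imports
    "HOL-Library.Poly_Mapping"
    "HOL-Library.FuncSet"
    "HOL-Computational_Algebra.Polynomial"
    "HOL-Computational_Algebra.Fraction_Field"
    "HOL-Algebra.Module"
    "HOL-Algebra.QuotRing"
    "HOL-Algebra.Sym_Groups"
begin

section \<open>The ground field and free modules\<close>

type_synonym kq = "complex poly fract"

definition q :: kq where
  "q = Fract [:0, 1:] 1"

text \<open>The free module on a set \<open>B\<close> consists of the finitely supported functions with support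
  in \<open>B\<close>; the basis vector of \<open>b\<close> is \<open>Poly_Mapping.single b 1\<close>.\<close>

definition sc :: "'k::field \<Rightarrow> ('b \<Rightarrow>\<^sub>0 'k) \<Rightarrow> ('b \<Rightarrow>\<^sub>0 'k)" where
  "sc c v = Poly_Mapping.map ((*) c) v"

definition fmod :: "'b set \<Rightarrow> ('b \<Rightarrow>\<^sub>0 'k::field) set" where
  "fmod B = {v. Poly_Mapping.keys v \<subseteq> B}"

abbreviation bvec :: "'b \<Rightarrow> ('b \<Rightarrow>\<^sub>0 'k::field)" where
  "bvec b \<equiv> Poly_Mapping.single b 1"

text \<open>Linear extension of a map given on basis vectors.\<close>

definition lext :: "('b \<Rightarrow> ('c \<Rightarrow>\<^sub>0 'k::field)) \<Rightarrow> ('b \<Rightarrow>\<^sub>0 'k) \<Rightarrow> ('c \<Rightarrow>\<^sub>0 'k)" where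
  "lext f v = (\<Sum>b\<in>Poly_Mapping.keys v. sc (Poly_Mapping.lookup v b) (f b))"


section \<open>Algebras over a field, presentations\<close>

text \<open>A (not necessarily commutative) algebra over the field \<open>'k\<close> is a record of type
  \<open>('k, 'a) module\<close>: a ring together with a scalar multiplication.\<close>

definition alg_hom :: "('k, 'a) module \<Rightarrow> ('k, 'b) module \<Rightarrow> ('a \<Rightarrow> 'b) set" where
  "alg_hom A B = {h \<in> ring_hom A B. \<forall>c. \<forall>x\<in>carrier A. h (c \<odot>\<^bsub>A\<^esub> x) = c \<odot>\<^bsub>B\<^esub> h x}"

definition alg_iso :: "('k, 'a) module \<Rightarrow> ('k, 'b) module \<Rightarrow> ('a \<Rightarrow> 'b) set" where
  "alg_iso A B = {h \<in> alg_hom A B. bij_betw h (carrier A) (carrier B)}"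

definition quot_alg :: "('k, 'a) module \<Rightarrow> 'a set \<Rightarrow> ('k, 'a set) module" where
  "quot_alg A I = ring.extend (A Quot I)
     (module.fields (\<lambda>c X. \<Union>x\<in>X. I +>\<^bsub>A\<^esub> (c \<odot>\<^bsub>A\<^esub> x)))"

text \<open>Words in an alphabet form the free monoid, written additively because the convolution product
  of \<^theory>\<open>HOL-Library.Poly_Mapping\<close> takes its exponents in an additive (not necessarily
  commutative) monoid. Hence \<open>'g fmon \<Rightarrow>\<^sub>0 'k\<close> is the free associative algebra on \<open>'g\<close>.\<close>

datatype 'g fmon = FM (letters: "'g list")

instantiation fmon :: (type) monoid_add
begin

definition zero_fmon_def: "0 = FM []"
definition plus_fmon_def: "a + b = FM (letters a @ letters b)"

instance
  by standard (simp_all add: zero_fmon_def plus_fmon_def)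

end

type_synonym ('g, 'k) free = "'g fmon \<Rightarrow>\<^sub>0 'k"

definition gen :: "'g \<Rightarrow> ('g, 'k::field) free" where
  "gen x = bvec (FM [x])"

definition free_alg :: "'g set \<Rightarrow> ('k::field, ('g, 'k) free) module" where
  "free_alg X = \<lparr>carrier = fmod {w. set (letters w) \<subseteq> X},
     mult = (*), one = 1, zero = 0, add = (+), smult = sc\<rparr>"

text \<open>The algebra with generators \<open>X\<close> and relations \<open>r = 0\<close> for \<open>r \<in> R\<close>, and the class in it of an
  element of the free algebra.\<close>

definition rel_ideal :: "'g set \<Rightarrow> ('g, 'k::field) free set \<Rightarrow> ('g, 'k) free set" where
  "rel_ideal X R = genideal (free_alg X) R"

definition presented :: "'g set \<Rightarrow> ('g, 'k::field) free set \<Rightarrow> ('k, ('g, 'k) free set) module" where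
  "presented X R = quot_alg (free_alg X) (rel_ideal X R)"

definition pclass ::
    "'g set \<Rightarrow> ('g, 'k::field) free set \<Rightarrow> ('g, 'k) free \<Rightarrow> ('g, 'k) free set" where
  "pclass X R a = rel_ideal X R +>\<^bsub>free_alg X\<^esub> a"


section \<open>Endomorphism algebras and smash products\<close>

text \<open>The algebra of endomorphisms of the \<open>H\<close>-module \<open>fmod B\<close>, where \<open>act\<close> is the action of the
  algebra \<open>H\<close>. Endomorphisms are \<open>undefined\<close> outside \<open>fmod B\<close>.\<close>

definition End_alg ::
    "('k, 'h) module \<Rightarrow> ('h \<Rightarrow> ('b \<Rightarrow>\<^sub>0 'k) \<Rightarrow> ('b \<Rightarrow>\<^sub>0 'k)) \<Rightarrow> 'b set
      \<Rightarrow> ('k::field, ('b \<Rightarrow>\<^sub>0 'k) \<Rightarrow> ('b \<Rightarrow>\<^sub>0 'k)) module" where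
  "End_alg H act B = \<lparr>carrier = {f \<in> fmod B \<rightarrow>\<^sub>E fmod B.
         (\<forall>u\<in>fmod B. \<forall>v\<in>fmod B. f (u + v) = f u + f v) \<and>
         (\<forall>c. \<forall>v\<in>fmod B. f (sc c v) = sc c (f v)) \<and>
         (\<forall>h\<in>carrier H. \<forall>v\<in>fmod B. f (act h v) = act h (f v))},
     mult = compose (fmod B),
     one = (\<lambda>v\<in>fmod B. v),
     zero = (\<lambda>v\<in>fmod B. 0),
     add = (\<lambda>f g. \<lambda>v\<in>fmod B. f v + g v),
     smult = (\<lambda>c f. \<lambda>v\<in>fmod B. sc c (f v))\<rparr>"

text \<open>The smash product of an algebra \<open>A\<close> with a finite group \<open>G\<close> acting on it: the function \<open>f\<close>
  stands for the element \<open>\<Sum>k\<in>G. f k \<cdot> k\<close>, and \<open>(a \<cdot> k) (b \<cdot> l) = a (k.b) \<cdot> k l\<close>.\<close>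

definition smash ::
    "('k, 'a) module \<Rightarrow> 'g monoid \<Rightarrow> ('g \<Rightarrow> 'a \<Rightarrow> 'a) \<Rightarrow> ('k, 'g \<Rightarrow> 'a) module" where
  "smash A G act = \<lparr>carrier = carrier G \<rightarrow>\<^sub>E carrier A,
     mult = (\<lambda>f h. \<lambda>g\<in>carrier G.
       \<Oplus>\<^bsub>A\<^esub>k\<in>carrier G. f k \<otimes>\<^bsub>A\<^esub> act k (h (inv\<^bsub>G\<^esub> k \<otimes>\<^bsub>G\<^esub> g))),
     one = (\<lambda>g\<in>carrier G. if g = \<one>\<^bsub>G\<^esub> then \<one>\<^bsub>A\<^esub> else \<zero>\<^bsub>A\<^esub>),
     zero = (\<lambda>g\<in>carrier G. \<zero>\<^bsub>A\<^esub>),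
     add = (\<lambda>f h. \<lambda>g\<in>carrier G. f g \<oplus>\<^bsub>A\<^esub> h g),
     smult = (\<lambda>c f. \<lambda>g\<in>carrier G. c \<odot>\<^bsub>A\<^esub> f g)\<rparr>"


section \<open>The quantum group of \<open>gl\<^sub>2\<^sup>\<oplus>\<^sup>d\<close>\<close>

text \<open>The generator \<open>GK a\<close> is the group-like element attached to the \<open>a\<close>-th diagonal matrix unit,
  so that the usual \<open>K\<close> is \<open>GK I1 * GKinv I2\<close>.\<close>

datatype idx = I1 | I2

datatype glgen = GE | GF | GK idx | GKinv idx

definition gl2_rels :: "(glgen \<Rightarrow> 'g) \<Rightarrow> ('g, kq) free set" where
  "gl2_rels \<iota> = (let E = gen (\<iota> GE); F = gen (\<iota> GF);
        K = (\<lambda>a. gen (\<iota> (GK a))); K' = (\<lambda>a. gen (\<iota> (GKinv a))) in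
     (\<Union>a. {K a * K' a - 1, K' a * K a - 1}) \<union>
     {K I1 * K I2 - K I2 * K I1,
      K I1 * E * K' I1 - sc q E,
      K I2 * E * K' I2 - sc (inverse q) E,
      K I1 * F * K' I1 - sc (inverse q) F,
      K I2 * F * K' I2 - sc q F,
      E * F - F * E - sc (inverse (q - inverse q)) (K I1 * K' I2 - K' I1 * K I2)})"

text \<open>The generator \<open>(b, x)\<close> is the generator \<open>x\<close> of the \<open>b\<close>-th copy, \<open>1 \<le> b \<le> d\<close>. The coproduct,
  counit and action on \<open>V\<close> below do not depend on \<open>d\<close>.\<close>

definition Ugens :: "nat \<Rightarrow> (nat \<times> glgen) set" where
  "Ugens d = {1..d} \<times> UNIV"

definition Urels :: "nat \<Rightarrow> (nat \<times> glgen, kq) free set" where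
  "Urels d = (\<Union>b\<in>{1..d}. gl2_rels (Pair b)) \<union>
     {gen (b, x) * gen (c, y) - gen (c, y) * gen (b, x) | b c x y.
        b \<in> {1..d} \<and> c \<in> {1..d} \<and> b \<noteq> c}"

definition Uq :: "nat \<Rightarrow> (kq, (nat \<times> glgen, kq) free set) module" where
  "Uq d = presented (Ugens d) (Urels d)"

text \<open>A permutation \<open>s\<close> sends the generator \<open>(b, x)\<close> to \<open>(s b, x)\<close>: the tensor factor in position \<open>b\<close>
  moves to position \<open>s b\<close>. On the quotient, the coset \<open>X\<close> is sent to its image, again a coset.\<close>

definition Uperm :: "(nat \<Rightarrow> nat) \<Rightarrow> (nat \<times> glgen, kq) free set \<Rightarrow> (nat \<times> glgen, kq) free set" where
  "Uperm s X = lext (\<lambda>w. bvec (FM (map (\<lambda>(b, x). (s b, x)) (letters w)))) ` X"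

definition UqS :: "nat \<Rightarrow> (kq, (nat \<Rightarrow> nat) \<Rightarrow> (nat \<times> glgen, kq) free set) module" where
  "UqS d = smash (Uq d) (sym_group d) Uperm"


section \<open>The vector representation and its tensor powers\<close>

text \<open>\<open>(b, i)\<close> indexes the \<open>i\<close>-th basis vector of the summand \<open>V\<^sub>b\<close> of \<open>V\<close>. The \<open>n\<close>-th tensor power of
  \<open>V\<close> is the free module on the words of length \<open>n\<close> in this basis, the word \<open>[e\<^sub>1, \<dots>, e\<^sub>n]\<close> standing
  for \<open>e\<^sub>1 \<otimes> \<dots> \<otimes> e\<^sub>n\<close>.\<close>

type_synonym vbasis = "nat \<times> idx"

definition tbasis :: "nat \<Rightarrow> nat \<Rightarrow> vbasis list set" where
  "tbasis d n = {w. length w = n \<and> set w \<subseteq> {1..d} \<times> UNIV}"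

abbreviation tpow :: "nat \<Rightarrow> nat \<Rightarrow> (vbasis list \<Rightarrow>\<^sub>0 kq) set" where
  "tpow d n \<equiv> fmod (tbasis d n)"

fun vrep :: "glgen \<Rightarrow> idx \<Rightarrow> (idx \<Rightarrow>\<^sub>0 kq)" where
  "vrep GE i = (if i = I2 then bvec I1 else 0)"
| "vrep GF i = (if i = I1 then bvec I2 else 0)"
| "vrep (GK a) i = Poly_Mapping.single i (if i = a then q else 1)"
| "vrep (GKinv a) i = Poly_Mapping.single i (if i = a then inverse q else 1)"

fun counit :: "glgen \<Rightarrow> kq" where
  "counit GE = 0"
| "counit GF = 0"
| "counit (GK a) = 1"
| "counit (GKinv a) = 1"

text \<open>\<open>\<Delta>(E) = E \<otimes> 1 + K \<otimes> E\<close>, \<open>\<Delta>(F) = F \<otimes> K\<^sup>-\<^sup>1 + 1 \<otimes> F\<close>, and the \<open>GK a\<close> are group-like. A list of pairs of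
  words stands for the sum of the corresponding elementary tensors.\<close>

fun coprod :: "glgen \<Rightarrow> (glgen list \<times> glgen list) list" where
  "coprod GE = [([GE], []), ([GK I1, GKinv I2], [GE])]"
| "coprod GF = [([GF], [GKinv I1, GK I2]), ([], [GF])]"
| "coprod (GK a) = [([GK a], [GK a])]"
| "coprod (GKinv a) = [([GKinv a], [GKinv a])]"

text \<open>The \<open>b\<close>-th copy acts on \<open>V\<^sub>b\<close> by the vector representation, on the other summands by the
  counit.\<close>

fun vact :: "nat \<times> glgen \<Rightarrow> (vbasis \<Rightarrow>\<^sub>0 kq) \<Rightarrow> (vbasis \<Rightarrow>\<^sub>0 kq)" where
  "vact (b, x) = lext (\<lambda>(c, i).
     if c = b then lext (\<lambda>j. bvec (c, j)) (vrep x i)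
     else Poly_Mapping.single (c, i) (counit x))"

definition tens ::
    "(vbasis \<Rightarrow>\<^sub>0 kq) \<Rightarrow> (vbasis list \<Rightarrow>\<^sub>0 kq) \<Rightarrow> (vbasis list \<Rightarrow>\<^sub>0 kq)" where
  "tens u v = lext (\<lambda>e. lext (\<lambda>w. bvec (e # w)) v) u"

text \<open>The action of a generator on the \<open>n\<close>-th tensor power, through the iterated coproduct, with
  the \<open>(n+1)\<close>-st tensor power as \<open>V\<close> tensored with the \<open>n\<close>-th one.\<close>

primrec tact :: "nat \<Rightarrow> nat \<times> glgen \<Rightarrow> (vbasis list \<Rightarrow>\<^sub>0 kq) \<Rightarrow> (vbasis list \<Rightarrow>\<^sub>0 kq)" where
  "tact 0 = (\<lambda>(b, x) v. sc (counit x) v)"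
| "tact (Suc n) = (\<lambda>(b, x). lext (\<lambda>w. \<Sum>(y, z)\<leftarrow>coprod x.
     tens (foldr vact (map (Pair b) y) (bvec (hd w)))
          (foldr (tact n) (map (Pair b) z) (bvec (tl w)))))"

definition free_act ::
    "nat \<Rightarrow> (nat \<times> glgen, kq) free \<Rightarrow> (vbasis list \<Rightarrow>\<^sub>0 kq) \<Rightarrow> (vbasis list \<Rightarrow>\<^sub>0 kq)" where
  "free_act n p v = lext (\<lambda>w. foldr (tact n) (letters w) v) p"

text \<open>On the \<open>n\<close>-th tensor power the relations act as zero, so all elements of a coset act in the
  same way.\<close>

definition Uact ::
    "nat \<Rightarrow> (nat \<times> glgen, kq) free set \<Rightarrow> (vbasis list \<Rightarrow>\<^sub>0 kq) \<Rightarrow> (vbasis list \<Rightarrow>\<^sub>0 kq)" where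
  "Uact n X v = the_elem ((\<lambda>p. free_act n p v) ` X)"

definition Sact :: "(nat \<Rightarrow> nat) \<Rightarrow> (vbasis list \<Rightarrow>\<^sub>0 kq) \<Rightarrow> (vbasis list \<Rightarrow>\<^sub>0 kq)" where
  "Sact s = lext (\<lambda>w. bvec (map (\<lambda>(b, i). (s b, i)) w))"

definition UqS_act ::
    "nat \<Rightarrow> nat \<Rightarrow> ((nat \<Rightarrow> nat) \<Rightarrow> (nat \<times> glgen, kq) free set)
      \<Rightarrow> (vbasis list \<Rightarrow>\<^sub>0 kq) \<Rightarrow> (vbasis list \<Rightarrow>\<^sub>0 kq)" where
  "UqS_act d n f v = (\<Sum>s\<in>carrier (sym_group d). Uact n (f s) (Sact s v))"

definition End_UqS ::
    "nat \<Rightarrow> nat \<Rightarrow> (kq, (vbasis list \<Rightarrow>\<^sub>0 kq) \<Rightarrow> (vbasis list \<Rightarrow>\<^sub>0 kq)) module" where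
  "End_UqS d n = End_alg (UqS d) (UqS_act d n) (tbasis d n)"


section \<open>The operators \<open>\<sigma>\<^sub>i\<close> and \<open>\<epsilon>\<^sub>i\<close>\<close>

text \<open>For the above coproduct, the \<open>R\<close>-matrix acts on the tensor square of the vector representation
  by \<open>q\<^sup>H (1 + (q - q\<^sup>-\<^sup>1) F \<otimes> E)\<close>, where \<open>q\<^sup>H\<close> multiplies \<open>v\<^sub>i \<otimes> v\<^sub>j\<close> by \<open>q\<close> if \<open>i = j\<close> and by \<open>1\<close>
  otherwise. This is followed by the flip.\<close>

fun Rcheck :: "idx \<times> idx \<Rightarrow> (idx \<times> idx \<Rightarrow>\<^sub>0 kq)" where
  "Rcheck (I1, I1) = sc q (bvec (I1, I1))"
| "Rcheck (I2, I2) = sc q (bvec (I2, I2))"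
| "Rcheck (I2, I1) = bvec (I1, I2)"
| "Rcheck (I1, I2) = bvec (I2, I1) + sc (q - inverse q) (bvec (I1, I2))"

text \<open>The submodule generated by \<open>v\<^sub>1 \<otimes> v\<^sub>1\<close>, the \<open>q\<close>-symmetric square, is spanned by \<open>v\<^sub>1 \<otimes> v\<^sub>1\<close>,
  \<open>v\<^sub>2 \<otimes> v\<^sub>2\<close> and \<open>v\<^sub>1 \<otimes> v\<^sub>2 + q\<^sup>-\<^sup>1 v\<^sub>2 \<otimes> v\<^sub>1\<close>; its complement, the \<open>q\<close>-antisymmetric square, by
  \<open>v\<^sub>1 \<otimes> v\<^sub>2 - q v\<^sub>2 \<otimes> v\<^sub>1\<close>.\<close>

lemma lookup_sc [simp]: "Poly_Mapping.lookup (sc c v) b = c * Poly_Mapping.lookup v b"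
  by (simp add: sc_def Poly_Mapping.map.rep_eq when_def)

lemma lext_superset:
  assumes "finite B" "Poly_Mapping.keys v \<subseteq> B"
  shows "lext f v = (\<Sum>b\<in>B. sc (Poly_Mapping.lookup v b) (f b))"
  unfolding lext_def using assms
  by (intro sum.mono_neutral_left)
     (auto simp: in_keys_iff intro!: poly_mapping_eqI)

lemma q_nz: "q \<noteq> 0"
  by (simp add: q_def Zero_fract_def eq_fract)

lemma sc_sc [simp]: "sc a (sc b v) = sc (a * b) v"
  by (intro poly_mapping_eqI) (simp add: mult.assoc)

lemma lext_add: "lext f (u + v) = lext f u + lext f v"
proof -
  let ?B = "Poly_Mapping.keys u \<union> Poly_Mapping.keys v"
  have "lext f (u + v) = (\<Sum>b\<in>?B. sc (Poly_Mapping.lookup (u + v) b) (f b))"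
    by (rule lext_superset) (use Poly_Mapping.keys_add[of u v] in auto)
  also have "\<dots> = (\<Sum>b\<in>?B. sc (Poly_Mapping.lookup u b) (f b)) + (\<Sum>b\<in>?B. sc (Poly_Mapping.lookup v b) (f b))"
    unfolding sum.distrib[symmetric]
    by (intro sum.cong refl poly_mapping_eqI) (simp add: lookup_add algebra_simps)
  also have "\<dots> = lext f u + lext f v"
    by (simp add: lext_superset[of ?B])
  finally show ?thesis .
qed

lemma sc_sum: "sc c (sum g B) = (\<Sum>b\<in>B. sc c (g b))"
  by (intro poly_mapping_eqI) (simp add: lookup_sum sum_distrib_left)

lemma lext_sc: "lext f (sc c v) = sc c (lext f v)"
proof -
  have "Poly_Mapping.keys (sc c v) \<subseteq> Poly_Mapping.keys v"
    by (auto simp: in_keys_iff)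
  then have "lext f (sc c v) = (\<Sum>b\<in>Poly_Mapping.keys v. sc (c * Poly_Mapping.lookup v b) (f b))"
    by (simp add: lext_superset[of "Poly_Mapping.keys v"])
  then show ?thesis
    by (simp add: sc_sum lext_def)
qed

lemma lext_bvec [simp]: "lext f (bvec b) = f b"
  by (simp add: lext_def poly_mapping_eqI)

lemma Rcheck_sym:
  "lext Rcheck (bvec (I1, I1)) = sc q (bvec (I1, I1))"
  "lext Rcheck (bvec (I2, I2)) = sc q (bvec (I2, I2))"
  "lext Rcheck (bvec (I1, I2) + sc (inverse q) (bvec (I2, I1)))
     = sc q (bvec (I1, I2) + sc (inverse q) (bvec (I2, I1)))"
  using q_nz
  by (auto simp: lext_add lext_sc lookup_add lookup_single when_def algebra_simps
           intro!: poly_mapping_eqI)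

lemma Rcheck_antisym:
  "lext Rcheck (bvec (I1, I2) + sc (- q) (bvec (I2, I1)))
     = sc (- inverse q) (bvec (I1, I2) + sc (- q) (bvec (I2, I1)))"
  using q_nz
  by (auto simp: lext_add lext_sc lookup_add lookup_single when_def algebra_simps
           intro!: poly_mapping_eqI)

fun sigma2 :: "vbasis \<Rightarrow> vbasis \<Rightarrow> (vbasis \<times> vbasis \<Rightarrow>\<^sub>0 kq)" where
  "sigma2 (b, i) (c, j) = (if b = c
     then lext (\<lambda>(k, l). bvec ((b, k), (b, l))) (Rcheck (i, j))
     else bvec ((c, j), (b, i)))"

text \<open>Tensor factors are numbered from 1, list entries from 0.\<close>

definition sigma :: "nat \<Rightarrow> nat \<Rightarrow> nat \<Rightarrow> (vbasis list \<Rightarrow>\<^sub>0 kq) \<Rightarrow> (vbasis list \<Rightarrow>\<^sub>0 kq)" where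
  "sigma d n i = restrict
     (lext (\<lambda>w. lext (\<lambda>(x, y). bvec (w[i - 1 := x, i := y])) (sigma2 (w ! (i - 1)) (w ! i))))
     (tpow d n)"

definition eps :: "nat \<Rightarrow> nat \<Rightarrow> nat \<Rightarrow> (vbasis list \<Rightarrow>\<^sub>0 kq) \<Rightarrow> (vbasis list \<Rightarrow>\<^sub>0 kq)" where
  "eps d n i = restrict
     (lext (\<lambda>w. if fst (w ! (i - 1)) = fst (w ! i) then bvec w else 0))
     (tpow d n)"


section \<open>The Temperley--Lieb algebra of braids and ties\<close>

datatype tbgen = TS nat | TSinv nat | TE nat

definition TBgens :: "nat \<Rightarrow> tbgen set" where
  "TBgens n = TS ` {1..<n} \<union> TSinv ` {1..<n} \<union> TE ` {1..<n}"

abbreviation tS :: "nat \<Rightarrow> (tbgen, kq) free" where "tS i \<equiv> gen (TS i)"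
abbreviation tSinv :: "nat \<Rightarrow> (tbgen, kq) free" where "tSinv i \<equiv> gen (TSinv i)"
abbreviation tE :: "nat \<Rightarrow> (tbgen, kq) free" where "tE i \<equiv> gen (TE i)"

definition TBrels :: "nat \<Rightarrow> (tbgen, kq) free set" where
  "TBrels n =
     (\<Union>i\<in>{1..<n}.
        {tS i * tSinv i - 1, tSinv i * tS i - 1,
         tE i * tE i - tE i,
         tS i * tE i - tE i * tS i}) \<union>
     (\<Union>i\<in>{1..<n}. \<Union>j\<in>{1..<n}. {tE i * tE j - tE j * tE i}) \<union>
     (\<Union>(i, j)\<in>{(i, j). i \<in> {1..<n} \<and> j \<in> {1..<n} \<and> (i + 1 < j \<or> j + 1 < i)}.
        {tS i * tS j - tS j * tS i,
         tS i * tE j - tE j * tS i}) \<union>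
     (\<Union>(i, j)\<in>{(i, j). i \<in> {1..<n} \<and> j \<in> {1..<n} \<and> (i + 1 = j \<or> j + 1 = i)}.
        {tS i * tS j * tS i - tS j * tS i * tS j,
         tE i * tS j * tS i - tS j * tS i * tE j,
         tE i * tS j * tSinv i - tS j * tSinv i * tE j,
         tE i * tE j * tS i - tE j * tS i * tE j,
         tE j * tS i * tE j - tS i * tE j * tE i})"

definition BTTLrels :: "nat \<Rightarrow> (tbgen, kq) free set" where
  "BTTLrels n = TBrels n \<union>
     (\<Union>i\<in>{1..<n}. {tS i * tS i - (sc (q - inverse q) (tS i * tE i) + 1)}) \<union>
     (if n > 2 then
        {tE 1 * tE 2 * (1 - sc (inverse q) (tS 1) - sc (inverse q) (tS 2)
           + sc (inverse q ^ 2) (tS 1 * tS 2) + sc (inverse q ^ 2) (tS 2 * tS 1)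
           - sc (inverse q ^ 3) (tS 1 * tS 2 * tS 1))}
      else {})"

definition BTTL :: "nat \<Rightarrow> (kq, (tbgen, kq) free set) module" where
  "BTTL n = presented (TBgens n) (BTTLrels n)"

definition BTTL_gen :: "nat \<Rightarrow> tbgen \<Rightarrow> (tbgen, kq) free set" where
  "BTTL_gen n x = pclass (TBgens n) (BTTLrels n) (gen x)"

end

theory Submission
  imports Defs
begin

text \<open>Call the index of a summand of \<open>V\<close> a colour; a basis vector of \<open>V\<^sup>\<otimes>\<^sup>n\<close> is a labelling, by the two basis
  vectors of the vector representation, of \<open>n\<close> coloured strands. In the algebra of braids and ties the products of the
  ties and their complements are orthogonal idempotents with sum 1, and those which do not vanish belong to the
  partitions of the set of strands, that is, to colourings up to permutations of the colours. This reduces both claims to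
  a single colouring.

  Let \<open>P\<close> be the idempotent of a colouring. By the Temperley--Lieb relation, \<open>w P\<close> is a combination of shorter products of
  crossings when three strands of one colour cross pairwise in \<open>w\<close>. The permutations without such a triple therefore
  span the multiples of \<open>P\<close>. Counting inversions of labellings, the operator of such a permutation has a leading
  coefficient at a labelling from which the permutation can be recovered, so these operators are independent. Hence
  the kernel is generated by the idempotents of the partitions into more than \<open>d\<close> blocks, and it is zero if and only
  if \<open>n \<le> d\<close>.

  For surjectivity, an operator between coloured modules that commutes with the quantum group is determined by those
  matrix coefficients at which the permutations above have their leading coefficients. This follows by induction on the
  number of strands, with the four blocks of the operator according to the labels of the first strand; the blocks
  to which the induction does not apply are eliminated because an operator of positive weight that is invariant under
  lowering for the quantum adjoint action of a copy of \<open>sl\<^sub>2\<close> vanishes. So the operator is a combination of products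
  of crossings. Equivariance under permutations of the colours carries a combination that works for one colouring
  over to all colourings with the same partition.\<close>

section \<open>Linear maps between free modules\<close>

text \<open>No dimensions are compared. The codes that span the multiples of an idempotent and the
  pairs of words that index the determining matrix coefficients are never matched; each family has
  its own triangularity argument. Both rest on one estimate: a crossing of equal colours removes at
  most one inversion, and a term of a product that loses the maximal number is the permuted word
  itself. The idempotents of the ties help because on a multiple of one of them every tie acts as 0
  or 1, so ties disappear from all words and the quadratic relation depends only on whether the
  crossing strands have equal colours. The induction over strands brings in operators of arbitrary
  weight: the blocks of an invariant operator have other weights and are invariant only up to terms
  from other blocks. One block, with both labels \<open>I2\<close> at height zero, carries no
  determining coefficient and has to be recovered from its neighbour. That \<open>q\<close> has
  infinite order enters in three ways: the group-like elements separate the numbers of letters, sums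
  of quantum integers do not vanish, and \<open>q - inverse q\<close> is invertible.\<close>

lemma sc_add_right [simp]: "sc c (u + v) = sc c u + sc c v"
  by (rule poly_mapping_eqI) (simp add: lookup_add algebra_simps)

lemma sc_add_left: "sc (a + b) v = sc a v + sc b v"
  by (rule poly_mapping_eqI) (simp add: lookup_add algebra_simps)

lemma sc_one [simp]: "sc 1 v = v"
  by (rule poly_mapping_eqI) simp

lemma sc_zero_left [simp]: "sc 0 v = 0"
  by (rule poly_mapping_eqI) simp

lemma sc_zero_right [simp]: "sc c 0 = 0"
  by (rule poly_mapping_eqI) simp

lemma sc_minus_right [simp]: "sc c (- v) = - sc c v"
  by (rule poly_mapping_eqI) simp

lemma sc_diff_right [simp]: "sc c (u - v) = sc c u - sc c v"
  by (rule poly_mapping_eqI) (simp add: lookup_minus algebra_simps)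

lemma sc_eq_0_iff [simp]: "sc c v = 0 \<longleftrightarrow> c = 0 \<or> v = 0"
proof
  assume "sc c v = 0"
  then have "\<forall>b. c * Poly_Mapping.lookup v b = 0"
    by (metis lookup_sc lookup_zero)
  then show "c = 0 \<or> v = 0"
    by (auto intro: poly_mapping_eqI)
qed auto

lemma sc_bvec: "sc c (bvec b) = Poly_Mapping.single b c"
  by (rule poly_mapping_eqI) (simp add: lookup_single when_def)

global_interpretation vec: vector_space sc
  by unfold_locales (auto simp: sc_add_left)

text \<open>Linearity on all finitely supported functions. Operators therefore compose without
  domain conditions, and a submodule \<open>fmod B\<close> is mentioned only where an identity
  depends on the shape of the words.\<close>

definition lin :: "(('b \<Rightarrow>\<^sub>0 'k::field) \<Rightarrow> ('c \<Rightarrow>\<^sub>0 'k)) \<Rightarrow> bool" where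
  "lin f \<longleftrightarrow> (\<forall>u v. f (u + v) = f u + f v) \<and> (\<forall>c v. f (sc c v) = sc c (f v))"

lemma linI:
  assumes "\<And>u v. f (u + v) = f u + f v" "\<And>c v. f (sc c v) = sc c (f v)"
  shows "lin f"
  using assms by (simp add: lin_def)

lemma lin_plus: "lin f \<Longrightarrow> f (u + v) = f u + f v"
  and lin_scale: "lin f \<Longrightarrow> f (sc c v) = sc c (f v)"
  by (simp_all add: lin_def)

lemma lin_zero: "lin f \<Longrightarrow> f 0 = 0"
  using lin_scale[of f 0 0] by simp

lemma lin_uminus: "lin f \<Longrightarrow> f (- v) = - f v"
  using lin_plus[of f v "- v"] lin_zero[of f] by (simp add: eq_neg_iff_add_eq_0 add.commute)

lemma lin_minus: "lin f \<Longrightarrow> f (u - v) = f u - f v"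
  using lin_plus[of f u "- v"] lin_uminus[of f v] by simp

lemma lin_sum: "lin f \<Longrightarrow> f (sum g A) = (\<Sum>a\<in>A. f (g a))"
  by (induction A rule: infinite_finite_induct) (auto simp: lin_zero lin_plus)

lemmas lin_simps = lin_plus lin_scale lin_zero lin_uminus lin_minus

lemma lin_lext [simp]: "lin (lext f)"
  by (intro linI lext_add lext_sc)

lemma lin_id [simp]: "lin (\<lambda>v. v)"
  and lin_const0 [simp]: "lin (\<lambda>v. 0)"
  by (simp_all add: lin_def)

lemma lin_comp: "lin f \<Longrightarrow> lin g \<Longrightarrow> lin (\<lambda>v. f (g v))"
  and lin_add: "lin f' \<Longrightarrow> lin g' \<Longrightarrow> lin (\<lambda>v. f' v + g' v)"
  and lin_diff: "lin f' \<Longrightarrow> lin g' \<Longrightarrow> lin (\<lambda>v. f' v - g' v)"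
  and lin_sc: "lin f' \<Longrightarrow> lin (\<lambda>v. sc c (f' v))"
  by (simp_all add: lin_def algebra_simps)

lemma lin_sums: "(\<And>a. a \<in> A \<Longrightarrow> lin (f a)) \<Longrightarrow> lin (\<lambda>v. \<Sum>a\<in>A. f a v)"
  by (simp add: lin_def sum.distrib sc_sum)

lemmas lin_intros = lin_comp lin_add lin_diff lin_sc lin_lext lin_id lin_const0

lemma lookup_sum_keys:
  "Poly_Mapping.lookup (\<Sum>b\<in>A. sc (f b) (bvec b)) c = (if finite A \<and> c \<in> A then f c else 0)"
proof (cases "finite A")
  case True
  then show ?thesis
    by (simp add: lookup_sum lookup_single when_def if_distrib cong: if_cong)
qed simp

lemma vec_expand: "v = (\<Sum>b\<in>Poly_Mapping.keys v. sc (Poly_Mapping.lookup v b) (bvec b))"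
  by (rule poly_mapping_eqI) (simp add: lookup_sum_keys in_keys_iff)

lemma lin_eq_lext: "lin f \<Longrightarrow> f v = lext (\<lambda>b. f (bvec b)) v"
  by (subst vec_expand[of v]) (simp add: lin_sum lin_scale lext_def)

lemma lin_eq_on:
  assumes "lin f" "lin g" "\<And>b. b \<in> B \<Longrightarrow> f (bvec b) = g (bvec b)" "v \<in> fmod B"
  shows "f v = g v"
proof -
  have "f v = (\<Sum>b\<in>Poly_Mapping.keys v. sc (Poly_Mapping.lookup v b) (f (bvec b)))"
    unfolding lext_def[symmetric] by (rule lin_eq_lext[OF assms(1)])
  also have "\<dots> = (\<Sum>b\<in>Poly_Mapping.keys v. sc (Poly_Mapping.lookup v b) (g (bvec b)))"
    using assms(3,4) by (intro sum.cong) (auto simp: fmod_def)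
  also have "\<dots> = g v"
    unfolding lext_def[symmetric] by (rule lin_eq_lext[OF assms(2), symmetric])
  finally show ?thesis .
qed

lemma fmod_UNIV [simp]: "v \<in> fmod UNIV"
  by (simp add: fmod_def)

lemma lin_ext:
  assumes "lin f" "lin g" "\<And>b. f (bvec b) = g (bvec b)"
  shows "f = g"
  using lin_eq_on[OF assms(1,2), of UNIV] assms(3) by auto

lemma fmod_bvec [simp]: "bvec b \<in> fmod B \<longleftrightarrow> b \<in> B"
  by (simp add: fmod_def)

lemma fmod_zero [simp]: "0 \<in> fmod B"
  by (simp add: fmod_def)

lemma fmod_add: "u \<in> fmod B \<Longrightarrow> v \<in> fmod B \<Longrightarrow> u + v \<in> fmod B"
  using Poly_Mapping.keys_add[of u v] by (auto simp: fmod_def)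

lemma fmod_sc: "v \<in> fmod B \<Longrightarrow> sc c v \<in> fmod B"
  by (auto simp: fmod_def in_keys_iff)

lemma fmod_uminus: "v \<in> fmod B \<Longrightarrow> - v \<in> fmod B"
  by (simp add: fmod_def)

lemma fmod_diff: "u \<in> fmod B \<Longrightarrow> v \<in> fmod B \<Longrightarrow> u - v \<in> fmod B"
  using fmod_add[of u B "- v"] fmod_uminus[of v B] by simp

lemma fmod_sum: "(\<And>a. a \<in> A \<Longrightarrow> f a \<in> fmod B) \<Longrightarrow> sum f A \<in> fmod B"
  by (induction A rule: infinite_finite_induct) (auto intro: fmod_add)

lemma fmod_mono: "v \<in> fmod A \<Longrightarrow> A \<subseteq> B \<Longrightarrow> v \<in> fmod B"
  by (auto simp: fmod_def)

lemma lin_fmod: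
  assumes "lin f" "\<And>b. b \<in> B \<Longrightarrow> f (bvec b) \<in> fmod C" "v \<in> fmod B"
  shows "f v \<in> fmod C"
proof -
  have "lext (\<lambda>b. f (bvec b)) v \<in> fmod C"
    unfolding lext_def using assms(2,3) by (auto simp: fmod_def[of B] intro!: fmod_sum fmod_sc)
  then show ?thesis
    by (simp add: lin_eq_lext[OF assms(1), symmetric])
qed

section \<open>Presented algebras and their modules\<close>

lemma sc_mult_left: "sc c p * r = sc c (p * r)" for p r :: "('g, 'k::field) free"
  by (simp add: sc_def mult_map_scale_conv_mult mult.assoc)

lemma lin_mult_left: "lin (\<lambda>r. p * r)"
  and lin_mult_right: "lin (\<lambda>p. p * r)" for p r :: "('g, 'k::field) free"
proof -
  show r: "lin (\<lambda>p. p * r)" for r :: "('g, 'k) free"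
    by (intro linI) (simp_all add: sc_mult_left algebra_simps)
  have "p * sc c r = sc c (p * r)" for c and r :: "('g, 'k) free"
  proof (rule fun_cong[where x = p], rule lin_ext)
    show "lin (\<lambda>p. p * sc c r)" "lin (\<lambda>p. sc c (p * r))"
      by (intro r lin_sc)+
    fix w :: "'g fmon"
    show "bvec w * sc c r = sc c (bvec w * r)"
    proof -
      \<comment> \<open>Scalars are multiples of the empty word, which commutes with every
        word.\<close>
      have "bvec w * Poly_Mapping.single 0 c = Poly_Mapping.single 0 c * bvec w"
        by (simp add: mult_single)
      then show ?thesis
        by (simp add: sc_def mult_map_scale_conv_mult mult.assoc[symmetric])
    qed
  qed
  then show "lin (\<lambda>r. p * r)"
    by (intro linI) (simp_all add: algebra_simps)
qed

lemma sc_mult_right: "p * sc c r = sc c (p * r)" for p r :: "('g, 'k::field) free"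
  using lin_scale[OF lin_mult_left] .

lemma fmod_words_mult:
  assumes "p \<in> fmod {w. set (letters w) \<subseteq> X}" "r \<in> fmod {w. set (letters w) \<subseteq> X}"
  shows "p * r \<in> fmod {w. set (letters w) \<subseteq> X}"
  using assms keys_mult[of p r] by (fastforce simp: fmod_def plus_fmon_def)

lemma one_free: "(1 :: ('g, 'k::field) free) = bvec (FM [])"
  by (simp add: zero_fmon_def[symmetric])

lemma carrier_free_alg: "carrier (free_alg X) = fmod {w. set (letters w) \<subseteq> X}"
  by (simp add: free_alg_def)

lemma free_alg_simps [simp]:
  "mult (free_alg X) = (*)" "one (free_alg X) = 1" "zero (free_alg X) = 0" "add (free_alg X) = (+)"
  "smult (free_alg X) = sc"
  by (simp_all add: free_alg_def)

lemma ring_free_alg: "ring (free_alg X :: ('k::field, ('g, 'k) free) module)"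
proof (rule ringI)
  show "abelian_group (free_alg X :: ('k, ('g, 'k) free) module)"
  proof (rule abelian_groupI)
    fix x assume "x \<in> carrier (free_alg X :: ('k, ('g, 'k) free) module)"
    then show "\<exists>y\<in>carrier (free_alg X). y \<oplus>\<^bsub>free_alg X\<^esub> x = \<zero>\<^bsub>free_alg X\<^esub>"
      by (intro bexI[of _ "- x"]) (auto simp: carrier_free_alg intro: fmod_uminus)
  qed (auto simp: carrier_free_alg algebra_simps intro: fmod_add)
  show "monoid (free_alg X :: ('k, ('g, 'k) free) module)"
    by (rule monoidI) (auto simp: carrier_free_alg mult.assoc intro: fmod_words_mult, simp add: one_free)
qed (auto simp: algebra_simps)

lemma free_alg_a_inv:
  "x \<in> carrier (free_alg X) \<Longrightarrow> \<ominus>\<^bsub>free_alg X\<^esub> x = - x" for x :: "('g, 'k::field) free"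
  using abelian_group.minus_equality[OF ring.is_abelian_group[OF ring_free_alg[of X]], of "- x" x]
  by (auto simp: carrier_free_alg intro: fmod_uminus)

lemma gen_in_free_alg [simp]: "gen x \<in> carrier (free_alg X) \<longleftrightarrow> x \<in> X"
  by (simp add: gen_def carrier_free_alg)

text \<open>Evaluation of a noncommutative polynomial at the operators \<open>g\<close>; the last
  letter of a word acts first.\<close>

definition word_act ::
    "('g \<Rightarrow> ('b \<Rightarrow>\<^sub>0 'k) \<Rightarrow> ('b \<Rightarrow>\<^sub>0 'k)) \<Rightarrow> ('g, 'k::field) free \<Rightarrow> ('b \<Rightarrow>\<^sub>0 'k) \<Rightarrow> ('b \<Rightarrow>\<^sub>0 'k)" where
  "word_act g p v = lext (\<lambda>w. foldr g (letters w) v) p"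

lemma word_act_lin1: "lin (\<lambda>p. word_act g p v)"
  unfolding word_act_def by simp

lemma word_act_bvec [simp]: "word_act g (bvec w) v = foldr g (letters w) v"
  by (simp add: word_act_def)

lemma word_act_gen [simp]: "word_act g (gen x) v = g x v"
  by (simp add: gen_def)

lemma word_act_one [simp]: "word_act g 1 v = v"
  by (simp add: one_free)

lemmas word_act_simps = lin_simps[OF word_act_lin1]

locale letter_action =
  fixes g :: "'g \<Rightarrow> ('b \<Rightarrow>\<^sub>0 'k) \<Rightarrow> ('b \<Rightarrow>\<^sub>0 'k::field)" and X :: "'g set" and B :: "'b set"
  assumes lin_letter: "lin (g x)"
    and letter_closed: "x \<in> X \<Longrightarrow> v \<in> fmod B \<Longrightarrow> g x v \<in> fmod B"
begin

lemma lin_foldr: "lin (foldr g ws)"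
  by (induction ws) (auto simp: id_def o_def intro: lin_comp lin_letter)

lemma word_act_lin2: "lin (word_act g p)"
proof (intro linI)
  show "word_act g p (u + v) = word_act g p u + word_act g p v" for u v
    by (simp add: word_act_def lext_def lin_plus[OF lin_foldr] sum.distrib)
  show "word_act g p (sc c v) = sc c (word_act g p v)" for c v
    by (simp add: word_act_def lext_def lin_scale[OF lin_foldr] sc_sum mult.commute)
qed

lemma word_act_mult: "word_act g (p * r) v = word_act g p (word_act g r v)"
proof (rule fun_cong[where x = p], rule lin_ext)
  show "lin (\<lambda>p. word_act g (p * r) v)"
    by (rule lin_comp[OF word_act_lin1 lin_mult_right])
  show "lin (\<lambda>p. word_act g p (word_act g r v))"
    by (rule word_act_lin1)
  fix w :: "'g fmon"
  show "word_act g (bvec w * r) v = word_act g (bvec w) (word_act g r v)"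
  proof (rule fun_cong[where x = r], rule lin_ext)
    show "lin (\<lambda>r. word_act g (bvec w * r) v)"
      by (rule lin_comp[OF word_act_lin1 lin_mult_left])
    show "lin (\<lambda>r. word_act g (bvec w) (word_act g r v))"
      by (rule lin_comp[OF word_act_lin2 word_act_lin1])
  qed (simp add: mult_single plus_fmon_def)
qed

lemma foldr_closed: "set ws \<subseteq> X \<Longrightarrow> v \<in> fmod B \<Longrightarrow> foldr g ws v \<in> fmod B"
  by (induction ws) (auto intro: letter_closed)

lemma word_act_closed: "p \<in> carrier (free_alg X) \<Longrightarrow> v \<in> fmod B \<Longrightarrow> word_act g p v \<in> fmod B"
  using lin_fmod[OF word_act_lin1, of "{w. set (letters w) \<subseteq> X}" g v B p]
  by (simp add: carrier_free_alg foldr_closed)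

text \<open>The elements of the free algebra that annihilate \<open>fmod B\<close> form an ideal
  containing the relations. It is closed under multiplication from the right because the letters
  preserve \<open>fmod B\<close>.\<close>

lemma rel_ideal_acts_zero:
  assumes "R \<subseteq> carrier (free_alg X)" "\<And>r v. r \<in> R \<Longrightarrow> v \<in> fmod B \<Longrightarrow> word_act g r v = 0"
    "p \<in> rel_ideal X R" "v \<in> fmod B"
  shows "word_act g p v = 0"
proof -
  interpret F: ring "free_alg X" by (rule ring_free_alg)
  let ?J = "{p \<in> carrier (free_alg X). \<forall>v\<in>fmod B. word_act g p v = 0}"
  have "ideal ?J (free_alg X)"
  proof (rule idealI[OF ring_free_alg])
    show "subgroup ?J (add_monoid (free_alg X))"
    proof (rule group.subgroupI[OF F.a_group])
      have "0 \<in> ?J"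
        by (simp add: carrier_free_alg word_act_simps)
      then show "?J \<noteq> {}" by blast
      show "inv\<^bsub>add_monoid (free_alg X)\<^esub> a \<in> ?J" if "a \<in> ?J" for a
        using that free_alg_a_inv[of a X] unfolding a_inv_def[symmetric]
        by (auto simp: carrier_free_alg word_act_simps intro: fmod_uminus)
    qed (auto simp: carrier_free_alg word_act_simps intro: fmod_add)
  qed (auto simp: word_act_mult word_act_closed word_act_simps lin_simps[OF word_act_lin2] carrier_free_alg
        intro: fmod_words_mult)
  moreover have "R \<subseteq> ?J"
    using assms(1,2) by auto
  ultimately have "rel_ideal X R \<subseteq> ?J"
    unfolding rel_ideal_def by (rule F.genideal_minimal)
  then show ?thesis
    using assms(3,4) by blast
qed

end

section \<open>Presented algebras and representatives of their elements\<close>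

locale presentation =
  fixes X :: "'g set" and R :: "('g, 'k::field) free set"
  assumes rels: "R \<subseteq> carrier (free_alg X)"
begin

interpretation free: ring "free_alg X :: ('k, ('g, 'k) free) module"
  by (rule ring_free_alg)

interpretation I: ideal "rel_ideal X R" "free_alg X :: ('k, ('g, 'k) free) module"
  unfolding rel_ideal_def by (rule free.genideal_ideal[OF rels])

lemma rel_in_ideal: "r \<in> R \<Longrightarrow> r \<in> rel_ideal X R"
  unfolding rel_ideal_def using free.genideal_self[OF rels] by blast

lemma sc_one_carrier: "sc c (1 :: ('g, 'k) free) \<in> carrier (free_alg X)"
  by (simp add: carrier_free_alg one_free fmod_sc)

lemma ideal_sc: "p \<in> rel_ideal X R \<Longrightarrow> sc c p \<in> rel_ideal X R"
  using I.I_l_closed[of p "sc c 1"] sc_one_carrier by (simp add: sc_mult_left)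

lemma pclass_eq_iff:
  assumes "a \<in> carrier (free_alg X)" "b \<in> carrier (free_alg X)"
  shows "pclass X R a = pclass X R b \<longleftrightarrow> a - b \<in> rel_ideal X R"
proof -
  have "a \<ominus>\<^bsub>free_alg X\<^esub> b = a - b"
    using assms by (simp add: a_minus_def free_alg_a_inv)
  then show ?thesis
    unfolding pclass_def using free.quotient_eq_iff_same_a_r_cos[OF I.is_ideal assms] by simp
qed

lemma zero_in_ideal: "0 \<in> rel_ideal X R"
  using additive_subgroup.zero_closed[OF I.is_additive_subgroup] by simp

lemma mem_pclass: "p \<in> pclass X R a \<longleftrightarrow> p - a \<in> rel_ideal X R"
  unfolding pclass_def a_r_coset_def'
  by (auto simp: algebra_simps intro: bexI[of _ "p - a"])

lemma pclass_self: "a \<in> pclass X R a"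
  by (simp add: mem_pclass zero_in_ideal)

lemma presented_carrier: "carrier (presented X R) = pclass X R ` carrier (free_alg X)"
  by (auto simp: presented_def quot_alg_def ring.defs module.defs FactRing_def A_RCOSETS_def' pclass_def)

lemma presented_simps:
  "mult (presented X R) = rcoset_mult (free_alg X) (rel_ideal X R)"
  "one (presented X R) = pclass X R 1" "zero (presented X R) = rel_ideal X R"
  "add (presented X R) = set_add (free_alg X)"
  by (simp_all add: presented_def quot_alg_def ring.defs module.defs FactRing_def pclass_def)

lemma pclass_mult:
  "a \<in> carrier (free_alg X) \<Longrightarrow> b \<in> carrier (free_alg X) \<Longrightarrow>
    pclass X R a \<otimes>\<^bsub>presented X R\<^esub> pclass X R b = pclass X R (a * b)"
  by (simp add: presented_simps pclass_def I.rcoset_mult_add)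

lemma pclass_add:
  "a \<in> carrier (free_alg X) \<Longrightarrow> b \<in> carrier (free_alg X) \<Longrightarrow>
    pclass X R a \<oplus>\<^bsub>presented X R\<^esub> pclass X R b = pclass X R (a + b)"
  by (simp add: presented_simps pclass_def I.a_rcos_sum)

lemma pclass_zero: "zero (presented X R) = pclass X R 0"
  using I.a_rcos_const[OF zero_in_ideal] by (simp add: presented_simps pclass_def)

text \<open>The scalar multiple of a coset is a union over its representatives; the ideal is closed
  under scalars, so they all contribute the same coset.\<close>

lemma pclass_smult:
  assumes "a \<in> carrier (free_alg X)"
  shows "c \<odot>\<^bsub>presented X R\<^esub> pclass X R a = pclass X R (sc c a)"
proof -
  have carr: "sc c x \<in> carrier (free_alg X)" if "x \<in> carrier (free_alg X)" for x :: "('g, 'k) free"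
    using that by (simp add: carrier_free_alg fmod_sc)
  have "pclass X R (sc c x) = pclass X R (sc c a)" if "x \<in> pclass X R a" for x
  proof -
    have "x - a \<in> rel_ideal X R" using that by (simp add: mem_pclass)
    moreover from this have "x \<in> carrier (free_alg X)"
      using I.Icarr[of "x - a"] free.a_closed[OF _ assms, of "x - a"] by simp
    moreover have "sc c x - sc c a = sc c (x - a)" by simp
    ultimately show ?thesis
      using assms by (subst pclass_eq_iff) (auto simp del: sc_diff_right intro: carr ideal_sc)
  qed
  moreover note pclass_self[of a]
  moreover have "c \<odot>\<^bsub>presented X R\<^esub> Y = (\<Union>x\<in>Y. pclass X R (sc c x))" for Y
    by (simp add: presented_def quot_alg_def ring.defs module.defs FactRing_def pclass_def)
  ultimately show ?thesis
    by (metis (no_types, lifting) SUP_cong SUP_constant empty_iff)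
qed

lemma free_carrier_closed:
  assumes "a \<in> carrier (free_alg X)" "b \<in> carrier (free_alg X)"
  shows "a + b \<in> carrier (free_alg X)" "a * b \<in> carrier (free_alg X)" "- a \<in> carrier (free_alg X)"
    "a - b \<in> carrier (free_alg X)" "sc c a \<in> carrier (free_alg X)"
  using assms by (auto simp: carrier_free_alg intro: fmod_add fmod_words_mult fmod_uminus fmod_sc fmod_diff)

lemma zero_one_carrier: "(0 :: ('g, 'k) free) \<in> carrier (free_alg X)"
    "(1 :: ('g, 'k) free) \<in> carrier (free_alg X)"
  using free.zero_closed free.one_closed by simp_all

lemma ring_presented: "ring (presented X R)"
proof (rule ringI)
  note simps = presented_carrier pclass_add pclass_mult pclass_zero presented_simps(2)
    free_carrier_closed zero_one_carrier
  show "abelian_group (presented X R)"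
  proof (rule abelian_groupI)
    fix x assume "x \<in> carrier (presented X R)"
    then obtain a where a: "a \<in> carrier (free_alg X)" "x = pclass X R a"
      by (auto simp: presented_carrier)
    then show "\<exists>y\<in>carrier (presented X R). y \<oplus>\<^bsub>presented X R\<^esub> x = \<zero>\<^bsub>presented X R\<^esub>"
      by (intro bexI[of _ "pclass X R (- a)"]) (auto simp: simps)
  qed (auto simp: simps algebra_simps)
  show "monoid (presented X R)"
    by (rule monoidI) (auto simp: simps mult.assoc)
qed (auto simp: presented_carrier pclass_add pclass_mult free_carrier_closed algebra_simps)

lemma pclass_closed: "a \<in> carrier (free_alg X) \<Longrightarrow> pclass X R a \<in> carrier (presented X R)"
  by (simp add: presented_carrier)

end

text \<open>Gives a meaning to \<open>the_elem\<close> of the image of a coset: the actions of the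
  quantum group and of the algebra of braids and ties are both defined in this way.\<close>

locale presented_action = letter_action g X B + presentation X R
  for g :: "'g \<Rightarrow> ('b \<Rightarrow>\<^sub>0 'k) \<Rightarrow> ('b \<Rightarrow>\<^sub>0 'k::field)" and X B R +
  assumes rel_zero: "r \<in> R \<Longrightarrow> v \<in> fmod B \<Longrightarrow> word_act g r v = 0"
begin

lemma coset_act:
  assumes "a \<in> carrier (free_alg X)" "v \<in> fmod B"
  shows "the_elem ((\<lambda>p. word_act g p v) ` pclass X R a) = word_act g a v"
proof -
  have "word_act g p v = word_act g a v" if "p \<in> pclass X R a" for p
  proof -
    have "word_act g (p - a) v = 0"
      using that rel_ideal_acts_zero[OF rels rel_zero _ assms(2)] by (simp add: mem_pclass)
    then show ?thesis by (simp add: word_act_simps)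
  qed
  then show ?thesis
    using pclass_self[of a] by (intro the_elem_image_unique) blast+
qed

end

section \<open>The quantum group acting on tensor powers\<close>

type_synonym vec = "vbasis list \<Rightarrow>\<^sub>0 kq"

definition pre :: "'a \<Rightarrow> ('a list \<Rightarrow>\<^sub>0 'k::field) \<Rightarrow> ('a list \<Rightarrow>\<^sub>0 'k)" where
  "pre x = lext (\<lambda>w. bvec (x # w))"

lemma lin_pre [simp]: "lin (pre x)"
  by (simp add: pre_def)

lemma pre_bvec: "pre x (bvec w) = bvec (x # w)"
  by (simp add: pre_def)

lemmas pre_simps = lin_simps[OF lin_pre]

lemma tens_bvec_left [simp]: "tens (bvec e) v = pre e v"
  by (simp add: tens_def pre_def)

lemma tens_lin1: "lin (\<lambda>u. tens u v)"
  by (simp add: tens_def)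

lemma lext_single: "lext f (Poly_Mapping.single b c) = sc c (f b)"
  using lext_sc[of f c "bvec b"] by (simp add: sc_bvec)

lemma lext_zero [simp]: "lext f 0 = 0"
  by (simp add: lext_def)

lemmas tens_simps = lin_simps[OF tens_lin1]

text \<open>The shape of the action of a group-like element: \<open>\<chi> e\<close> is its
  eigenvalue on the letter \<open>e\<close>, and eigenvalues multiply over tensor factors.\<close>

definition diag :: "(vbasis \<Rightarrow> kq) \<Rightarrow> vec \<Rightarrow> vec" where
  "diag \<chi> = lext (\<lambda>w. sc (prod_list (map \<chi> w)) (bvec w))"

lemma lin_diag [simp]: "lin (diag \<chi>)"
  by (simp add: diag_def)

lemma diag_bvec: "diag \<chi> (bvec w) = sc (prod_list (map \<chi> w)) (bvec w)"
  by (simp add: diag_def)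

lemma diag_pre: "diag \<chi> (pre e v) = sc (\<chi> e) (pre e (diag \<chi> v))"
  by (rule fun_cong[where x = v], rule lin_ext)
     (simp_all add: lin_intros pre_bvec diag_bvec pre_simps)

lemma diag_diag: "diag \<chi> (diag \<psi> v) = diag (\<lambda>e. \<chi> e * \<psi> e) v"
proof (rule fun_cong[where x = v], rule lin_ext)
  show "diag \<chi> (diag \<psi> (bvec w)) = diag (\<lambda>e. \<chi> e * \<psi> e) (bvec w)" for w
  proof -
    have "prod_list (map \<psi> w) * prod_list (map \<chi> w) = prod_list (map (\<lambda>e. \<chi> e * \<psi> e) w)"
      by (induction w) (simp_all add: ac_simps)
    then show ?thesis
      by (simp add: diag_bvec lin_scale[OF lin_diag])
  qed
qed (simp_all add: lin_intros)

lemma diag_one: "diag (\<lambda>e. 1) v = v"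
proof (rule fun_cong[where x = v], rule lin_ext)
  show "diag (\<lambda>e. 1) (bvec w) = bvec w" for w
  proof -
    have "prod_list (map (\<lambda>e. 1 :: kq) w) = 1"
      by (induction w) simp_all
    then show ?thesis by (simp add: diag_bvec)
  qed
qed simp_all

definition gwt :: "nat \<Rightarrow> idx \<Rightarrow> vbasis \<Rightarrow> kq" where
  "gwt b a e = (if e = (b, a) then q else 1)"

text \<open>\<open>kwt b\<close> is the weight of the usual \<open>K = K\<^sub>1 K\<^sub>2\<^sup>-\<^sup>1\<close> of the \<open>b\<close>-th copy.\<close>

definition kwt :: "nat \<Rightarrow> vbasis \<Rightarrow> kq" where
  "kwt b e = (if e = (b, I1) then q else if e = (b, I2) then inverse q else 1)"

definition kinvwt :: "nat \<Rightarrow> vbasis \<Rightarrow> kq" where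
  "kinvwt b e = (if e = (b, I1) then inverse q else if e = (b, I2) then q else 1)"

abbreviation Kop :: "nat \<Rightarrow> vec \<Rightarrow> vec" where "Kop b \<equiv> diag (kwt b)"
abbreviation Kinv :: "nat \<Rightarrow> vec \<Rightarrow> vec" where "Kinv b \<equiv> diag (kinvwt b)"

text \<open>The iterated coproduct unfolded at the first letter, here and in \<open>fword\<close>.
  Unlike \<open>tact\<close>, these operators do not carry the number of tensor factors;
  \<open>tact_eq_uop\<close> identifies the two.\<close>

primrec eword :: "nat \<Rightarrow> vbasis list \<Rightarrow> vec" where
  "eword b [] = 0"
| "eword b (e # w) = (if e = (b, I2) then bvec ((b, I1) # w) else 0) + sc (kwt b e) (pre e (eword b w))"

primrec fword :: "nat \<Rightarrow> vbasis list \<Rightarrow> vec" where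
  "fword b [] = 0"
| "fword b (e # w) = (if e = (b, I1) then pre (b, I2) (Kinv b (bvec w)) else 0) + pre e (fword b w)"

definition Eop :: "nat \<Rightarrow> vec \<Rightarrow> vec" where "Eop b = lext (eword b)"
definition Fop :: "nat \<Rightarrow> vec \<Rightarrow> vec" where "Fop b = lext (fword b)"

lemma lin_Eop [simp]: "lin (Eop b)" and lin_Fop [simp]: "lin (Fop b)"
  by (simp_all add: Eop_def Fop_def)

lemma Eop_nil [simp]: "Eop b (bvec []) = 0" and Fop_nil [simp]: "Fop b (bvec []) = 0"
  by (simp_all add: Eop_def Fop_def)

lemma diag_nil [simp]: "diag \<chi> (bvec []) = bvec []"
  by (simp add: diag_bvec)

lemma Eop_zero [simp]: "Eop b 0 = 0" and Fop_zero [simp]: "Fop b 0 = 0"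
  and diag_zero [simp]: "diag \<chi> 0 = 0" and pre_zero [simp]: "pre x 0 = 0"
  by (simp_all add: lin_zero)

lemma Eop_pre:
  "Eop b (pre e v) = (if e = (b, I2) then pre (b, I1) v else 0) + sc (kwt b e) (pre e (Eop b v))"
proof (rule fun_cong[where x = v], rule lin_ext)
  show "Eop b (pre e (bvec w)) =
    (if e = (b, I2) then pre (b, I1) (bvec w) else 0) + sc (kwt b e) (pre e (Eop b (bvec w)))" for w
    by (simp add: Eop_def pre_bvec)
qed (cases "e = (b, I2)"; simp add: lin_intros)+

lemma Fop_pre:
  "Fop b (pre e v) = (if e = (b, I1) then pre (b, I2) (Kinv b v) else 0) + pre e (Fop b v)"
proof (rule fun_cong[where x = v], rule lin_ext)
  show "Fop b (pre e (bvec w)) =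
    (if e = (b, I1) then pre (b, I2) (Kinv b (bvec w)) else 0) + pre e (Fop b (bvec w))" for w
    by (simp add: Fop_def pre_bvec)
qed (cases "e = (b, I1)"; simp add: lin_intros)+

lemmas op_simps = lin_simps[OF lin_Eop] lin_simps[OF lin_Fop] lin_simps[OF lin_diag] pre_simps
  Eop_pre Fop_pre diag_pre

lemma op_induct:
  assumes "lin f" "lin g" "f (bvec []) = g (bvec [])"
    "\<And>e w. f (bvec w) = g (bvec w) \<Longrightarrow> f (pre e (bvec w)) = g (pre e (bvec w))"
  shows "f v = g v"
proof (rule fun_cong[where x = v], rule lin_ext[OF assms(1,2)])
  show "f (bvec w) = g (bvec w)" for w
    by (induction w) (use assms(3,4) in \<open>simp_all add: pre_bvec\<close>)
qed

text \<open>\<open>E\<close> of the copy \<open>b\<close> replaces one letter \<open>(b, I2)\<close>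
  by \<open>(b, I1)\<close>, which multiplies the eigenvalue by \<open>t\<close>.\<close>

lemma diag_Eop:
  assumes "\<chi> (b, I1) = t * \<chi> (b, I2)"
  shows "diag \<chi> (Eop b v) = sc t (Eop b (diag \<chi> v))"
  by (rule op_induct[where v = v])
     (auto simp: lin_intros op_simps assms ac_simps)

lemma diag_Fop:
  assumes "\<chi> (b, I2) = t * \<chi> (b, I1)"
  shows "diag \<chi> (Fop b v) = sc t (Fop b (diag \<chi> v))"
  by (rule op_induct[where v = v])
     (auto simp: lin_intros op_simps assms ac_simps diag_diag)

lemma q_inv [simp]: "q * inverse q = 1" "inverse q * q = 1" "q * (inverse q * x) = x" "inverse q * (q * x) = x"
  using q_nz by (simp_all add: field_simps)

lemma Kop_Kinv [simp]: "Kop b (Kinv b v) = v" "Kinv b (Kop b v) = v"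
proof -
  have "(\<lambda>e. kwt b e * kinvwt b e) = (\<lambda>e. 1)" "(\<lambda>e. kinvwt b e * kwt b e) = (\<lambda>e. 1)"
    by (auto simp: kwt_def kinvwt_def)
  then show "Kop b (Kinv b v) = v" "Kinv b (Kop b v) = v"
    by (simp_all add: diag_diag diag_one)
qed

lemma Eop_Eop_commute: "b \<noteq> c \<Longrightarrow> Eop b (Eop c v) = Eop c (Eop b v)"
  by (rule op_induct[where v = v]) (auto simp: lin_intros op_simps kwt_def)

lemma Kinv_Fop: "Kinv b (Fop c v) = sc (if b = c then q * q else 1) (Fop c (Kinv b v))"
  by (rule diag_Fop) (simp add: kinvwt_def)

lemma Kinv_Eop: "Kinv b (Eop c v) = sc (if b = c then inverse q * inverse q else 1) (Eop c (Kinv b v))"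
  by (rule diag_Eop) (simp add: kinvwt_def)

lemma Fop_Fop_commute: "b \<noteq> c \<Longrightarrow> Fop b (Fop c v) = Fop c (Fop b v)"
  by (rule op_induct[where v = v]) (auto simp: lin_intros op_simps kinvwt_def Kinv_Fop)

lemma Eop_Fop_commute: "b \<noteq> c \<Longrightarrow> Eop b (Fop c v) = Fop c (Eop b v)"
  by (rule op_induct[where v = v]) (auto simp: lin_intros op_simps kwt_def kinvwt_def Kinv_Eop)

text \<open>A positive power of the indeterminate vanishes at 0, unlike the constant polynomial
  1.\<close>

lemma q_powers_ne_1: "k > 0 \<Longrightarrow> q ^ k \<noteq> 1"
proof
  assume k: "k > 0" and *: "q ^ k = 1"
  have "q ^ k = Fract ([:0, 1:] ^ k) 1"
    unfolding q_def by (induction k) (simp_all add: One_fract_def)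
  with * have "Fract ([:0, 1:] ^ k) 1 = (Fract 1 1 :: kq)"
    by (simp add: One_fract_def)
  then have "([:0, 1:] :: complex poly) ^ k = 1"
    by (simp add: eq_fract)
  then have "poly (([:0, 1:] :: complex poly) ^ k) 0 = 1"
    by simp
  then show False
    using k by (simp add: poly_power zero_power)
qed

lemma q_minus_inv_nz: "q - inverse q \<noteq> 0"
proof
  assume "q - inverse q = 0"
  then have "q ^ 2 = 1"
    using q_nz by (simp add: power2_eq_square field_simps)
  then show False using q_powers_ne_1[of 2] by simp
qed

lemma Eop_Fop:
  "Eop b (Fop b v) - Fop b (Eop b v :: vec) = sc (inverse (q - inverse q)) (Kop b v - Kinv b v)"
proof -
  let ?c = "inverse (q - inverse q)"
  have c: "?c * (q - inverse q) = 1" using q_minus_inv_nz by simp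
  \<comment> \<open>These rewritings trade \<open>q\<close> times \<open>?c\<close> for
    \<open>inverse q\<close> times \<open>?c\<close>, so that both sides reach a common normal
    form.\<close>
  have c1: "?c * q = 1 + ?c * inverse q" "q * ?c = 1 + inverse q * ?c"
    using c by (simp_all add: algebra_simps)
  have "(\<lambda>v. Eop b (Fop b v)) v = (\<lambda>v. Fop b (Eop b v) + sc ?c (Kop b v - Kinv b v)) v"
  proof (rule op_induct[where v = v])
    fix e :: vbasis and w :: "vbasis list"
    let ?v = "bvec w :: vec"
    assume IH: "Eop b (Fop b ?v) = Fop b (Eop b ?v) + sc ?c (Kop b ?v - Kinv b ?v)"
    consider "e = (b, I1)" | "e = (b, I2)" | "e \<noteq> (b, I1)" "e \<noteq> (b, I2)" by blast
    then show "Eop b (Fop b (pre e ?v)) =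
        Fop b (Eop b (pre e ?v)) + sc ?c (Kop b (pre e ?v) - Kinv b (pre e ?v))"
    proof cases
      case 1
      then show ?thesis
        by (simp add: op_simps kwt_def kinvwt_def IH Kinv_Eop c1 sc_add_left mult.assoc[symmetric])
           (simp add: c1 sc_add_left algebra_simps)
    next
      case 2
      then show ?thesis
        by (simp add: op_simps kwt_def kinvwt_def IH Kinv_Eop c1 sc_add_left mult.assoc[symmetric])
           (simp add: c1 sc_add_left algebra_simps)
    next
      case 3
      then show ?thesis
        by (simp add: op_simps kwt_def kinvwt_def IH)
    qed
  qed (simp_all add: lin_intros)
  then show ?thesis by simp
qed

fun uop :: "nat \<times> glgen \<Rightarrow> vec \<Rightarrow> vec" where
  "uop (b, GE) = Eop b"
| "uop (b, GF) = Fop b"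
| "uop (b, GK a) = diag (gwt b a)"
| "uop (b, GKinv a) = diag (\<lambda>e. inverse (gwt b a e))"

lemma lin_uop [simp]: "lin (uop g)"
  by (cases g rule: uop.cases) simp_all

definition words :: "nat \<Rightarrow> vbasis list set" where
  "words n = {w. length w = n}"

lemma lin_tact [simp]: "lin (tact n g)"
  by (cases n; cases g) (simp_all add: lin_intros)

lemma pre_words: "v \<in> fmod (words n) \<Longrightarrow> pre e v \<in> fmod (words (Suc n))"
  by (rule lin_fmod[OF lin_pre]) (auto simp: words_def pre_bvec)

lemma uop_words: "v \<in> fmod (words n) \<Longrightarrow> uop g v \<in> fmod (words n)"
proof (rule lin_fmod[OF lin_uop])
  show "uop g (bvec w) \<in> fmod (words n)" if "w \<in> words n" for w
    using that
  proof (induction w arbitrary: n)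
    case Nil
    then show ?case
      by (cases g rule: uop.cases) auto
  next
    case (Cons e w)
    then obtain m where n: "n = Suc m" "w \<in> words m"
      by (cases n) (auto simp: words_def)
    have v: "bvec w \<in> fmod (words m)"
      using n by simp
    have d: "diag \<chi> (bvec w) \<in> fmod (words m)" for \<chi>
      using v by (simp add: diag_bvec fmod_sc)
    have "uop g (bvec (e # w)) = uop g (pre e (bvec w))"
      by (simp add: pre_bvec)
    also have "\<dots> \<in> fmod (words n)"
      using Cons.IH[OF n(2)] v d unfolding n(1)
      by (cases g rule: uop.cases) (auto simp: op_simps intro!: fmod_add fmod_sc pre_words)
    finally show ?case .
  qed
qed

lemma vact_GE: "vact (b, GE) (bvec e) = (if e = (b, I2) then bvec (b, I1) else 0)"
proof (cases e)
  case (Pair c i)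
  then show ?thesis by (cases i) simp_all
qed

lemma vact_GF: "vact (b, GF) (bvec e) = (if e = (b, I1) then bvec (b, I2) else 0)"
proof (cases e)
  case (Pair c i)
  then show ?thesis by (cases i) simp_all
qed

lemma vact_GK: "vact (b, GK a) (bvec e) = sc (gwt b a e) (bvec e)"
proof (cases e)
  case (Pair c i)
  then show ?thesis by (simp add: gwt_def lext_single)
qed

lemma vact_GKinv: "vact (b, GKinv a) (bvec e) = sc (inverse (gwt b a e)) (bvec e)"
proof (cases e)
  case (Pair c i)
  then show ?thesis by (simp add: gwt_def lext_single)
qed

lemma vact_KK: "vact (b, GK I1) (vact (b, GKinv I2) (bvec e)) = sc (kwt b e) (bvec e)"
proof -
  have "vact (b, GK I1) (vact (b, GKinv I2) (bvec e)) = sc (inverse (gwt b I2 e)) (vact (b, GK I1) (bvec e))"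
    unfolding vact_GKinv unfolding vact.simps lext_sc ..
  also have "\<dots> = sc (kwt b e) (bvec e)"
    unfolding vact_GK by (simp add: gwt_def kwt_def del: vec.scale_cancel_right)
  finally show ?thesis .
qed

lemma tact_eq_uop: "v \<in> fmod (words n) \<Longrightarrow> tact n g v = uop g v"
proof (induction n arbitrary: g v)
  case 0
  have "tact 0 g (bvec w) = uop g (bvec w)" if "w \<in> words 0" for w
    using that by (cases g rule: uop.cases) (auto simp: words_def)
  then show ?case
    by (rule lin_eq_on[OF lin_tact lin_uop _ 0])
next
  case (Suc n)
  have "tact (Suc n) g (bvec w) = uop g (bvec w)" if w: "w \<in> words (Suc n)" for w
  proof -
    obtain e w' where ew: "w = e # w'" and w': "w' \<in> words n"
      using w by (cases w) (auto simp: words_def)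
    obtain c i where e: "e = (c, i)" by fastforce
    have v: "bvec w' \<in> fmod (words n)" using w' by simp
    have tt: "tact n h (tact n h' (bvec w')) = uop h (uop h' (bvec w'))" for h h'
      using Suc.IH[of _ h] Suc.IH[OF v, of h'] uop_words[OF v, of h'] by simp
    have "(\<lambda>e. inverse (gwt b I1 e) * gwt b I2 e) = kinvwt b" for b
      by (auto simp: gwt_def kinvwt_def)
    then have k: "diag (\<lambda>e. inverse (gwt b I1 e)) (diag (gwt b I2) u) = Kinv b u" for b u
      by (simp add: diag_diag)
    have kk: "tact n (b, GKinv I1) (tact n (b, GK I2) (bvec w')) = Kinv b (bvec w')" for b
      by (simp add: tt k)
    have "tact (Suc n) g (bvec w) = uop g (pre e (bvec w'))"
    proof (cases g rule: uop.cases)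
      case (1 b)
      have "tact (Suc n) g (bvec w) = tens (vact (b, GE) (bvec e)) (bvec w') +
          tens (vact (b, GK I1) (vact (b, GKinv I2) (bvec e))) (uop g (bvec w'))"
        by (simp add: 1 ew Suc.IH[OF v] del: vact.simps)
      then show ?thesis
        by (simp only: vact_GE vact_KK) (simp add: 1 Eop_pre tens_simps)
    next
      case (2 b)
      have "tact (Suc n) g (bvec w) = tens (vact (b, GF) (bvec e)) (Kinv b (bvec w')) +
          tens (bvec e) (uop g (bvec w'))"
        by (simp add: 2 ew Suc.IH[OF v, of "(b, GF)"] kk del: vact.simps)
      then show ?thesis
        by (simp only: vact_GF) (simp add: 2 Fop_pre tens_simps)
    next
      case (3 b a)
      have "tact (Suc n) g (bvec w) = tens (vact (b, GK a) (bvec e)) (uop g (bvec w'))"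
        by (simp add: 3 ew Suc.IH[OF v] del: vact.simps)
      then show ?thesis
        by (simp only: vact_GK) (simp add: 3 diag_pre tens_simps)
    next
      case (4 b a)
      have "tact (Suc n) g (bvec w) = tens (vact (b, GKinv a) (bvec e)) (uop g (bvec w'))"
        by (simp add: 4 ew Suc.IH[OF v] del: vact.simps)
      then show ?thesis
        by (simp only: vact_GKinv) (simp add: 4 diag_pre tens_simps)
    qed
    then show ?thesis by (simp add: ew pre_bvec)
  qed
  then show ?case
    by (rule lin_eq_on[OF lin_tact lin_uop _ Suc.prems])
qed

lemma Urels_carrier: "Urels d \<subseteq> carrier (free_alg (Ugens d))"
proof -
  interpret ring "free_alg (Ugens d) :: (kq, (nat \<times> glgen, kq) free) module" by (rule ring_free_alg)
  have g: "gen (b, x) \<in> fmod {w. set (letters w) \<subseteq> Ugens d}" if "b \<in> {1..d}" for b x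
    using that gen_in_free_alg[of "(b, x)" "Ugens d"] by (simp add: carrier_free_alg Ugens_def)
  have "(1 :: (nat \<times> glgen, kq) free) \<in> fmod {w. set (letters w) \<subseteq> Ugens d}"
    using one_closed by (simp add: carrier_free_alg)
  then show ?thesis
    unfolding Urels_def gl2_rels_def Let_def carrier_free_alg
    by (auto intro!: fmod_diff fmod_words_mult fmod_sc g)
qed

global_interpretation T: letter_action "tact n" UNIV "words n" for n
  by unfold_locales (simp_all add: tact_eq_uop uop_words)

lemma word_act_tact: "v \<in> fmod (words n) \<Longrightarrow> word_act (tact n) p v = word_act uop p v"
proof -
  assume v: "v \<in> fmod (words n)"
  have "foldr (tact n) ws v = foldr uop ws v" for ws
  proof (induction ws)
    case (Cons x ws)
    have "foldr (tact n) ws v \<in> fmod (words n)"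
      using v by (intro T.foldr_closed) auto
    then show ?case
      using Cons by (simp add: tact_eq_uop)
  qed simp
  then show ?thesis by (simp add: word_act_def)
qed

global_interpretation Uop: letter_action uop UNIV UNIV
  by unfold_locales simp_all

lemma uop_rels_zero: "r \<in> Urels d \<Longrightarrow> word_act uop r v = 0"
proof -
  have g: "(\<lambda>e. gwt b a e * inverse (gwt b a e)) = (\<lambda>e. 1)"
    "(\<lambda>e. inverse (gwt b a e) * gwt b a e) = (\<lambda>e. 1)" for a b
    using q_nz by (auto simp: gwt_def)
  have k: "(\<lambda>e. gwt b I1 e * inverse (gwt b I2 e)) = kwt b"
    "(\<lambda>e. inverse (gwt b I1 e) * gwt b I2 e) = kinvwt b"
    "(\<lambda>e. inverse (gwt b I2 e) * gwt b I1 e) = kwt b"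
    "(\<lambda>e. gwt b I2 e * inverse (gwt b I1 e)) = kinvwt b"
    "(\<lambda>e. gwt b I1 e * gwt b I2 e) = (\<lambda>e. gwt b I2 e * gwt b I1 e)" for b
    by (auto simp: gwt_def kinvwt_def kwt_def)
  have dd: "diag \<chi> (diag \<psi> v) = diag \<psi> (diag \<chi> v)" for \<chi> \<psi> v
    by (simp add: diag_diag mult.commute)
  have DE: "diag (gwt b a) (Eop c v) = sc (if b = c then (if a = I1 then q else inverse q) else 1) (Eop c (diag (gwt b a) v))"
    "diag (\<lambda>e. inverse (gwt b a e)) (Eop c v) = sc (if b = c then (if a = I1 then inverse q else q) else 1) (Eop c (diag (\<lambda>e. inverse (gwt b a e)) v))"
    "diag (gwt b a) (Fop c v) = sc (if b = c then (if a = I1 then inverse q else q) else 1) (Fop c (diag (gwt b a) v))"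
    "diag (\<lambda>e. inverse (gwt b a e)) (Fop c v) = sc (if b = c then (if a = I1 then q else inverse q) else 1) (Fop c (diag (\<lambda>e. inverse (gwt b a e)) v))"
    for a b c v
    by (intro diag_Eop diag_Fop; cases a; simp add: gwt_def)+
  assume "r \<in> Urels d"
  then consider b where "r \<in> gl2_rels (Pair b)"
    | b c x y where "b \<noteq> c" "r = gen (b, x) * gen (c, y) - gen (c, y) * gen (b, x)"
    unfolding Urels_def by blast
  then show ?thesis
  proof cases
    case 1
    then show ?thesis
      unfolding gl2_rels_def Let_def
      by (auto simp: word_act_simps Uop.word_act_mult diag_diag g diag_one dd Eop_Fop k DE)
  next
    case 2
    then show ?thesis
      by (cases x; cases y)
         (simp_all add: word_act_simps Uop.word_act_mult Eop_Eop_commute Fop_Fop_commute Eop_Fop_commute DE dd)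
  qed
qed

lemma tbasis_words: "tbasis d n \<subseteq> words n"
  by (auto simp: tbasis_def words_def)

lemma tpow_words: "v \<in> tpow d n \<Longrightarrow> v \<in> fmod (words n)"
  using fmod_mono tbasis_words by blast

lemma pre_tpow: "v \<in> tpow d n \<Longrightarrow> fst e \<in> {1..d} \<Longrightarrow> pre e v \<in> tpow d (Suc n)"
  by (rule lin_fmod[OF lin_pre]) (auto simp: tbasis_def pre_bvec mem_Times_iff)

lemma uop_tpow: "v \<in> tpow d n \<Longrightarrow> uop g v \<in> tpow d n"
proof (rule lin_fmod[OF lin_uop])
  show "uop g (bvec w) \<in> tpow d n" if "w \<in> tbasis d n" for w
    using that
  proof (induction w arbitrary: n)
    case Nil
    then show ?case
      by (cases g rule: uop.cases) auto
  next
    case (Cons e w)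
    then obtain m where n: "n = Suc m" "w \<in> tbasis d m" "fst e \<in> {1..d}"
      by (cases n) (auto simp: tbasis_def mem_Times_iff)
    have v: "bvec w \<in> tpow d m"
      using n by simp
    have dg: "diag \<chi> (bvec w) \<in> tpow d m" for \<chi>
      using v by (simp add: diag_bvec fmod_sc)
    have "uop g (bvec (e # w)) = uop g (pre e (bvec w))"
      by (simp add: pre_bvec)
    also have "\<dots> \<in> tpow d n"
      using Cons.IH[OF n(2)] v dg n(3) unfolding n(1)
      by (cases g rule: uop.cases) (auto simp: op_simps intro!: fmod_add fmod_sc pre_tpow)
    finally show ?case .
  qed
qed

lemma lin_Sact [simp]: "lin (Sact s)"
  by (simp add: Sact_def)

lemma Sact_bvec: "Sact s (bvec w) = bvec (map (\<lambda>(b, i). (s b, i)) w)"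
  by (simp add: Sact_def)

lemma Sact_tpow: "s permutes {1..d} \<Longrightarrow> v \<in> tpow d n \<Longrightarrow> Sact s v \<in> tpow d n"
proof (rule lin_fmod[OF lin_Sact])
  assume s: "s permutes {1..d}"
  show "Sact s (bvec w) \<in> tpow d n" if "w \<in> tbasis d n" for w
    using that permutes_in_image[OF s] by (fastforce simp: tbasis_def Sact_bvec)
qed

global_interpretation U: presented_action "tact n" "Ugens d" "words n" "Urels d" for n d
proof unfold_locales
  show "word_act (tact n) r v = 0" if "r \<in> Urels d" "v \<in> fmod (words n)" for n d r v
    using that by (simp add: word_act_tact uop_rels_zero)
qed (simp_all add: tact_eq_uop uop_words Urels_carrier)

lemma free_act_eq: "free_act n p v = word_act (tact n) p v"
  by (simp add: free_act_def word_act_def)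

lemma Uact_pclass:
  assumes "p \<in> carrier (free_alg (Ugens d))" "v \<in> tpow d' n"
  shows "Uact n (pclass (Ugens d) (Urels d) p) v = word_act uop p v"
  unfolding Uact_def free_act_eq
  using U.coset_act[OF assms(1) tpow_words[OF assms(2)]] word_act_tact[OF tpow_words[OF assms(2)]]
  by simp

definition tlin :: "nat \<Rightarrow> nat \<Rightarrow> (vec \<Rightarrow> vec) \<Rightarrow> bool" where
  "tlin d n f \<longleftrightarrow> f \<in> tpow d n \<rightarrow>\<^sub>E tpow d n \<and>
     (\<forall>u\<in>tpow d n. \<forall>v\<in>tpow d n. f (u + v) = f u + f v) \<and> (\<forall>c. \<forall>v\<in>tpow d n. f (sc c v) = sc c (f v))"

lemma tlin_lext:
  assumes "tlin d n f" "v \<in> tpow d n"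
  shows "f v = lext (\<lambda>w. f (bvec w)) v"
proof -
  have *: "f (\<Sum>b\<in>A. sc (c b) (bvec b)) = (\<Sum>b\<in>A. sc (c b) (f (bvec b)))"
    if "finite A" "A \<subseteq> tbasis d n" for A and c :: "vbasis list \<Rightarrow> kq"
    using that
  proof (induction A)
    case empty
    have "f (sc 0 0) = sc 0 (f 0)"
      using assms(1) fmod_zero unfolding tlin_def by blast
    then show ?case by simp
  next
    case (insert x A)
    then have "sc (c x) (bvec x) \<in> tpow d n" "(\<Sum>b\<in>A. sc (c b) (bvec b)) \<in> tpow d n"
      by (auto intro!: fmod_sum fmod_sc)
    then have "f (sc (c x) (bvec x) + (\<Sum>b\<in>A. sc (c b) (bvec b))) =
        f (sc (c x) (bvec x)) + f (\<Sum>b\<in>A. sc (c b) (bvec b))"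
      using assms(1) unfolding tlin_def by blast
    moreover have "f (sc (c x) (bvec x)) = sc (c x) (f (bvec x))"
      using assms(1) insert.prems fmod_bvec[of x "tbasis d n"] unfolding tlin_def by blast
    ultimately show ?case using insert by simp
  qed
  have "f v = f (\<Sum>b\<in>Poly_Mapping.keys v. sc (Poly_Mapping.lookup v b) (bvec b))"
    using vec_expand[of v] by simp
  also have "\<dots> = lext (\<lambda>w. f (bvec w)) v"
    unfolding lext_def using assms(2) by (intro *) (auto simp: fmod_def)
  finally show ?thesis .
qed

text \<open>Only the carrier of the smash product enters the definition of its module endomorphisms, so it
  suffices to commute with the generators of the quantum group and with the permutations.\<close>

lemma End_UqS_I:
  assumes f: "tlin d n f"
    and U: "\<And>b x v. b \<in> {1..d} \<Longrightarrow> v \<in> tpow d n \<Longrightarrow> f (uop (b, x) v) = uop (b, x) (f v)"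
    and S: "\<And>s v. s permutes {1..d} \<Longrightarrow> v \<in> tpow d n \<Longrightarrow> f (Sact s v) = Sact s (f v)"
  shows "f \<in> carrier (End_UqS d n)"
proof -
  define L where "L = lext (\<lambda>w. f (bvec w))"
  have L: "f v = L v" if "v \<in> tpow d n" for v
    unfolding L_def using tlin_lext[OF f that] .
  have lin: "lin L" by (simp add: L_def)
  have cl: "f v \<in> tpow d n" if "v \<in> tpow d n" for v
    using f that by (auto simp: tlin_def)
  interpret W: letter_action uop "Ugens d" "tbasis d n"
    by unfold_locales (simp_all add: uop_tpow)
  have fold: "f (foldr uop ws v) = foldr uop ws (f v)" if "v \<in> tpow d n" "set ws \<subseteq> Ugens d" for ws v
    using that(2)
  proof (induction ws)
    case (Cons g ws)
    then have "foldr uop ws v \<in> tpow d n"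
      using that(1) by (intro W.foldr_closed) auto
    moreover obtain b x where "g = (b, x)" "b \<in> {1..d}"
      using Cons.prems by (cases g) (auto simp: Ugens_def)
    ultimately show ?case
      using Cons U by simp
  qed simp
  have word: "f (word_act uop p v) = word_act uop p (f v)"
    if "v \<in> tpow d n" "p \<in> carrier (free_alg (Ugens d))" for v p
  proof -
    have "L (word_act uop p v) = word_act uop p (f v)"
    proof (rule lin_eq_on[OF lin_comp[OF lin word_act_lin1] word_act_lin1])
      show "p \<in> fmod {w. set (letters w) \<subseteq> Ugens d}"
        using that(2) by (simp add: carrier_free_alg)
      show "L (word_act uop (bvec w) v) = word_act uop (bvec w) (f v)"
        if "w \<in> {w. set (letters w) \<subseteq> Ugens d}" for w
        using that \<open>v \<in> tpow d n\<close> W.foldr_closed[of "letters w" v] L[of "foldr uop (letters w) v"] fold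
        by simp
    qed
    then show ?thesis
      using L[OF W.word_act_closed[OF that(2,1)]] by simp
  qed
  have "f (UqS_act d n h v) = UqS_act d n h (f v)"
    if h: "h \<in> carrier (UqS d)" and v: "v \<in> tpow d n" for h v
  proof -
    have "f (Uact n (h s) (Sact s v)) = Uact n (h s) (Sact s (f v)) \<and> Uact n (h s) (Sact s v) \<in> tpow d n"
      if s: "s \<in> carrier (sym_group d)" for s
    proof -
      have "h s \<in> carrier (Uq d)"
        using h s by (auto simp: UqS_def smash_def)
      then obtain p where p: "p \<in> carrier (free_alg (Ugens d))" "h s = pclass (Ugens d) (Urels d) p"
        by (auto simp: Uq_def U.presented_carrier)
      have s': "s permutes {1..d}" using s by (simp add: sym_group_carrier)
      have "Sact s v \<in> tpow d n" "Sact s (f v) \<in> tpow d n"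
        using Sact_tpow[OF s'] v cl by auto
      then show ?thesis
        using word[OF _ p(1)] S[OF s' v] W.word_act_closed[OF p(1)] by (simp add: p(2) Uact_pclass[OF p(1)])
    qed
    note * = this
    have "f (UqS_act d n h v) = L (UqS_act d n h v)"
      unfolding UqS_act_def using * by (intro L fmod_sum) auto
    also have "\<dots> = (\<Sum>s\<in>carrier (sym_group d). L (Uact n (h s) (Sact s v)))"
      unfolding UqS_act_def by (rule lin_sum[OF lin])
    also have "\<dots> = UqS_act d n h (f v)"
      unfolding UqS_act_def using * L by (intro sum.cong) metis+
    finally show ?thesis .
  qed
  then show ?thesis
    using f by (simp add: End_UqS_def End_alg_def tlin_def)
qed

lemma End_UqS_D:
  assumes f: "f \<in> carrier (End_UqS d n)"
  shows "tlin d n f"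
    and "b \<in> {1..d} \<Longrightarrow> v \<in> tpow d n \<Longrightarrow> f (uop (b, x) v) = uop (b, x) (f v)"
    and "s permutes {1..d} \<Longrightarrow> v \<in> tpow d n \<Longrightarrow> f (Sact s v) = Sact s (f v)"
proof -
  show t: "tlin d n f"
    using f by (simp add: End_UqS_def End_alg_def tlin_def)
  have cl: "f v \<in> tpow d n" if "v \<in> tpow d n" for v
    using t that by (auto simp: tlin_def)
  let ?pc = "pclass (Ugens d) (Urels d)"
  let ?F = "carrier (free_alg (Ugens d)) :: (nat \<times> glgen, kq) free set"
  \<comment> \<open>\<open>h s p\<close> is the element \<open>p\<close> times \<open>s\<close> of
    the smash product. Taking \<open>p = 1\<close> isolates the permutations, and
    \<open>s = id\<close> the generators of the quantum group.\<close>
  define h where "h s p = (\<lambda>s'\<in>carrier (sym_group d). if s' = s then ?pc p else ?pc 0)"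
    for s :: "nat \<Rightarrow> nat" and p :: "(nat \<times> glgen, kq) free"
  have h: "h s p \<in> carrier (UqS d)" if "p \<in> ?F" for s p
    using that U.pclass_closed U.zero_one_carrier by (auto simp: h_def UqS_def smash_def Uq_def)
  have act: "UqS_act d n (h s p) v = word_act uop p (Sact s v)"
    if "v \<in> tpow d n" "p \<in> ?F" "s permutes {1..d}" for v s p
  proof -
    have "Uact n (h s p s') (Sact s' v) = (if s' = s then word_act uop p (Sact s v) else 0)"
      if "s' \<in> carrier (sym_group d)" for s'
    proof -
      have "Sact s' v \<in> tpow d n"
        using Sact_tpow that \<open>v \<in> tpow d n\<close> by (simp add: sym_group_carrier)
      then show ?thesis
        using that Uact_pclass[OF \<open>p \<in> ?F\<close>, of "Sact s' v" d n] Uact_pclass[OF U.zero_one_carrier(1), of "Sact s' v" d n d]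
        by (auto simp: h_def word_act_simps)
    qed
    then have "UqS_act d n (h s p) v =
        (\<Sum>s'\<in>carrier (sym_group d). if s' = s then word_act uop p (Sact s v) else 0)"
      unfolding UqS_act_def by (rule sum.cong[OF refl])
    moreover have "finite (carrier (sym_group d))"
      using finite_permutations[of "{1..d}"] by (simp add: sym_group_def)
    ultimately show ?thesis
      using that(3) by (simp add: sym_group_carrier)
  qed
  have comm: "f (word_act uop p (Sact s v)) = word_act uop p (Sact s (f v))"
    if "v \<in> tpow d n" "p \<in> ?F" "s permutes {1..d}" for v s p
  proof -
    have "f (UqS_act d n (h s p) v) = UqS_act d n (h s p) (f v)"
      using f h[OF that(2)] that(1) by (simp add: End_UqS_def End_alg_def)
    then show ?thesis using act that cl by simp
  qed
  show "f (Sact s v) = Sact s (f v)" if "s permutes {1..d}" "v \<in> tpow d n"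
    using comm[OF that(2) U.zero_one_carrier(2) that(1)] by simp
  have "Sact id v = v" for v
    by (rule fun_cong[where x = v], rule lin_ext) (auto simp: Sact_bvec)
  then show "f (uop (b, x) v) = uop (b, x) (f v)" if "b \<in> {1..d}" "v \<in> tpow d n"
    using comm[OF that(2), of "gen (b, x)" id] that(1) permutes_id by (simp add: Ugens_def)
qed

section \<open>The operators of the braid generators and ties\<close>

text \<open>Positions count from 0 and the recursion peels off letters, so that a local relation at
  position \<open>i\<close> becomes one at the start of a word. Words too short for the crossing are
  fixed.\<close>

fun sgw :: "nat \<Rightarrow> vbasis list \<Rightarrow> vec" where
  "sgw 0 (x # y # w) = lext (\<lambda>(x', y'). bvec (x' # y' # w)) (sigma2 x y)"
| "sgw (Suc i) (x # w) = pre x (sgw i w)"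
| "sgw i w = bvec w"

fun epw :: "nat \<Rightarrow> vbasis list \<Rightarrow> vec" where
  "epw 0 (x # y # w) = (if fst x = fst y then bvec (x # y # w) else 0)"
| "epw (Suc i) (x # w) = pre x (epw i w)"
| "epw i w = bvec w"

definition SG :: "nat \<Rightarrow> vec \<Rightarrow> vec" where "SG i = lext (sgw i)"
definition EP :: "nat \<Rightarrow> vec \<Rightarrow> vec" where "EP i = lext (epw i)"

lemma lin_SG [simp]: "lin (SG i)" and lin_EP [simp]: "lin (EP i)"
  by (simp_all add: SG_def EP_def)

lemma SG_zero [simp]: "SG i 0 = 0" and EP_zero [simp]: "EP i 0 = 0"
  by (simp_all add: lin_zero)

lemma lin_ops [simp]:
  "lin f \<Longrightarrow> lin (\<lambda>v. pre x (f v))" "lin g \<Longrightarrow> lin (\<lambda>v. SG i (g v))" "lin g \<Longrightarrow> lin (\<lambda>v. EP i (g v))"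
  "lin g \<Longrightarrow> lin (\<lambda>v. Eop b (g v))" "lin g \<Longrightarrow> lin (\<lambda>v. Fop b (g v))" "lin g \<Longrightarrow> lin (\<lambda>v. diag \<chi> (g v))"
  "lin g \<Longrightarrow> lin (\<lambda>v. Sact s (g v))" "lin h \<Longrightarrow> lin (\<lambda>v. sc c (h v))"
  "lin h \<Longrightarrow> lin h' \<Longrightarrow> lin (\<lambda>v. h v + h' v)" "lin h \<Longrightarrow> lin h' \<Longrightarrow> lin (\<lambda>v. h v - h' v)"
  by (simp_all add: lin_comp[OF lin_pre] lin_comp[OF lin_SG] lin_comp[OF lin_EP] lin_comp[OF lin_Eop]
      lin_comp[OF lin_Fop] lin_comp[OF lin_diag] lin_comp[OF lin_Sact] lin_sc lin_add lin_diff)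

lemmas SG_simps = lin_simps[OF lin_SG] lin_simps[OF lin_EP]

lemma SG_Suc [simp]: "SG (Suc i) (pre x v) = pre x (SG i v)"
  and EP_Suc [simp]: "EP (Suc i) (pre x v) = pre x (EP i v)"
proof -
  have e: "SG (Suc i) (pre x (bvec w)) = pre x (SG i (bvec w))" "EP (Suc i) (pre x (bvec w)) = pre x (EP i (bvec w))"
    for w
    by (simp_all add: SG_def EP_def pre_bvec)
  show "SG (Suc i) (pre x v) = pre x (SG i v)"
    by (rule fun_cong[where x = v], rule lin_ext) (simp_all add: e)
  show "EP (Suc i) (pre x v) = pre x (EP i v)"
    by (rule fun_cong[where x = v], rule lin_ext) (simp_all add: e)
qed

lemma SG_1 [simp]: "SG 1 (pre x v) = pre x (SG 0 v)" and EP_1 [simp]: "EP 1 (pre x v) = pre x (EP 0 v)"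
  using SG_Suc[of 0] EP_Suc[of 0] by simp_all

lemma SG_diff: "b \<noteq> c \<Longrightarrow> SG 0 (pre (b, i) (pre (c, j) v)) = pre (c, j) (pre (b, i) v)"
proof (rule fun_cong[where x = v], rule lin_ext)
  show "b \<noteq> c \<Longrightarrow> SG 0 (pre (b, i) (pre (c, j) (bvec w))) = pre (c, j) (pre (b, i) (bvec w))" for w
    by (simp add: SG_def pre_bvec)
qed simp_all

lemma SG_same:
  "SG 0 (pre (b, I1) (pre (b, I1) v)) = sc q (pre (b, I1) (pre (b, I1) v))"
  "SG 0 (pre (b, I2) (pre (b, I2) v)) = sc q (pre (b, I2) (pre (b, I2) v))"
  "SG 0 (pre (b, I2) (pre (b, I1) v)) = pre (b, I1) (pre (b, I2) v)"
  "SG 0 (pre (b, I1) (pre (b, I2) v)) =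
     pre (b, I2) (pre (b, I1) v) + sc (q - inverse q) (pre (b, I1) (pre (b, I2) v))"
proof -
  have e: "SG 0 (pre x (pre y (bvec w))) = lext (\<lambda>(x', y'). bvec (x' # y' # w)) (sigma2 x y)" for x y w
    by (simp add: SG_def pre_bvec)
  show "SG 0 (pre (b, I1) (pre (b, I1) v)) = sc q (pre (b, I1) (pre (b, I1) v))"
    by (rule fun_cong[where x = v], rule lin_ext; (subst e)?; simp add: pre_bvec lext_sc)
  show "SG 0 (pre (b, I2) (pre (b, I2) v)) = sc q (pre (b, I2) (pre (b, I2) v))"
    by (rule fun_cong[where x = v], rule lin_ext; (subst e)?; simp add: pre_bvec lext_sc)
  show "SG 0 (pre (b, I2) (pre (b, I1) v)) = pre (b, I1) (pre (b, I2) v)"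
    by (rule fun_cong[where x = v], rule lin_ext; (subst e)?; simp add: pre_bvec lext_sc)
  show "SG 0 (pre (b, I1) (pre (b, I2) v)) =
     pre (b, I2) (pre (b, I1) v) + sc (q - inverse q) (pre (b, I1) (pre (b, I2) v))"
    by (rule fun_cong[where x = v], rule lin_ext; (subst e)?; simp add: pre_bvec lext_sc lext_add)
qed

lemma EP_0: "EP 0 (pre x (pre y v)) = (if fst x = fst y then pre x (pre y v) else 0)"
proof (rule fun_cong[where x = v], rule lin_ext)
  show "EP 0 (pre x (pre y (bvec w))) = (if fst x = fst y then pre x (pre y (bvec w)) else 0)" for w
    by (simp add: EP_def pre_bvec)
qed (cases "fst x = fst y"; simp)+

lemmas local_ops = SG_diff SG_same EP_0 SG_simps pre_simps

text \<open>Both sides ignore the letters before position \<open>i\<close>, so a relation among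
  neighbouring crossings is checked on the first three letters. Here \<open>n\<close> is the number
  of letters that remain after the first \<open>i\<close>.\<close>

lemma shift_induct:
  assumes "\<And>i. lin (A i)" "\<And>i. lin (A' i)"
    "\<And>i x v. A (Suc i) (pre x v) = pre x (A i v)" "\<And>i x v. A' (Suc i) (pre x v) = pre x (A' i v)"
    "\<And>x y z w. length w + 3 = n \<Longrightarrow> A 0 (pre x (pre y (pre z (bvec w)))) = A' 0 (pre x (pre y (pre z (bvec w))))"
    "i + 2 < m" "n + i = m" "v \<in> fmod (words m)"
  shows "A i v = A' i v"
proof (rule lin_eq_on[OF assms(1,2) _ assms(8)])
  fix w assume "w \<in> words m"
  then have "length w = n + i" "n \<ge> 3" using assms(6,7) by (auto simp: words_def)
  then show "A i (bvec w) = A' i (bvec w)"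
  proof (induction i arbitrary: w)
    case 0
    then obtain x y z w' where "w = x # y # z # w'" "length w' + 3 = n"
      by (cases w; cases "tl w"; cases "tl (tl w)") auto
    then show ?case
      using assms(5)[of w' x y z] by (simp add: pre_bvec)
  next
    case (Suc i)
    then obtain x w' where "w = x # w'" "length w' = n + i"
      by (cases w) auto
    then show ?case
      using Suc.IH[of w'] Suc.prems assms(3,4) by (simp add: pre_bvec[symmetric])
  qed
qed

lemma shift_induct2:
  assumes "\<And>i. lin (A i)" "\<And>i. lin (A' i)"
    "\<And>i x v. A (Suc i) (pre x v) = pre x (A i v)" "\<And>i x v. A' (Suc i) (pre x v) = pre x (A' i v)"
    "\<And>x y w. A 0 (pre x (pre y (bvec w))) = A' 0 (pre x (pre y (bvec w)))"
    "i + 1 < m" "v \<in> fmod (words m)"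
  shows "A i v = A' i v"
proof (rule lin_eq_on[OF assms(1,2) _ assms(7)])
  fix w assume "w \<in> words m"
  then have "length w > i + 1" using assms(6) by (auto simp: words_def)
  then show "A i (bvec w) = A' i (bvec w)"
  proof (induction i arbitrary: w)
    case 0
    then obtain x y w' where "w = x # y # w'"
      by (cases w; cases "tl w") auto
    then show ?case
      using assms(5)[of x y w'] by (simp add: pre_bvec)
  next
    case (Suc i)
    then obtain x w' where "w = x # w'" "length w' > i + 1"
      by (cases w) auto
    then show ?case
      using Suc.IH[of w'] assms(3,4) by (simp add: pre_bvec[symmetric])
  qed
qed

text \<open>The inverse dictated by the quadratic relation, as crossing and tie commute.\<close>

definition SGinv :: "nat \<Rightarrow> vec \<Rightarrow> vec" where
  "SGinv i v = SG i v - sc (q - inverse q) (EP i v)"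

lemma lin_SGinv [simp]: "lin (SGinv i)"
  unfolding SGinv_def by simp

lemma SGinv_Suc [simp]: "SGinv (Suc i) (pre x v) = pre x (SGinv i v)"
  by (simp add: SGinv_def pre_simps)

lemma two_cases:
  assumes "\<And>b c i j. b \<noteq> c \<Longrightarrow> P (b, i) (c, j)" "\<And>b i j. P (b, i) (b, j)"
  shows "P x y"
  using assms by (cases x; cases y) metis

lemma three_cases:
  assumes "\<And>b i j k. P (b, i) (b, j) (b, k)" "\<And>b c i j k. b \<noteq> c \<Longrightarrow> P (b, i) (b, j) (c, k)"
    "\<And>b c i j k. b \<noteq> c \<Longrightarrow> P (b, i) (c, j) (b, k)" "\<And>b c i j k. b \<noteq> c \<Longrightarrow> P (c, i) (b, j) (b, k)"
    "\<And>a b c i j k. a \<noteq> b \<Longrightarrow> a \<noteq> c \<Longrightarrow> b \<noteq> c \<Longrightarrow> P (a, i) (b, j) (c, k)"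
  shows "P x y z"
  using assms by (cases x; cases y; cases z) metis

lemmas vec_eq = lookup_add lookup_minus q_nz

lemma rel_quad:
  assumes "i + 1 < n" "v \<in> fmod (words n)"
  shows "SG i (SG i v) = sc (q - inverse q) (SG i (EP i v)) + v"
proof (rule shift_induct2[OF _ _ _ _ _ assms])
  fix x y :: vbasis and w :: "vbasis list"
  let ?P = "\<lambda>x y. SG 0 (SG 0 (pre x (pre y (bvec w)))) =
      sc (q - inverse q) (SG 0 (EP 0 (pre x (pre y (bvec w))))) + pre x (pre y (bvec w))"
  show "?P x y"
  proof (rule two_cases[of ?P x y])
    show "?P (b, i) (b, j)" for b i j
      by (rule poly_mapping_eqI; cases i; cases j; simp add: local_ops vec_eq algebra_simps)
  qed (simp add: local_ops)
qed (auto simp: pre_simps)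

lemma rel_EE:
  assumes "i + 1 < n" "v \<in> fmod (words n)"
  shows "EP i (EP i v) = EP i v"
  by (rule shift_induct2[OF _ _ _ _ _ assms]) (auto simp: EP_0)

lemma rel_SE:
  assumes "i + 1 < n" "v \<in> fmod (words n)"
  shows "SG i (EP i v) = EP i (SG i v)"
proof (rule shift_induct2[OF _ _ _ _ _ assms])
  fix x y :: vbasis and w :: "vbasis list"
  let ?P = "\<lambda>x y. SG 0 (EP 0 (pre x (pre y (bvec w)))) = EP 0 (SG 0 (pre x (pre y (bvec w))))"
  show "?P x y"
  proof (rule two_cases[of ?P x y])
    show "?P (b, i) (b, j)" for b i j
      by (cases i; cases j; simp add: local_ops)
  qed (simp add: local_ops)
qed (auto simp:)

lemma EP_bvec: "i + 1 < length w \<Longrightarrow> EP i (bvec w) = (if fst (w ! i) = fst (w ! Suc i) then bvec w else 0)"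
proof (induction i arbitrary: w)
  case 0
  then show ?case
    by (cases w; cases "tl w") (auto simp: EP_def)
next
  case (Suc i)
  then obtain x w' where w: "w = x # w'" "i + 1 < length w'" by (cases w) auto
  have "EP (Suc i) (bvec w) = pre x (EP i (bvec w'))"
    by (simp add: w pre_bvec[symmetric])
  then show ?case unfolding Suc.IH[OF w(2)] by (simp add: w pre_bvec)
qed

lemma rel_EE_comm:
  assumes "i + 1 < n" "j + 1 < n" "v \<in> fmod (words n)"
  shows "EP i (EP j v) = EP j (EP i v)"
  by (rule lin_eq_on[OF _ _ _ assms(3)]) (use assms(1,2) in \<open>auto simp: words_def EP_bvec\<close>)

lemma SG_far_0: "SG 0 (pre x (pre y (SG j v))) = SG (Suc (Suc j)) (SG 0 (pre x (pre y v)))"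
  "SG 0 (pre x (pre y (EP j v))) = EP (Suc (Suc j)) (SG 0 (pre x (pre y v)))"
  "EP 0 (pre x (pre y (SG j v))) = SG (Suc (Suc j)) (EP 0 (pre x (pre y v)))"
proof -
  let ?P = "\<lambda>x y. SG 0 (pre x (pre y (SG j v))) = SG (Suc (Suc j)) (SG 0 (pre x (pre y v)))"
  have "?P x y"
  proof (rule two_cases[of ?P x y])
    show "?P (b, i) (b, j)" for b i j
      by (cases i; cases j; simp add: local_ops)
  qed (simp add: local_ops)
  then show "?P x y" .
  let ?Q = "\<lambda>x y. SG 0 (pre x (pre y (EP j v))) = EP (Suc (Suc j)) (SG 0 (pre x (pre y v)))"
  have "?Q x y"
  proof (rule two_cases[of ?Q x y])
    show "?Q (b, i) (b, j)" for b i j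
      by (cases i; cases j; simp add: local_ops)
  qed (simp add: local_ops)
  then show "?Q x y" .
qed (simp add: local_ops)

lemma rel_far:
  assumes "i + 1 < j" "j + 1 < n" "v \<in> fmod (words n)"
  shows "SG i (SG j v) = SG j (SG i v)" "SG i (EP j v) = EP j (SG i v)" "EP i (SG j v) = SG j (EP i v)"
proof -
  obtain k where j: "j = Suc (Suc k) + i"
    using assms(1) by (metis Suc_eq_plus1 add.commute add_Suc_right less_natE)
  have i: "i + 1 < n" using assms by simp
  show "SG i (SG j v) = SG j (SG i v)"
    unfolding j
    by (rule shift_induct2[OF _ _ _ _ _ i assms(3)]) (auto simp: SG_far_0)
  show "SG i (EP j v) = EP j (SG i v)"
    unfolding j
    by (rule shift_induct2[OF _ _ _ _ _ i assms(3)]) (auto simp: SG_far_0)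
  show "EP i (SG j v) = SG j (EP i v)"
    unfolding j
    by (rule shift_induct2[OF _ _ _ _ _ i assms(3)]) (auto simp: SG_far_0)
qed

text \<open>A finite verification: the five patterns of coincidence among three colours, combined
  with the labels of the three letters, exhaust the cases.\<close>

lemma near_base:
  "SG 0 (SG 1 (SG 0 (pre x (pre y (pre z v))))) = SG 1 (SG 0 (SG 1 (pre x (pre y (pre z v)))))"
  "EP 0 (SG 1 (SG 0 (pre x (pre y (pre z v))))) = SG 1 (SG 0 (EP 1 (pre x (pre y (pre z v)))))"
  "EP 1 (SG 0 (SG 1 (pre x (pre y (pre z v))))) = SG 0 (SG 1 (EP 0 (pre x (pre y (pre z v)))))"
  "EP 0 (SG 1 (SGinv 0 (pre x (pre y (pre z v))))) = SG 1 (SGinv 0 (EP 1 (pre x (pre y (pre z v)))))"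
  "EP 1 (SG 0 (SGinv 1 (pre x (pre y (pre z v))))) = SG 0 (SGinv 1 (EP 0 (pre x (pre y (pre z v)))))"
  "EP 0 (EP 1 (SG 0 (pre x (pre y (pre z v))))) = EP 1 (SG 0 (EP 1 (pre x (pre y (pre z v)))))"
  "EP 1 (EP 0 (SG 1 (pre x (pre y (pre z v))))) = EP 0 (SG 1 (EP 0 (pre x (pre y (pre z v)))))"
  "EP 1 (SG 0 (EP 1 (pre x (pre y (pre z v))))) = SG 0 (EP 1 (EP 0 (pre x (pre y (pre z v)))))"
  "EP 0 (SG 1 (EP 0 (pre x (pre y (pre z v))))) = SG 1 (EP 0 (EP 1 (pre x (pre y (pre z v)))))"
  by (rule three_cases[of _ x y z]; rule poly_mapping_eqI; (case_tac i; case_tac j; case_tac k);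
      simp add: local_ops SGinv_def vec_eq algebra_simps)+

text \<open>Up to a factor the q-antisymmetrizer on three strands: the sum of the six products of
  crossings with coefficient \<open>- inverse q\<close> to the power of the length.\<close>

definition tl_antisym :: "vec \<Rightarrow> vec" where
  "tl_antisym v = v - sc (inverse q) (SG 0 v) - sc (inverse q) (SG 1 v) + sc (inverse q ^ 2) (SG 0 (SG 1 v))
     + sc (inverse q ^ 2) (SG 1 (SG 0 v)) - sc (inverse q ^ 3) (SG 0 (SG 1 (SG 0 v)))"

text \<open>On three strands of one colour the antisymmetrizer vanishes because the q-exterior cube
  of a 2-dimensional space is zero. Any other colouring is killed by the two ties.\<close>

lemma tl_base: "EP 0 (EP 1 (tl_antisym (pre x (pre y (pre z v))))) = 0"
proof (rule three_cases[of _ x y z])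
  show "EP 0 (EP 1 (tl_antisym (pre (b, i) (pre (b, j) (pre (b, k) v))))) = 0" for b i j k
    by (rule poly_mapping_eqI; cases i; cases j; cases k;
        simp add: tl_antisym_def local_ops vec_eq algebra_simps power2_eq_square power3_eq_cube)
qed (case_tac i; case_tac j; case_tac k; simp add: tl_antisym_def local_ops)+

lemma rel_near:
  assumes "i + 2 < n" "v \<in> fmod (words n)"
  shows "SG i (SG (Suc i) (SG i v)) = SG (Suc i) (SG i (SG (Suc i) v))"
    "EP i (SG (Suc i) (SG i v)) = SG (Suc i) (SG i (EP (Suc i) v))"
    "EP (Suc i) (SG i (SG (Suc i) v)) = SG i (SG (Suc i) (EP i v))"
    "EP i (SG (Suc i) (SGinv i v)) = SG (Suc i) (SGinv i (EP (Suc i) v))"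
    "EP (Suc i) (SG i (SGinv (Suc i) v)) = SG i (SGinv (Suc i) (EP i v))"
    "EP i (EP (Suc i) (SG i v)) = EP (Suc i) (SG i (EP (Suc i) v))"
    "EP (Suc i) (EP i (SG (Suc i) v)) = EP i (SG (Suc i) (EP i v))"
    "EP (Suc i) (SG i (EP (Suc i) v)) = SG i (EP (Suc i) (EP i v))"
    "EP i (SG (Suc i) (EP i v)) = SG (Suc i) (EP i (EP (Suc i) v))"
  by (rule shift_induct[OF _ _ _ _ _ assms(1) _ assms(2), of _ _ "n - i"];
      use assms(1) near_base[unfolded One_nat_def] in \<open>simp add: lin_SGinv[THEN lin_comp]\<close>)+

lemma SG_mset: "SG i (bvec w) \<in> fmod {w'. mset w' = mset w}"
proof (induction i arbitrary: w)
  case 0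
  show ?case
  proof (cases "\<exists>x y w'. w = x # y # w'")
    case True
    then obtain x y w' where w: "w = x # y # w'" by blast
    let ?P = "\<lambda>x y. SG 0 (pre x (pre y (bvec w'))) \<in> fmod {v. mset v = mset (x # y # w')}"
    have "?P x y"
    proof (rule two_cases[of ?P x y])
      show "?P (b, i) (b, j)" for b i j
        by (cases i; cases j; simp add: SG_same) (auto simp: pre_bvec intro!: fmod_add fmod_sc)
    qed (subst SG_diff, simp_all add: pre_bvec)
    then show ?thesis by (simp add: w pre_bvec)
  next
    case False
    then have "sgw 0 w = bvec w" by (cases "(0 :: nat, w)" rule: sgw.cases) auto
    then show ?thesis by (simp add: SG_def)
  qed
next
  case (Suc i)
  show ?case
  proof (cases w)
    case Nil
    then show ?thesis by (simp add: SG_def)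
  next
    case (Cons x w')
    have "SG (Suc i) (bvec w) = pre x (SG i (bvec w'))"
      by (simp add: Cons pre_bvec[symmetric])
    moreover have "pre x (SG i (bvec w')) \<in> fmod {v. mset v = mset w}"
      by (rule lin_fmod[OF lin_pre _ Suc.IH]) (simp add: pre_bvec Cons)
    ultimately show ?thesis by simp
  qed
qed

lemma EP_mset: "i + 1 < length w \<Longrightarrow> EP i (bvec w) \<in> fmod {w'. mset w' = mset w}"
  by (simp add: EP_bvec)

lemma mset_tbasis: "mset w' = mset w \<Longrightarrow> w' \<in> tbasis d n \<longleftrightarrow> w \<in> tbasis d n"
  using mset_eq_length[of w' w] mset_eq_setD[of w' w] by (auto simp: tbasis_def)

fun tbop :: "tbgen \<Rightarrow> vec \<Rightarrow> vec" where
  "tbop (TS i) = SG (i - 1)"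
| "tbop (TSinv i) = SGinv (i - 1)"
| "tbop (TE i) = EP (i - 1)"

lemma lin_tbop [simp]: "lin (tbop x)"
  by (cases x) simp_all

lemma tbop_mset: "x \<in> TBgens n \<Longrightarrow> w \<in> words n \<Longrightarrow> tbop x (bvec w) \<in> fmod {w'. mset w' = mset w}"
  by (auto simp: TBgens_def words_def SGinv_def intro!: SG_mset EP_mset fmod_diff fmod_sc)

lemma tbop_closed:
  assumes "x \<in> TBgens n" "v \<in> fmod B" "B \<subseteq> words n" "\<And>w w'. mset w' = mset w \<Longrightarrow> w \<in> B \<Longrightarrow> w' \<in> B"
  shows "tbop x v \<in> fmod B"
proof (rule lin_fmod[OF lin_tbop _ assms(2)])
  fix w assume "w \<in> B"
  then show "tbop x (bvec w) \<in> fmod B"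
    using fmod_mono[OF tbop_mset[OF assms(1)], of w B] assms(3,4) by blast
qed

lemma tbop_words: "x \<in> TBgens n \<Longrightarrow> v \<in> fmod (words n) \<Longrightarrow> tbop x v \<in> fmod (words n)"
  by (rule tbop_closed) (auto simp: words_def dest: mset_eq_length)

lemma tbop_tpow: "x \<in> TBgens n \<Longrightarrow> v \<in> tpow d n \<Longrightarrow> tbop x v \<in> tpow d n"
  using mset_tbasis tbasis_words by (intro tbop_closed[of x n v]) blast+

lemma BTTLrels_carrier: "BTTLrels n \<subseteq> carrier (free_alg (TBgens n))"
proof -
  let ?F = "fmod {w. set (letters w) \<subseteq> TBgens n} :: (tbgen, kq) free set"
  have g: "tS i \<in> ?F" "tSinv i \<in> ?F" "tE i \<in> ?F" if "i \<in> {1..<n}" for i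
    using that by (simp_all add: TBgens_def carrier_free_alg[symmetric])
  have "(1 :: (tbgen, kq) free) \<in> ?F"
    by (simp add: one_free)
  then show ?thesis
    unfolding BTTLrels_def TBrels_def carrier_free_alg
    by (auto intro!: fmod_add fmod_diff fmod_words_mult fmod_sc g)
qed

global_interpretation Tb: letter_action tbop "TBgens n" "words n" for n
  by unfold_locales (simp_all add: tbop_words)

lemma rel_inv:
  assumes "i + 1 < n" "v \<in> fmod (words n)"
  shows "SG i (SGinv i v) = v" "SGinv i (SG i v) = v"
  using rel_quad[OF assms] rel_SE[OF assms] by (simp_all add: SGinv_def SG_simps)

lemma tb_rel_zero:
  assumes r: "r \<in> BTTLrels n" and v: "v \<in> fmod (words n)"
  shows "word_act tbop r v = 0"
proof -
  note simps = word_act_simps Tb.word_act_mult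
  have pm: "i - 1 + 1 < n" if "1 \<le> i" "i < n" for i using that by simp
  have one: "word_act tbop x v = 0"
    if "i \<in> {1..<n}" "x \<in> {tS i * tSinv i - 1, tSinv i * tS i - 1, tE i * tE i - tE i, tS i * tE i - tE i * tS i,
        tS i * tS i - (sc (q - inverse q) (tS i * tE i) + 1)}" for i x
    using that rel_inv[OF pm v] rel_EE[OF pm v] rel_SE[OF pm v] rel_quad[OF pm v]
    by (auto simp: simps)
  have comm: "word_act tbop x v = 0"
    if "i \<in> {1..<n}" "j \<in> {1..<n}" "x = tE i * tE j - tE j * tE i" for i j x
    using that rel_EE_comm[OF pm pm v] by (simp add: simps)
  have far: "word_act tbop x v = 0"
    if "i \<in> {1..<n}" "j \<in> {1..<n}" "i + 1 < j \<or> j + 1 < i" "x \<in> {tS i * tS j - tS j * tS i, tS i * tE j - tE j * tS i}" for i j x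
    using that(3)
  proof
    assume "i + 1 < j"
    then show ?thesis
      using that rel_far[of "i - 1" "j - 1" n v] v by (auto simp: simps)
  next
    assume "j + 1 < i"
    then show ?thesis
      using that rel_far[of "j - 1" "i - 1" n v] v by (auto simp: simps)
  qed
  have near: "word_act tbop x v = 0"
    if ij: "i \<in> {1..<n}" "j \<in> {1..<n}" and "i + 1 = j \<or> j + 1 = i" and
      "x \<in> {tS i * tS j * tS i - tS j * tS i * tS j,
         tE i * tS j * tS i - tS j * tS i * tE j,
         tE i * tS j * tSinv i - tS j * tSinv i * tE j,
         tE i * tE j * tS i - tE j * tS i * tE j,
         tE j * tS i * tE j - tS i * tE j * tE i}" for i j x
    using \<open>i + 1 = j \<or> j + 1 = i\<close>
  proof
    assume j: "i + 1 = j"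
    then obtain k where "i = Suc k" using ij by (cases i) auto
    then show ?thesis
      using that j rel_near[of k n v] v by (auto simp: simps)
  next
    assume j: "j + 1 = i"
    then obtain k where "j = Suc k" using ij by (cases j) auto
    then show ?thesis
      using that j rel_near[of k n v] v by (auto simp: simps)
  qed
  have tl: "word_act tbop x v = 0"
    if n: "n > 2" and x: "x = tE 1 * tE 2 * (1 - sc (inverse q) (tS 1) - sc (inverse q) (tS 2)
           + sc (inverse q ^ 2) (tS 1 * tS 2) + sc (inverse q ^ 2) (tS 2 * tS 1)
           - sc (inverse q ^ 3) (tS 1 * tS 2 * tS 1))" for x
  proof -
    have "word_act tbop x v = EP 0 (EP 1 (tl_antisym v))"
      by (simp add: x simps tl_antisym_def)
    also have "\<dots> = 0"
    proof (rule lin_eq_on[of "\<lambda>v. EP 0 (EP 1 (tl_antisym v))" "\<lambda>v. 0", OF _ _ _ v])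
      show "lin (\<lambda>v. EP 0 (EP 1 (tl_antisym v)))" by (simp add: tl_antisym_def)
      fix w assume "w \<in> words n"
      then obtain e f g w' where "w = e # f # g # w'"
        using n by (cases w; cases "tl w"; cases "tl (tl w)") (auto simp: words_def)
      then show "EP 0 (EP 1 (tl_antisym (bvec w))) = 0"
        using tl_base[of e f g "bvec w'"] by (simp add: pre_bvec)
    qed simp
    finally show ?thesis .
  qed
  have "BTTLrels n \<subseteq> {r. word_act tbop r v = 0}"
    unfolding BTTLrels_def TBrels_def
    apply (intro Un_least UN_least subsetI CollectI)
         apply (rule one, assumption, blast)
        apply (rule comm, assumption, assumption, blast)
       apply (clarify, rule far, assumption, assumption, assumption, blast)
      apply (clarify, rule near, assumption, assumption, assumption, blast)
     apply (rule one, assumption, blast)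
    apply (cases "n > 2"; simp only: if_True if_False)
     apply (rule tl, assumption, blast)
    apply blast
    done
  then show ?thesis using r by blast
qed

global_interpretation Tb: presented_action tbop "TBgens n" "words n" "BTTLrels n" for n
  by unfold_locales (simp_all add: BTTLrels_carrier tb_rel_zero)

section \<open>Braid and tie operators as module endomorphisms\<close>

lemma (in letter_action) word_act_commute:
  assumes L: "lin L" and "\<And>x v. x \<in> X \<Longrightarrow> v \<in> fmod B \<Longrightarrow> L (g x v) = h x (L v)"
    and "p \<in> carrier (free_alg X)" "v \<in> fmod B"
  shows "L (word_act g p v) = word_act h p (L v)"
proof (rule lin_eq_on[OF lin_comp[OF L word_act_lin1] word_act_lin1])
  show "p \<in> fmod {w. set (letters w) \<subseteq> X}"
    using assms(3) by (simp add: carrier_free_alg)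
  have "L (foldr g ws v) = foldr h ws (L v)" if "set ws \<subseteq> X" for ws
    using that by (induction ws) (use assms(2,4) foldr_closed in auto)
  then show "L (word_act g (bvec w) v) = word_act h (bvec w) (L v)"
    if "w \<in> {w. set (letters w) \<subseteq> X}" for w
    using that by simp
qed

lemma local_commute:
  assumes D: "\<And>i. lin (D i)" "\<And>i x v. D (Suc i) (pre x v) = pre x (D i v)"
    and M: "lin M"
    and pre: "\<And>i x v. D i (M v) = M (D i v) \<Longrightarrow> D (Suc i) (M (pre x v)) = M (pre x (D i v))"
    and base: "\<And>x y w. D 0 (M (pre x (pre y (bvec w)))) = M (D 0 (pre x (pre y (bvec w))))"
    and i: "i + 1 < n" and v: "v \<in> fmod (words n)"
  shows "D i (M v) = M (D i v)"
proof (rule lin_eq_on[OF lin_comp[OF D(1) M] lin_comp[OF M D(1)] _ v])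
  fix w assume "w \<in> words n"
  then have "length w > i + 1" using i by (auto simp: words_def)
  then show "D i (M (bvec w)) = M (D i (bvec w))"
  proof (induction i arbitrary: w)
    case 0
    then obtain x y w' where "w = x # y # w'"
      by (cases w; cases "tl w") auto
    then show ?case
      using base[of x y w'] by (simp add: pre_bvec)
  next
    case (Suc i)
    then obtain x w' where "w = x # w'" "length w' > i + 1"
      by (cases w) auto
    then show ?case
      using pre[OF Suc.IH[of w'], of x] by (simp add: pre_bvec[symmetric] D(2))
  qed
qed

lemma SG_diag:
  assumes "i + 1 < n" "v \<in> fmod (words n)"
  shows "SG i (diag \<chi> v) = diag \<chi> (SG i v)"
proof (rule local_commute[OF _ _ _ _ _ assms])
  fix x y :: vbasis and w :: "vbasis list"
  let ?P = "\<lambda>x y. SG 0 (diag \<chi> (pre x (pre y (bvec w)))) = diag \<chi> (SG 0 (pre x (pre y (bvec w))))"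
  show "?P x y"
  proof (rule two_cases[of ?P x y])
    show "?P (b, i) (b, j)" for b i j
      by (rule poly_mapping_eqI; cases i; cases j; simp add: local_ops op_simps vec_eq algebra_simps)
  qed (simp add: local_ops op_simps mult.commute)
qed (simp_all add: op_simps SG_simps)

lemma EP_diag:
  assumes "i + 1 < n" "v \<in> fmod (words n)"
  shows "EP i (diag \<chi> v) = diag \<chi> (EP i v)"
  by (rule local_commute[OF _ _ _ _ _ assms]) (simp_all add: local_ops op_simps)

lemma SG_Eop:
  assumes "i + 1 < n" "v \<in> fmod (words n)"
  shows "SG i (Eop a v) = Eop a (SG i v)"
proof (rule local_commute[OF _ _ _ _ _ assms])
  fix x y :: vbasis and w :: "vbasis list"
  let ?P = "\<lambda>x y. SG 0 (Eop a (pre x (pre y (bvec w)))) = Eop a (SG 0 (pre x (pre y (bvec w))))"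
  show "?P x y"
  proof (rule two_cases[of ?P x y])
    show "?P (b, i) (b, j)" for b i j
      by (rule poly_mapping_eqI; cases i; cases j; simp add: local_ops op_simps kwt_def vec_eq algebra_simps)
    show "?P (b, i) (c, j)" if "b \<noteq> c" for b c i j
      using that by (cases i; cases j; simp add: local_ops op_simps kwt_def)
  qed
qed (simp_all add: op_simps SG_simps)

lemma EP_Eop:
  assumes "i + 1 < n" "v \<in> fmod (words n)"
  shows "EP i (Eop a v) = Eop a (EP i v)"
  by (rule local_commute[OF _ _ _ _ _ assms]) (auto simp: local_ops op_simps)

lemma SG_Fop:
  assumes "i + 1 < n" "v \<in> fmod (words n)"
  shows "SG i (Fop a v) = Fop a (SG i v)"
proof -
  have "lin (\<lambda>v. Fop a v)" by simp
  \<comment> \<open>\<open>F\<close> of a prefixed word involves \<open>Kinv\<close> of the rest, so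
    commutation with \<open>Kinv\<close> is carried through the induction.\<close>
  have "SG i (Fop a v) = Fop a (SG i v) \<and> SG i (Kinv a v) = Kinv a (SG i v)"
    if "length w > i + 1" "v = bvec w" for i v w
    using that
  proof (induction i arbitrary: v w)
    case 0
    then obtain x y w' where w: "w = x # y # w'"
      by (cases w; cases "tl w") auto
    let ?P = "\<lambda>x y. SG 0 (Fop a (pre x (pre y (bvec w')))) = Fop a (SG 0 (pre x (pre y (bvec w'))))"
    have "?P x y"
    proof (rule two_cases[of ?P x y])
      show "?P (b, i) (b, j)" for b i j
        by (rule poly_mapping_eqI; cases i; cases j; simp add: local_ops op_simps kinvwt_def vec_eq algebra_simps)
      show "?P (b, i) (c, j)" if "b \<noteq> c" for b c i j
        using that by (cases i; cases j; simp add: local_ops op_simps kinvwt_def)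
    qed
    then show ?case
      using SG_diag[of 0 "length w" "bvec w"] 0 by (simp add: w pre_bvec words_def)
  next
    case (Suc i)
    then obtain x w' where w: "w = x # w'" "length w' > i + 1"
      by (cases w) auto
    then have v: "v = pre x (bvec w')" using Suc.prems by (simp add: pre_bvec)
    show ?case
      using Suc.IH[OF w(2) refl] unfolding v by (simp add: op_simps SG_simps)
  qed
  then show ?thesis
    using assms by (intro lin_eq_on[OF lin_comp[OF lin_SG lin_Fop] lin_comp[OF lin_Fop lin_SG] _ assms(2)])
      (auto simp: words_def)
qed

lemma EP_Fop:
  assumes "i + 1 < n" "v \<in> fmod (words n)"
  shows "EP i (Fop a v) = Fop a (EP i v)"
proof -
  have "EP i (Fop a v) = Fop a (EP i v) \<and> EP i (Kinv a v) = Kinv a (EP i v)"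
    if "length w > i + 1" "v = bvec w" for i v w
    using that
  proof (induction i arbitrary: v w)
    case 0
    then obtain x y w' where w: "w = x # y # w'"
      by (cases w; cases "tl w") auto
    show ?case
      using 0 by (auto simp: w pre_bvec[symmetric] local_ops op_simps)
  next
    case (Suc i)
    then obtain x w' where w: "w = x # w'" "length w' > i + 1"
      by (cases w) auto
    then have v: "v = pre x (bvec w')" using Suc.prems by (simp add: pre_bvec)
    show ?case
      using Suc.IH[OF w(2) refl] unfolding v by (simp add: op_simps SG_simps)
  qed
  then show ?thesis
    using assms by (intro lin_eq_on[OF lin_comp[OF lin_EP lin_Fop] lin_comp[OF lin_Fop lin_EP] _ assms(2)])
      (auto simp: words_def)
qed

lemma Sact_pre: "Sact s (pre (b, i) v) = pre (s b, i) (Sact s v)"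
proof (rule fun_cong[where x = v], rule lin_ext)
  show "Sact s (pre (b, i) (bvec w)) = pre (s b, i) (Sact s (bvec w))" for w
    by (simp add: Sact_bvec pre_bvec)
qed simp_all

lemmas Sact_simps = lin_simps[OF lin_Sact] Sact_pre

lemma SG_Sact:
  assumes "inj s" "i + 1 < n" "v \<in> fmod (words n)"
  shows "SG i (Sact s v) = Sact s (SG i v)"
proof (rule local_commute[OF _ _ _ _ _ assms(2,3)])
  fix x y :: vbasis and w :: "vbasis list"
  let ?P = "\<lambda>x y. SG 0 (Sact s (pre x (pre y (bvec w)))) = Sact s (SG 0 (pre x (pre y (bvec w))))"
  show "?P x y"
  proof (rule two_cases[of ?P x y])
    show "?P (b, i) (b, j)" for b i j
      by (cases i; cases j; simp add: local_ops Sact_simps)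
    show "?P (b, i) (c, j)" if "b \<noteq> c" for b c i j
      using that assms(1) by (simp add: local_ops Sact_simps inj_eq)
  qed
next
  show "SG i (Sact s v) = Sact s (SG i v) \<Longrightarrow> SG (Suc i) (Sact s (pre x v)) = Sact s (pre x (SG i v))" for i x v
    by (cases x) (simp add: Sact_pre)
qed simp_all

lemma EP_Sact:
  assumes "inj s" "i + 1 < n" "v \<in> fmod (words n)"
  shows "EP i (Sact s v) = Sact s (EP i v)"
proof (rule local_commute[OF _ _ _ _ _ assms(2,3)])
  show "EP 0 (Sact s (pre x (pre y (bvec w)))) = Sact s (EP 0 (pre x (pre y (bvec w))))" for x y w
    using assms(1) by (cases x; cases y) (simp add: EP_0 Sact_simps inj_eq)
  show "EP i (Sact s v) = Sact s (EP i v) \<Longrightarrow> EP (Suc i) (Sact s (pre x v)) = Sact s (pre x (EP i v))" for i x v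
    by (cases x) (simp add: Sact_pre)
qed simp_all

lemma tbop_uop:
  assumes "x \<in> TBgens n" "v \<in> fmod (words n)"
  shows "tbop x (uop g v) = uop g (tbop x v)"
  using assms
  by (cases g rule: uop.cases)
     (auto simp: TBgens_def SGinv_def SG_Eop SG_Fop SG_diag EP_Eop EP_Fop EP_diag op_simps)

lemma tbop_Sact:
  assumes "inj s" "x \<in> TBgens n" "v \<in> fmod (words n)"
  shows "tbop x (Sact s v) = Sact s (tbop x v)"
  using assms by (auto simp: TBgens_def SGinv_def SG_Sact EP_Sact Sact_simps)

section \<open>The morphism\<close>

definition Psi :: "nat \<Rightarrow> nat \<Rightarrow> (tbgen, kq) free set \<Rightarrow> vec \<Rightarrow> vec" where
  "Psi d n C = (\<lambda>v\<in>tpow d n. the_elem ((\<lambda>p. word_act tbop p v) ` C))"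

lemma Psi_pclass:
  "p \<in> carrier (free_alg (TBgens n)) \<Longrightarrow>
     Psi d n (pclass (TBgens n) (BTTLrels n) p) = (\<lambda>v\<in>tpow d n. word_act tbop p v)"
  by (rule ext) (simp add: Psi_def Tb.coset_act tpow_words restrict_def)

lemma word_act_tbop_tpow:
  "p \<in> carrier (free_alg (TBgens n)) \<Longrightarrow> v \<in> tpow d n \<Longrightarrow> word_act tbop p v \<in> tpow d n"
proof -
  interpret W: letter_action tbop "TBgens n" "tbasis d n"
    by unfold_locales (simp_all add: tbop_tpow)
  show "p \<in> carrier (free_alg (TBgens n)) \<Longrightarrow> v \<in> tpow d n \<Longrightarrow> word_act tbop p v \<in> tpow d n"
    by (rule W.word_act_closed)
qed

lemma Psi_in_End:
  assumes p: "p \<in> carrier (free_alg (TBgens n))"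
  shows "(\<lambda>v\<in>tpow d n. word_act tbop p v) \<in> carrier (End_UqS d n)"
proof (rule End_UqS_I)
  show "tlin d n (\<lambda>v\<in>tpow d n. word_act tbop p v)"
    using word_act_tbop_tpow[OF p] lin_simps(1,2)[OF Tb.word_act_lin2]
    by (auto simp: tlin_def fmod_add fmod_sc)
  show "(\<lambda>v\<in>tpow d n. word_act tbop p v) (uop (b, x) v) = uop (b, x) ((\<lambda>v\<in>tpow d n. word_act tbop p v) v)"
    if "v \<in> tpow d n" for b x v
    using that Tb.word_act_commute[OF lin_uop[of "(b, x)"] _ p tpow_words[OF that], where h = tbop]
    by (simp add: uop_tpow tbop_uop)
  show "(\<lambda>v\<in>tpow d n. word_act tbop p v) (Sact s v) = Sact s ((\<lambda>v\<in>tpow d n. word_act tbop p v) v)"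
    if "s permutes {1..d}" "v \<in> tpow d n" for s v
    using that Tb.word_act_commute[OF lin_Sact[of s] _ p tpow_words[OF that(2)], where h = tbop]
      tbop_Sact[OF permutes_inj[OF that(1)]]
    by (simp add: Sact_tpow)
qed

lemma End_ops:
  "mult (End_UqS d n) = compose (tpow d n)" "one (End_UqS d n) = (\<lambda>v\<in>tpow d n. v)"
  "add (End_UqS d n) = (\<lambda>f g. \<lambda>v\<in>tpow d n. f v + g v)" "smult (End_UqS d n) = (\<lambda>c f. \<lambda>v\<in>tpow d n. sc c (f v))"
  by (simp_all add: End_UqS_def End_alg_def)

lemma Psi_hom: "Psi d n \<in> alg_hom (BTTL n) (End_UqS d n)"
proof -
  have "Psi d n \<in> ring_hom (BTTL n) (End_UqS d n)"
  proof (rule ring_hom_memI)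
    fix x y assume "x \<in> carrier (BTTL n)" "y \<in> carrier (BTTL n)"
    then obtain p r where p: "p \<in> carrier (free_alg (TBgens n))" "x = pclass (TBgens n) (BTTLrels n) p"
      and r: "r \<in> carrier (free_alg (TBgens n))" "y = pclass (TBgens n) (BTTLrels n) r"
      by (auto simp: BTTL_def Tb.presented_carrier)
    show "Psi d n x \<in> carrier (End_UqS d n)"
      using Psi_in_End[OF p(1)] by (simp add: p Psi_pclass)
    show "Psi d n (x \<otimes>\<^bsub>BTTL n\<^esub> y) = Psi d n x \<otimes>\<^bsub>End_UqS d n\<^esub> Psi d n y"
      by (rule ext) (simp add: p r Psi_pclass BTTL_def Tb.pclass_mult Tb.free_carrier_closed End_ops
          compose_def Tb.word_act_mult word_act_tbop_tpow)
    show "Psi d n (x \<oplus>\<^bsub>BTTL n\<^esub> y) = Psi d n x \<oplus>\<^bsub>End_UqS d n\<^esub> Psi d n y"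
      by (rule ext) (simp add: p r Psi_pclass BTTL_def Tb.pclass_add Tb.free_carrier_closed End_ops word_act_simps)
  next
    show "Psi d n \<one>\<^bsub>BTTL n\<^esub> = \<one>\<^bsub>End_UqS d n\<^esub>"
      by (rule ext) (simp add: BTTL_def Tb.presented_simps Psi_pclass Tb.zero_one_carrier End_ops)
  qed
  moreover have "Psi d n (c \<odot>\<^bsub>BTTL n\<^esub> x) = c \<odot>\<^bsub>End_UqS d n\<^esub> Psi d n x" if "x \<in> carrier (BTTL n)" for c x
    using that by (auto simp: BTTL_def Tb.presented_carrier Tb.pclass_smult Psi_pclass Tb.free_carrier_closed
        End_ops word_act_simps intro!: ext)
  ultimately show ?thesis by (simp add: alg_hom_def)
qed

lemma sgw_eq:
  "Suc i < length w \<Longrightarrow> sgw i w = lext (\<lambda>(x, y). bvec (w[i := x, Suc i := y])) (sigma2 (w ! i) (w ! Suc i))"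
proof (induction i arbitrary: w)
  case 0
  then obtain x y w' where "w = x # y # w'" by (cases w; cases "tl w") auto
  then show ?case by simp
next
  case (Suc i)
  then obtain x w' where w: "w = x # w'" "Suc i < length w'" by (cases w) auto
  have "pre x (lext f u) = lext (\<lambda>y. pre x (f y)) u" for f :: "vbasis \<times> vbasis \<Rightarrow> vec" and u
    by (simp add: lext_def pre_simps lin_sum[OF lin_pre])
  then show ?case using w Suc.IH[OF w(2)]
    by (simp add: case_prod_unfold pre_bvec)
qed

lemma Psi_gens:
  assumes "i \<in> {1..<n}"
  shows "Psi d n (BTTL_gen n (TS i)) = sigma d n i" "Psi d n (BTTL_gen n (TE i)) = eps d n i"
proof -
  have g: "gen (TS i) \<in> carrier (free_alg (TBgens n) :: (kq, (tbgen, kq) free) module)"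
    "gen (TE i) \<in> carrier (free_alg (TBgens n) :: (kq, (tbgen, kq) free) module)"
    using assms by (auto simp: TBgens_def)
  obtain k where k: "i = Suc k" using assms by (cases i) auto
  show "Psi d n (BTTL_gen n (TS i)) = sigma d n i"
  proof
    fix v
    have "SG k v = lext (\<lambda>w. lext (\<lambda>(x, y). bvec (w[i - 1 := x, i := y])) (sigma2 (w ! (i - 1)) (w ! i))) v"
      if "v \<in> tpow d n"
      using assms by (intro lin_eq_on[OF lin_SG lin_lext _ that])
        (auto simp: SG_def k sgw_eq tbasis_def)
    then show "Psi d n (BTTL_gen n (TS i)) v = sigma d n i v"
      unfolding BTTL_gen_def Psi_pclass[OF g(1)] by (simp add: sigma_def k)
  qed
  show "Psi d n (BTTL_gen n (TE i)) = eps d n i"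
  proof
    fix v
    have "EP k v = lext (\<lambda>w. if fst (w ! (i - 1)) = fst (w ! i) then bvec w else 0) v"
      if "v \<in> tpow d n"
      using assms by (intro lin_eq_on[OF lin_EP lin_lext _ that])
        (auto simp: k EP_bvec tbasis_def)
    then show "Psi d n (BTTL_gen n (TE i)) v = eps d n i v"
      unfolding BTTL_gen_def Psi_pclass[OF g(2)] by (simp add: eps_def k)
  qed
qed

section \<open>Leading coefficients of products of the braid operators\<close>

fun swp :: "nat \<Rightarrow> 'a list \<Rightarrow> 'a list" where
  "swp 0 (x # y # w) = y # x # w"
| "swp (Suc i) (x # w) = x # swp i w"
| "swp i w = w"

text \<open>A list of crossings is performed from its last entry to its first, in agreement with
  products of operators.\<close>

abbreviation perm :: "nat list \<Rightarrow> 'a list \<Rightarrow> 'a list" where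
  "perm is w \<equiv> foldr swp is w"

abbreviation SGs :: "nat list \<Rightarrow> vec \<Rightarrow> vec" where
  "SGs is v \<equiv> foldr SG is v"

lemma length_swp [simp]: "length (swp i w) = length w"
  by (induction i w rule: swp.induct) auto

lemma mset_swp [simp]: "mset (swp i w) = mset w"
  by (induction i w rule: swp.induct) auto

lemma map_swp: "map f (swp i w) = swp i (map f w)"
  by (induction i w rule: swp.induct) auto

lemma length_perm [simp]: "length (perm is w) = length w"
  by (induction "is") auto

lemma map_perm: "map f (perm is w) = perm is (map f w)"
  by (induction "is") (auto simp: map_swp)

lemma swp_swp [simp]: "swp i (swp i w) = w"
  by (induction i w rule: swp.induct) auto

lemma nth_swp:
  "Suc i < length w \<Longrightarrow> k < length w \<Longrightarrow> swp i w ! k = (if k = i then w ! Suc i else if k = Suc i then w ! i else w ! k)"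
proof (induction i w arbitrary: k rule: swp.induct)
  case (1 x y w)
  then show ?case by (cases k; cases "k - 1") auto
next
  case (2 i x w)
  then show ?case by (cases k) auto
qed auto

lemma lookup_pre: "Poly_Mapping.lookup (pre x v) w = (case w of [] \<Rightarrow> 0 | y # w' \<Rightarrow> if y = x then Poly_Mapping.lookup v w' else 0)"
proof -
  have "Poly_Mapping.lookup (pre x v) w =
      (\<Sum>u\<in>Poly_Mapping.keys v. Poly_Mapping.lookup v u * (if x # u = w then 1 else 0))"
    by (simp add: pre_def lext_def lookup_sum lookup_single when_def)
  also have "\<dots> = (case w of [] \<Rightarrow> 0 | y # w' \<Rightarrow> if y = x then Poly_Mapping.lookup v w' else 0)"
    by (cases w) (auto simp: if_distrib in_keys_iff cong: if_cong)
  finally show ?thesis .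
qed

lemma keys_pre: "Poly_Mapping.keys (pre x v) = (#) x ` Poly_Mapping.keys v"
proof (rule Set.set_eqI)
  show "w \<in> Poly_Mapping.keys (pre x v) \<longleftrightarrow> w \<in> (#) x ` Poly_Mapping.keys v" for w
    by (cases w) (auto simp: in_keys_iff lookup_pre)
qed

lemma keys_sc: "Poly_Mapping.keys (sc c v) \<subseteq> Poly_Mapping.keys v"
  by (auto simp: in_keys_iff)

lemma keys_lin:
  assumes "lin f" "w \<in> Poly_Mapping.keys (f v)"
  obtains u where "u \<in> Poly_Mapping.keys v" "w \<in> Poly_Mapping.keys (f (bvec u))"
proof -
  have "f v \<in> fmod (\<Union>u\<in>Poly_Mapping.keys v. Poly_Mapping.keys (f (bvec u)))"
    by (rule lin_fmod[OF assms(1), of "Poly_Mapping.keys v"]) (auto simp: fmod_def)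
  then show ?thesis
    using assms(2) that by (auto simp: fmod_def)
qed

text \<open>Only letters of the same colour are compared: an inversion is a \<open>(b, I2)\<close>
  in front of a \<open>(b, I1)\<close>.\<close>

primrec inversions :: "vbasis list \<Rightarrow> nat" where
  "inversions [] = 0"
| "inversions (x # w) = inversions w + (if snd x = I2 then count (mset w) (fst x, I1) else 0)"

definition same_col :: "nat \<Rightarrow> 'a list \<Rightarrow> nat" where
  "same_col i f = (if f ! i = f ! Suc i then 1 else 0)"

text \<open>Counts the crossings of strands of equal colour. This bounds the loss of inversions
  under the product of the crossings.\<close>

primrec ncross :: "nat list \<Rightarrow> 'a list \<Rightarrow> nat" where
  "ncross [] f = 0"
| "ncross (i # is) f = ncross is f + same_col i (perm is f)"

text \<open>A crossing is pure at \<open>w\<close> if the operator of the crossing just swaps the two letters and, for two letters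
  of the same colour, thereby removes an inversion.\<close>

definition pure_cross :: "nat \<Rightarrow> vbasis list \<Rightarrow> bool" where
  "pure_cross i w \<longleftrightarrow> fst (w ! i) \<noteq> fst (w ! Suc i) \<or> snd (w ! i) = I2 \<and> snd (w ! Suc i) = I1"

primrec pure :: "nat list \<Rightarrow> vbasis list \<Rightarrow> bool" where
  "pure [] w = True"
| "pure (i # is) w = (pure is w \<and> pure_cross i (perm is w))"

text \<open>For different colours the operator is the flip, and inversions are unchanged. For equal
  colours the terms of \<open>Rcheck\<close> keep or increase the number of inversions, except that
  \<open>(I2, I1)\<close> goes to \<open>(I1, I2)\<close> and loses one; this is the pure
  case.\<close>

lemma SG_keys:
  assumes "Suc i < length w" "u \<in> Poly_Mapping.keys (SG i (bvec w))"
  shows "map fst u = swp i (map fst w) \<and> inversions w \<le> inversions u + same_col i (map fst w) \<and>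
    (inversions w = inversions u + same_col i (map fst w) \<longrightarrow> pure_cross i w \<and> u = swp i w)"
  using assms
proof (induction i arbitrary: w u)
  case 0
  then obtain x y w' where w: "w = x # y # w'" by (cases w; cases "tl w") auto
  obtain b i where x: "x = (b, i)" by fastforce
  obtain c j where y: "y = (c, j)" by fastforce
  have u: "u \<in> Poly_Mapping.keys (SG 0 (pre (b, i) (pre (c, j) (bvec w'))))"
    using 0(2) by (simp add: w x y pre_bvec)
  show ?case
  proof (cases "b = c")
    case True
    note S = SG_same[of c "bvec w'", unfolded pre_bvec]
    have "u = x # y # w' \<or> i = I1 \<and> j = I2 \<and> u = y # x # w'" if "\<not> (i = I2 \<and> j = I1)"
      using u that keys_sc[of "q - inverse q" "bvec ((c, I1) # (c, I2) # w') :: vec"]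
        Poly_Mapping.keys_add[of "bvec ((c, I2) # (c, I1) # w') :: vec" "sc (q - inverse q) (bvec ((c, I1) # (c, I2) # w'))"]
        keys_sc[of "q" "bvec ((c, i) # (c, i) # w') :: vec"]
      by (cases i; cases j) (auto simp: True x y S pre_bvec)
    moreover have "u = y # x # w'" if "i = I2" "j = I1"
      using u that by (auto simp: True x y S pre_bvec)
    ultimately show ?thesis
      by (cases i; cases j; auto simp: w x y True same_col_def pure_cross_def)
  next
    case False
    then have "u = y # x # w'"
      using u SG_diff[OF False, of i j "bvec w'"] by (auto simp: pre_bvec x y)
    then show ?thesis
      using False by (auto simp: w x y same_col_def pure_cross_def)
  qed
next
  case (Suc i)
  then obtain x w' where w: "w = x # w'" "Suc i < length w'" by (cases w) auto
  have "u \<in> Poly_Mapping.keys (pre x (SG i (bvec w')))"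
    using Suc.prems(2) by (simp add: w pre_bvec[symmetric])
  then obtain u' where u: "u = x # u'" "u' \<in> Poly_Mapping.keys (SG i (bvec w'))"
    by (auto simp: keys_pre)
  moreover have "mset u' = mset w'"
    using SG_mset[of i w'] u(2) by (auto simp: fmod_def)
  moreover have "same_col (Suc i) (map fst w) = same_col i (map fst w')" "pure_cross (Suc i) w = pure_cross i w'"
    by (simp_all add: w same_col_def pure_cross_def)
  ultimately show ?case
    using Suc.IH[OF w(2) u(2)] by (simp add: w)
qed

text \<open>Equality in the sum of the local estimates forces purity at every crossing. Conversely,
  \<open>SGs_pure\<close> shows that a pure product attains the bound, with coefficient 1.\<close>

lemma SGs_keys:
  assumes "set is \<subseteq> {i. Suc i < length w}" "u \<in> Poly_Mapping.keys (SGs is (bvec w))"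
  shows "map fst u = perm is (map fst w) \<and> inversions w \<le> inversions u + ncross is (map fst w) \<and>
    (inversions w = inversions u + ncross is (map fst w) \<longrightarrow> pure is w \<and> u = perm is w)"
  using assms
proof (induction "is" arbitrary: u)
  case (Cons i "is")
  obtain u' where u': "u' \<in> Poly_Mapping.keys (SGs is (bvec w))" "u \<in> Poly_Mapping.keys (SG i (bvec u'))"
    using Cons.prems(2) keys_lin[OF lin_SG, of u i "SGs is (bvec w)"] by auto
  have IH: "map fst u' = perm is (map fst w)" "inversions w \<le> inversions u' + ncross is (map fst w)"
    "inversions w = inversions u' + ncross is (map fst w) \<Longrightarrow> pure is w \<and> u' = perm is w"
    using Cons.IH[OF _ u'(1)] Cons.prems(1) by auto
  have "length u' = length w"
    using arg_cong[OF IH(1), of length] by simp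
  then show ?case
    using SG_keys[OF _ u'(2)] Cons.prems(1) IH by auto
qed simp

lemma SG_pure:
  assumes "Suc i < length w" "pure_cross i w"
  shows "SG i (bvec w) = bvec (swp i w) \<and> inversions w = inversions (swp i w) + same_col i (map fst w)"
  using assms
proof (induction i arbitrary: w)
  case 0
  then obtain x y w' where w: "w = x # y # w'" by (cases w; cases "tl w") auto
  obtain b i where x: "x = (b, i)" by fastforce
  obtain c j where y: "y = (c, j)" by fastforce
  show ?case
  proof (cases "b = c")
    case True
    then show ?thesis
      using 0(2) SG_same(3)[of c "bvec w'"] by (simp add: w x y pure_cross_def same_col_def pre_bvec)
  next
    case False
    then show ?thesis
      using SG_diff[of b c i j "bvec w'"] by (auto simp: w x y pre_bvec same_col_def)
  qed
next
  case (Suc i)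
  then obtain x w' where w: "w = x # w'" "Suc i < length w'" by (cases w) auto
  have "SG (Suc i) (bvec w) = pre x (SG i (bvec w'))"
    by (simp add: w pre_bvec[symmetric])
  then show ?case
    using Suc.IH[OF w(2)] Suc.prems(2) by (simp add: w pre_bvec pure_cross_def same_col_def)
qed

lemma SGs_pure:
  assumes "set is \<subseteq> {i. Suc i < length w}" "pure is w"
  shows "SGs is (bvec w) = bvec (perm is w)"
    and "inversions w = inversions (perm is w) + ncross is (map fst w)"
proof -
  have "SGs is (bvec w) = bvec (perm is w) \<and> inversions w = inversions (perm is w) + ncross is (map fst w)"
    using assms
  proof (induction "is")
    case (Cons i "is")
    then show ?case
      using SG_pure[of i "perm is w"] by (simp add: map_perm)
  qed simp
  then show "SGs is (bvec w) = bvec (perm is w)"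
    "inversions w = inversions (perm is w) + ncross is (map fst w)" by auto
qed

lemma pure_append: "pure (xs @ ys) w \<longleftrightarrow> pure ys w \<and> pure xs (perm ys w)"
  by (induction xs) auto

lemma perm_map_Suc: "perm (map Suc is) (x # w) = x # perm is w"
  by (induction "is") auto

lemma pure_map_Suc: "pure (map Suc is) (x # w) = pure is w"
  by (induction "is") (auto simp: perm_map_Suc pure_cross_def)

lemma ncross_append: "ncross (xs @ ys) w = ncross ys w + ncross xs (perm ys w)"
  by (induction xs) auto

text \<open>In a product of crossings pure for two labellings \<open>x\<close>, \<open>x'\<close> of the same coloured strands, a strand with
  labels \<open>I2\<close>, \<open>I1\<close> crosses no strand of its colour.\<close>

lemma mixed_strand:
  fixes L :: "(nat \<times> idx \<times> idx) list"
  assumes "set is \<subseteq> {i. Suc i < length L}"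
    "pure is (map (\<lambda>(b, x, x'). (b, x)) L)" "pure is (map (\<lambda>(b, x, x'). (b, x')) L)"
    "filter (\<lambda>e. fst e = b) L = A @ (b, I2, I1) # B"
  shows "\<exists>A' B'. filter (\<lambda>e. fst e = b) (perm is L) = A' @ (b, I2, I1) # B' \<and> mset A' = mset A"
  using assms
proof (induction "is")
  case (Cons i "is")
  let ?m = "(b, I2, I1)"
  obtain A' B' where *: "filter (\<lambda>e. fst e = b) (perm is L) = A' @ ?m # B'" "mset A' = mset A"
    using Cons by auto
  let ?L = "perm is L"
  have i: "Suc i < length ?L" using Cons.prems(1) by simp
  obtain P Q u v where L: "?L = P @ u # v # Q" "length P = i"
  proof (rule that)
    show "?L = take i ?L @ ?L ! i # ?L ! Suc i # drop (Suc (Suc i)) ?L"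
      using id_take_nth_drop[of i ?L] i Cons_nth_drop_Suc[OF i] by simp
  qed (use i in simp)
  have sw: "swp i (P @ u # v # Q) = P @ v # u # Q"
    using L(2) by (induction P arbitrary: i) auto
  have pc: "pure_cross i (map (\<lambda>(b, x, x'). (b, x)) ?L)" "pure_cross i (map (\<lambda>(b, x, x'). (b, x')) ?L)"
    using Cons.prems(2,3) by (simp_all add: map_perm)
  show ?case
  proof (cases "fst u = fst v \<and> fst v = b")
    case False
    then have "filter (\<lambda>e. fst e = b) (swp i ?L) = filter (\<lambda>e. fst e = b) ?L"
      by (auto simp: L sw)
    then show ?thesis using * by auto
  next
    case True
    \<comment> \<open>Purity for both labellings forces \<open>I2\<close> before \<open>I1\<close>
      in each of them, so neither of the two crossing strands is the mixed one.\<close>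
    have uv: "u = (b, I2, I2)" "v = (b, I1, I1)"
      using pc True L(2) by (cases u; cases v; auto simp: L pure_cross_def nth_append)+
    let ?f = "filter (\<lambda>e. fst e = b)"
    have eq: "?f P @ u # v # ?f Q = A' @ ?m # B'"
      using *(1) by (simp add: L uv)
    have sw': "?f (swp i ?L) = ?f P @ v # u # ?f Q"
      using sw by (simp add: L uv)
    show ?thesis
    proof (cases "length A' < length (?f P)")
      case True
      then obtain R where "?f P = A' @ ?m # R"
        using eq uv by (auto simp: append_eq_append_conv2 Cons_eq_append_conv append_eq_Cons_conv)
      then show ?thesis using *(2) sw' by auto
    next
      case False
      then obtain R where R: "A' = ?f P @ R" "u # v # ?f Q = R @ ?m # B'"
        using eq by (auto simp: append_eq_append_conv2)
      then obtain R' where R': "R = u # v # R'" "?f Q = R' @ ?m # B'"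
        using uv by (cases R; cases "tl R") auto
      then have "?f (swp i ?L) = (?f P @ v # u # R') @ ?m # B'"
        by (simp add: sw')
      moreover have "mset (?f P @ v # u # R') = mset A"
        using *(2) by (simp add: R R' add_mset_commute)
      ultimately show ?thesis
        by (intro exI[of _ "?f P @ v # u # R'"] exI[of _ B']) simp
    qed
  qed
qed auto

section \<open>Operators commuting with the quantum group\<close>

definition colored :: "nat list \<Rightarrow> vbasis list set" where
  "colored f = {w. map fst w = f}"

abbreviation cmod :: "nat list \<Rightarrow> vec set" where
  "cmod f \<equiv> fmod (colored f)"

lemma colored_Nil [simp]: "colored [] = {[]}"
  by (auto simp: colored_def)

lemma colored_Cons: "w \<in> colored (b # f) \<longleftrightarrow> (\<exists>x w'. w = (b, x) # w' \<and> w' \<in> colored f)"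
  by (cases w) (auto simp: colored_def)

lemma pre_colored: "v \<in> cmod f \<Longrightarrow> pre (b, x) v \<in> cmod (b # f)"
  by (rule lin_fmod[OF lin_pre]) (auto simp: pre_bvec colored_def)

lemma uop_colored: "v \<in> cmod f \<Longrightarrow> uop g v \<in> cmod f"
proof (rule lin_fmod[OF lin_uop])
  show "uop g (bvec w) \<in> cmod f" if "w \<in> colored f" for w
    using that
  proof (induction w arbitrary: f)
    case Nil
    then show ?case
      by (cases g rule: uop.cases) auto
  next
    case (Cons e w)
    then obtain b x f' where f: "e = (b, x)" "f = b # f'" "w \<in> colored f'"
      by (cases e) (auto simp: colored_def)
    have v: "bvec w \<in> cmod f'"
      using f by simp
    have dg: "diag \<chi> (bvec w) \<in> cmod f'" for \<chi>
      using v by (simp add: diag_bvec fmod_sc)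
    have "uop g (bvec (e # w)) = uop g (pre e (bvec w))"
      by (simp add: pre_bvec)
    also have "\<dots> \<in> cmod f"
      using Cons.IH[OF f(3)] v dg unfolding f(1,2)
      by (cases g rule: uop.cases) (auto simp: op_simps intro!: fmod_add fmod_sc pre_colored)
    finally show ?case .
  qed
qed

lemma diag_colored: "v \<in> cmod f \<Longrightarrow> diag \<chi> v \<in> cmod f"
  by (rule lin_fmod[OF lin_diag]) (auto simp: diag_bvec fmod_sc)

lemma Eop_colored: "v \<in> cmod f \<Longrightarrow> Eop b v \<in> cmod f"
  and Fop_colored: "v \<in> cmod f \<Longrightarrow> Fop b v \<in> cmod f"
  using uop_colored[of v f "(b, GE)"] uop_colored[of v f "(b, GF)"] by simp_all

abbreviation cnt2 :: "nat \<Rightarrow> vbasis list \<Rightarrow> nat" where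
  "cnt2 b w \<equiv> count (mset w) (b, I2)"

lemma Eop_keys:
  assumes "u \<in> Poly_Mapping.keys (Eop b (bvec w))"
  shows "cnt2 b w = cnt2 b u + 1"
  using assms
proof (induction w arbitrary: u)
  case (Cons e w)
  have "Eop b (bvec (e # w)) =
      (if e = (b, I2) then bvec ((b, I1) # w) else 0) + sc (kwt b e) (pre e (Eop b (bvec w)))"
    using Eop_pre[of b e "bvec w"] by (simp add: pre_bvec)
  then have "u \<in> Poly_Mapping.keys (if e = (b, I2) then bvec ((b, I1) # w) else 0 :: vec) \<or>
      u \<in> Poly_Mapping.keys (pre e (Eop b (bvec w)))"
    using Cons.prems Poly_Mapping.keys_add[of "if e = (b, I2) then bvec ((b, I1) # w) else 0 :: vec"
        "sc (kwt b e) (pre e (Eop b (bvec w)))"] keys_sc[of "kwt b e" "pre e (Eop b (bvec w))"]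
    by (simp only:) blast
  then show ?case
    using Cons.IH by (auto simp: keys_pre split: if_splits)
qed simp

lemma kwt_prod: "prod_list (map (kwt b) w) = q ^ count (mset w) (b, I1) * inverse q ^ cnt2 b w"
  by (induction w) (auto simp: kwt_def ac_simps)

lemma kinvwt_prod: "prod_list (map (kinvwt b) w) = inverse q ^ count (mset w) (b, I1) * q ^ cnt2 b w"
  by (induction w) (auto simp: kinvwt_def ac_simps)

lemma colored_count: "w \<in> colored f \<Longrightarrow> count (mset w) (b, I1) + cnt2 b w = count (mset f) b"
proof (induction w arbitrary: f)
  case (Cons e w)
  then obtain f' where "f = fst e # f'" "w \<in> colored f'"
    by (auto simp: colored_def)
  then show ?case
    using Cons.IH[of f'] by (cases e; cases "snd e") auto
qed (auto simp: colored_def)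

lemma diag_const:
  assumes "\<And>u. u \<in> Poly_Mapping.keys v \<Longrightarrow> prod_list (map \<chi> u) = c"
  shows "diag \<chi> v = sc c v"
  by (rule lin_eq_on[OF lin_diag lin_sc[OF lin_id], of "Poly_Mapping.keys v"])
     (use assms in \<open>auto simp: diag_bvec fmod_def\<close>)

text \<open>The number of letters of colour \<open>b\<close> is fixed, so on balance
  \<open>X\<close> turns \<open>m\<close> letters \<open>(b, I2)\<close> into
  \<open>(b, I1)\<close>; each of them multiplies the eigenvalue of \<open>K\<close> by
  \<open>q ^ 2\<close>.\<close>

lemma raising_K:
  assumes X: "lin X" "\<And>v. v \<in> cmod f \<Longrightarrow> X v \<in> cmod f"
    and m: "\<And>w u. w \<in> colored f \<Longrightarrow> u \<in> Poly_Mapping.keys (X (bvec w)) \<Longrightarrow> cnt2 b w = cnt2 b u + m"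
    and v: "v \<in> cmod f"
  shows "Kop b (X v) = sc (q ^ (2 * m)) (X (Kop b v))" "Kinv b (X v) = sc (inverse q ^ (2 * m)) (X (Kinv b v))"
proof -
  have qq: "q ^ a * inverse q ^ a = 1" "inverse q ^ a * q ^ a = 1" for a
    using q_nz by (simp_all add: power_mult_distrib[symmetric])
  have cancel: "x * P * y = P * P * (x * (y * R))" "x * R * y = R * R * (x * (y * P))" if "P * R = 1" for P R x y :: kq
  proof -
    have "P * P * (x * (y * R)) = (P * R) * (x * P * y)" "R * R * (x * (y * P)) = (P * R) * (x * R * y)"
      by (simp_all add: algebra_simps)
    then show "x * P * y = P * P * (x * (y * R))" "x * R * y = R * R * (x * (y * P))"
      using that by (simp_all only: mult_1_left)
  qed
  have wt: "prod_list (map (kwt b) u) = q ^ (2 * m) * prod_list (map (kwt b) w)"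
    "prod_list (map (kinvwt b) u) = inverse q ^ (2 * m) * prod_list (map (kinvwt b) w)"
    if "w \<in> colored f" "u \<in> Poly_Mapping.keys (X (bvec w))" for u w
  proof -
    have "u \<in> colored f"
      using X(2)[of "bvec w"] that by (auto simp: fmod_def)
    then have c: "count (mset u) (b, I1) = count (mset w) (b, I1) + m" "cnt2 b w = cnt2 b u + m"
      using colored_count[OF that(1), of b] colored_count[of u f b] m[OF that] by auto
    show "prod_list (map (kwt b) u) = q ^ (2 * m) * prod_list (map (kwt b) w)"
      unfolding kwt_prod c mult_2 power_add by (rule cancel(1)[OF qq(1)])
    show "prod_list (map (kinvwt b) u) = inverse q ^ (2 * m) * prod_list (map (kinvwt b) w)"
      unfolding kinvwt_prod c mult_2 power_add by (rule cancel(2)[OF qq(1)])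
  qed
  show "Kop b (X v) = sc (q ^ (2 * m)) (X (Kop b v))"
    by (rule lin_eq_on[OF lin_comp[OF lin_diag X(1)] lin_sc[OF lin_comp[OF X(1) lin_diag]] _ v])
       (use wt(1) in \<open>simp add: diag_const diag_bvec lin_scale[OF X(1)]\<close>)
  show "Kinv b (X v) = sc (inverse q ^ (2 * m)) (X (Kinv b v))"
    by (rule lin_eq_on[OF lin_comp[OF lin_diag X(1)] lin_sc[OF lin_comp[OF X(1) lin_diag]] _ v])
       (use wt(2) in \<open>simp add: diag_const diag_bvec lin_scale[OF X(1)]\<close>)
qed

text \<open>The quantum adjoint action on operators: \<open>X\<close> of weight \<open>2 m\<close> is raised to \<open>E X - q\<^sup>2\<^sup>m X E\<close> and lowered to
  \<open>(F X - X F) K\<close>. The sum of quantum integers \<open>[2 m] + \<dots> + [2 (m + j)]\<close> is a product of two of them, up to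
  units, hence not zero.\<close>

definition qint2 :: "nat \<Rightarrow> kq" where
  "qint2 a = inverse (q - inverse q) * (q ^ (2 * a) - inverse q ^ (2 * a))"

lemma qint2_sum_nz:
  assumes "m > 0"
  shows "(\<Sum>i\<le>j. qint2 (m + i)) \<noteq> 0"
proof -
  let ?r = "inverse q"
  \<comment> \<open>The factor \<open>q - ?r\<close> makes the sum telescope.\<close>
  have "(q - ?r) * (\<Sum>i\<le>j. q ^ (2 * (m + i)) - ?r ^ (2 * (m + i))) =
      q ^ (2 * m + 2 * j + 1) + ?r ^ (2 * m + 2 * j + 1) - q ^ (2 * m - 1) - ?r ^ (2 * m - 1)"
  proof (induction j)
    case 0
    obtain k where "2 * m = Suc k" using assms by (cases "2 * m") auto
    then show ?case by (simp add: algebra_simps)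
  next
    case (Suc j)
    then show ?case
      by (simp add: distrib_left) (simp add: algebra_simps power_add)
  qed
  \<comment> \<open>The four terms factor into two differences, each nonzero because
    \<open>q\<close> is not a root of unity.\<close>
  also have "\<dots> = ?r ^ (2 * m + 2 * j + 1) * ((q ^ (4 * m + 2 * j) - 1) * (q ^ (2 * j + 2) - 1))"
  proof -
    have r: "?r ^ (a + c) * q ^ a = ?r ^ c" for a c
      using q_nz by (simp add: power_add power_mult_distrib[symmetric] algebra_simps)
    have r': "?r ^ c * q ^ (c + a) = q ^ a" for a c
      using q_nz by (simp add: power_add power_mult_distrib[symmetric] algebra_simps)
    have a: "?r ^ (2 * m + 2 * j + 1) * q ^ (2 * j + 2) = ?r ^ (2 * m - 1)"
      using r[of "2 * j + 2" "2 * m - 1"] assms by (simp add: algebra_simps)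
    have b: "?r ^ (2 * m + 2 * j + 1) * q ^ (4 * m + 2 * j) = q ^ (2 * m - 1)"
    proof -
      have "4 * m + 2 * j = (2 * m + 2 * j + 1) + (2 * m - 1)" using assms by simp
      then show ?thesis using r'[of "2 * m + 2 * j + 1" "2 * m - 1"] by metis
    qed
    have c: "?r ^ (2 * m + 2 * j + 1) * (q ^ (4 * m + 2 * j) * q ^ (2 * j + 2)) = q ^ (2 * m + 2 * j + 1)"
    proof -
      have "q ^ (4 * m + 2 * j) * q ^ (2 * j + 2) = q ^ ((2 * m + 2 * j + 1) + (2 * m + 2 * j + 1))"
        by (simp add: power_add[symmetric] algebra_simps del: power_Suc)
      then show ?thesis using r'[of "2 * m + 2 * j + 1" "2 * m + 2 * j + 1"] by metis
    qed
    have dist: "R * ((A - 1) * (B - 1)) = R * (A * B) - R * A - R * B + R" for R A B :: kq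
      by (simp add: algebra_simps)
    show ?thesis unfolding dist a b c by simp
  qed
  also have "\<dots> \<noteq> 0"
    using q_nz q_powers_ne_1[of "4 * m + 2 * j"] q_powers_ne_1[of "2 * j + 2"] assms by simp
  finally have "(\<Sum>i\<le>j. q ^ (2 * (m + i)) - ?r ^ (2 * (m + i))) \<noteq> 0"
    by auto
  then show ?thesis
    using q_minus_inv_nz unfolding qint2_def sum_distrib_left[symmetric] by simp
qed

text \<open>Moving \<open>F\<close> past \<open>E\<close> costs their commutator. Since
  \<open>X\<close> has weight \<open>2 m\<close>, the two terms with \<open>K\<close> cancel, and
  those with its inverse combine to \<open>qint2 m\<close>.\<close>

lemma adjoint_lowering:
  assumes X: "lin X" "\<And>v. v \<in> cmod f \<Longrightarrow> X v \<in> cmod f"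
    and m: "\<And>w u. w \<in> colored f \<Longrightarrow> u \<in> Poly_Mapping.keys (X (bvec w)) \<Longrightarrow> cnt2 b w = cnt2 b u + m"
    and v: "v \<in> cmod f"
    and Y: "\<And>v. Y v = Eop b (X v) - sc (q ^ (2 * m)) (X (Eop b v))"
    and D: "\<And>v. D v = Fop b (X v) - X (Fop b v)"
  shows "Fop b (Y v) - Y (Fop b v) =
    Eop b (D v) - sc (q ^ (2 * m)) (D (Eop b v)) - sc (qint2 m) (X (Kinv b v))"
proof -
  let ?t = "q ^ (2 * m)" and ?c = "inverse (q - inverse q)"
  note L = lin_simps[OF X(1)]
  have EF: "Eop b (Fop b u) = Fop b (Eop b u) + sc ?c (Kop b u - Kinv b u)" for u
    using Eop_Fop[of b u] by (simp add: algebra_simps)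
  have K: "Kop b (X v) = sc ?t (X (Kop b v))" "Kinv b (X v) = sc (inverse q ^ (2 * m)) (X (Kinv b v))"
    using raising_K[OF X m v] by blast+
  have "Fop b (Y v) - Y (Fop b v) = Fop b (Eop b (X v)) - sc ?t (Fop b (X (Eop b v)))
      - Eop b (X (Fop b v)) + sc ?t (X (Eop b (Fop b v)))"
    by (simp add: Y op_simps)
  also have "\<dots> = Eop b (D v) - sc ?t (D (Eop b v)) - sc ?c (Kop b (X v) - Kinv b (X v))
      + sc ?t (sc ?c (X (Kop b v) - X (Kinv b v)))"
    by (simp add: D op_simps EF L)
  also have "\<dots> = Eop b (D v) - sc ?t (D (Eop b v)) - sc (qint2 m) (X (Kinv b v))"
    unfolding K qint2_def by (intro poly_mapping_eqI) (simp add: lookup_add lookup_minus algebra_simps)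
  finally show ?thesis .
qed

lemma raised_keys:
  assumes "lin X" "\<And>v. v \<in> cmod f \<Longrightarrow> X v \<in> cmod f"
    and m: "\<And>w u. w \<in> colored f \<Longrightarrow> u \<in> Poly_Mapping.keys (X (bvec w)) \<Longrightarrow> cnt2 b w = cnt2 b u + m"
    and w: "w \<in> colored f" and u: "u \<in> Poly_Mapping.keys (Eop b (X (bvec w)) - sc t (X (Eop b (bvec w))))"
  shows "cnt2 b w = cnt2 b u + Suc m"
proof -
  have "u \<in> Poly_Mapping.keys (Eop b (X (bvec w))) \<or> u \<in> Poly_Mapping.keys (X (Eop b (bvec w)))"
    using u by (auto simp: in_keys_iff lookup_minus)
  then show ?thesis
  proof
    assume "u \<in> Poly_Mapping.keys (Eop b (X (bvec w)))"
    then obtain u' where "u' \<in> Poly_Mapping.keys (X (bvec w))" "u \<in> Poly_Mapping.keys (Eop b (bvec u'))"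
      by (rule keys_lin[OF lin_Eop])
    then show ?thesis using m[OF w] Eop_keys by fastforce
  next
    assume "u \<in> Poly_Mapping.keys (X (Eop b (bvec w)))"
    then obtain u' where u': "u' \<in> Poly_Mapping.keys (Eop b (bvec w))" "u \<in> Poly_Mapping.keys (X (bvec u'))"
      by (rule keys_lin[OF assms(1)])
    then have "u' \<in> colored f"
      using Eop_colored[of "bvec w" f b] w by (auto simp: fmod_def)
    then show ?thesis using m[OF _ u'(2)] Eop_keys[OF u'(1)] by simp
  qed
qed

text \<open>The lowering of the \<open>(j + 1)\<close>-fold raising \<open>Y (j + 1)\<close> of \<open>X\<close> is a nonzero multiple of \<open>Y j\<close>, and
  \<open>Y j\<close> vanishes for large \<open>j\<close> because of its weight.\<close>

lemma positive_weight_zero: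
  assumes X: "lin X" "\<And>v. v \<in> cmod f \<Longrightarrow> X v \<in> cmod f"
    and m: "\<And>w u. w \<in> colored f \<Longrightarrow> u \<in> Poly_Mapping.keys (X (bvec w)) \<Longrightarrow> cnt2 b w = cnt2 b u + m" "m > 0"
    and low: "\<And>v. v \<in> cmod f \<Longrightarrow> Eop b (Fop b (X v) - X (Fop b v)) =
      sc (q ^ (2 * m)) (Fop b (X (Eop b v)) - X (Fop b (Eop b v)))"
    and v: "v \<in> cmod f"
  shows "X v = 0"
proof -
  define Y where "Y = rec_nat X (\<lambda>j Z v. Eop b (Z v) - sc (q ^ (2 * (m + j))) (Z (Eop b v)))"
  have Y0: "Y 0 = X" and YS: "Y (Suc j) v = Eop b (Y j v) - sc (q ^ (2 * (m + j))) (Y j (Eop b v))" for j v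
    by (simp_all add: Y_def)
  have Y: "lin (Y j) \<and> (\<forall>v\<in>cmod f. Y j v \<in> cmod f) \<and>
      (\<forall>w\<in>colored f. \<forall>u\<in>Poly_Mapping.keys (Y j (bvec w)). cnt2 b w = cnt2 b u + (m + j))" for j
  proof (induction j)
    case 0
    then show ?case using X m by (simp add: Y0)
  next
    case (Suc j)
    then have lin: "lin (Y j)" and cl: "\<And>v. v \<in> cmod f \<Longrightarrow> Y j v \<in> cmod f"
      and k: "\<And>w u. w \<in> colored f \<Longrightarrow> u \<in> Poly_Mapping.keys (Y j (bvec w)) \<Longrightarrow> cnt2 b w = cnt2 b u + (m + j)"
      by auto
    have "lin (Y (Suc j))"
      unfolding YS[abs_def] by (intro lin_diff lin_sc lin_comp[OF lin_Eop lin] lin_comp[OF lin lin_Eop])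
    moreover have "Y (Suc j) v \<in> cmod f" if "v \<in> cmod f" for v
      unfolding YS using that by (intro fmod_diff fmod_sc cl Eop_colored)
    moreover have "cnt2 b w = cnt2 b u + (m + Suc j)"
      if "w \<in> colored f" "u \<in> Poly_Mapping.keys (Y (Suc j) (bvec w))" for w u
      using raised_keys[OF lin cl k that(1)] that(2) unfolding YS by simp
    ultimately show ?case by blast
  qed
  define D where "D j v = Fop b (Y j v) - Y j (Fop b v)" for j v
  have step: "D (Suc j) v = Eop b (D j v) - sc (q ^ (2 * (m + j))) (D j (Eop b v)) - sc (qint2 (m + j)) (Y j (Kinv b v))"
    if "v \<in> cmod f" for j v
    unfolding D_def[of "Suc j"]
    by (rule adjoint_lowering[of "Y j" f b "m + j" v "Y (Suc j)" "D j"]) (use Y[of j] that in \<open>auto simp: YS D_def\<close>)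
  have Dj: "D (Suc j) v = - sc (\<Sum>i\<le>j. qint2 (m + i)) (Y j (Kinv b v))" if "v \<in> cmod f" for j v
    using that
  proof (induction j arbitrary: v)
    case 0
    have "Eop b (D 0 v) = sc (q ^ (2 * m)) (D 0 (Eop b v))"
      using low[OF 0] by (simp add: D_def Y0)
    then show ?case
      using step[OF 0, of 0] by simp
  next
    case (Suc j)
    note L = lin_simps[OF conjunct1[OF Y[of j]]]
    let ?c = "\<Sum>i\<le>j. qint2 (m + i)"
    \<comment> \<open>Passing \<open>Kinv\<close> through \<open>E\<close> yields a factor that
      turns the raising factor of step \<open>j + 1\<close> into that of step \<open>j\<close>. So
      \<open>Y (Suc j)\<close> reappears, and the sum of quantum integers grows by one term.\<close>
    have "Y j (Kinv b (Eop b v)) = sc (inverse q * inverse q) (Y j (Eop b (Kinv b v)))"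
      by (simp add: Kinv_Eop L)
    moreover have "q ^ (2 * (m + Suc j)) * (inverse q * inverse q) = q ^ (2 * (m + j))"
      by (simp add: algebra_simps)
    ultimately have "sc (q ^ (2 * (m + Suc j))) (Y j (Kinv b (Eop b v))) = sc (q ^ (2 * (m + j))) (Y j (Eop b (Kinv b v)))"
      by simp
    moreover have "Eop b (D (Suc j) v) - sc (q ^ (2 * (m + Suc j))) (D (Suc j) (Eop b v)) =
        - sc ?c (Eop b (Y j (Kinv b v)) - sc (q ^ (2 * (m + Suc j))) (Y j (Kinv b (Eop b v))))"
      unfolding Suc.IH[OF Suc.prems] Suc.IH[OF Eop_colored[OF Suc.prems]]
      by (simp add: op_simps mult.commute)
    ultimately have "Eop b (D (Suc j) v) - sc (q ^ (2 * (m + Suc j))) (D (Suc j) (Eop b v)) =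
        - sc ?c (Y (Suc j) (Kinv b v))"
      by (simp add: YS)
    then show ?case
      unfolding step[OF Suc.prems, of "Suc j"] by (simp add: sc_add_left)
  qed
  have top: "Y j v = 0" if "m + j > length f" "v \<in> cmod f" for j v
  proof -
    have "Y j (bvec w) = 0" if w: "w \<in> colored f" for w
    proof -
      have "u \<notin> Poly_Mapping.keys (Y j (bvec w))" for u
      proof
        assume "u \<in> Poly_Mapping.keys (Y j (bvec w))"
        then have "cnt2 b w \<ge> m + j" using Y[of j] w by auto
        moreover have "cnt2 b w \<le> length w"
          using count_le_size[of "mset w"] by simp
        moreover have "length w = length f"
          using w by (auto simp: colored_def)
        ultimately show False using \<open>m + j > length f\<close> by simp
      qed
      then show ?thesis by (metis keys_eq_empty equals0I)
    qed
    then show ?thesis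
      using lin_eq_on[of "Y j" "\<lambda>v. 0" "colored f" v] Y[of j] that(2) by simp
  qed
  have "Y j v = 0" if "v \<in> cmod f" "j \<le> length f" for j v
    using that(2,1)
  proof (induction arbitrary: v rule: inc_induct)
    case base
    then show ?case using top m(2) by simp
  next
    case (step j)
    \<comment> \<open>\<open>Y (Suc j)\<close> vanishes by induction, hence so does its lowering.
      The argument \<open>Kop b v\<close> cancels the \<open>Kinv\<close> in
      \<open>Dj\<close>.\<close>
    have "D (Suc j) (Kop b v) = 0"
      unfolding D_def using step.IH[of "Kop b v"] step.IH[of "Fop b (Kop b v)"] step.prems
      by (simp add: diag_colored Fop_colored)
    then show ?case
      using Dj[OF diag_colored[OF step.prems, of "kwt b"], of j] qint2_sum_nz[OF m(2), of j] by simp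
  qed
  from this[OF v, of 0] show ?thesis by (simp add: Y0)
qed

section \<open>Matrix blocks with respect to the first strand\<close>

definition strip :: "vbasis \<Rightarrow> vec \<Rightarrow> vec" where
  "strip e = lext (\<lambda>w. case w of [] \<Rightarrow> 0 | e' # w' \<Rightarrow> if e' = e then bvec w' else 0)"

lemma lin_strip [simp]: "lin (strip e)"
  by (simp add: strip_def)

lemma strip_pre: "strip e (pre e' v) = (if e = e' then v else 0)"
proof (rule fun_cong[where x = v], rule lin_ext)
  show "strip e (pre e' (bvec w)) = (if e = e' then bvec w else 0)" for w
    by (simp add: strip_def pre_bvec)
qed (cases "e = e'"; simp add: lin_comp[OF lin_strip])+

lemma strip_nil [simp]: "strip e (bvec []) = 0"
  by (simp add: strip_def)

lemma strip_zero [simp]: "strip e 0 = 0"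
  by (simp add: lin_zero)

lemmas strip_simps = lin_simps[OF lin_strip] strip_pre

lemma lookup_strip: "Poly_Mapping.lookup (strip e v) w = Poly_Mapping.lookup v (e # w)"
proof -
  have "Poly_Mapping.lookup (strip e v) w =
      (\<Sum>u\<in>Poly_Mapping.keys v. Poly_Mapping.lookup v u * (if u = e # w then 1 else 0))"
    unfolding strip_def lext_def lookup_sum lookup_sc
    by (intro sum.cong) (auto simp: lookup_single when_def split: list.splits)
  also have "\<dots> = Poly_Mapping.lookup v (e # w)"
    by (auto simp: if_distrib in_keys_iff cong: if_cong)
  finally show ?thesis .
qed

lemma strip_Fop: "strip e (Fop c v) = (if e = (c, I2) then Kinv c (strip (c, I1) v) else 0) + Fop c (strip e v)"
proof (rule fun_cong[where x = v], rule lin_ext)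
  show "strip e (Fop c (bvec w)) = (if e = (c, I2) then Kinv c (strip (c, I1) (bvec w)) else 0) + Fop c (strip e (bvec w))"
    for w
  proof (cases w)
    case (Cons e' w')
    then have w: "bvec w = (pre e' (bvec w') :: vec)" by (simp add: pre_bvec)
    show ?thesis
      unfolding w by (auto simp: op_simps strip_simps)
  qed simp
qed (cases "e = (c, I2)"; simp add: lin_comp[OF lin_strip] lin_comp[OF lin_Fop lin_strip] lin_comp[OF lin_diag lin_strip])+

lemma strip_colored: "v \<in> cmod (b # f) \<Longrightarrow> strip (b, x) v \<in> cmod f"
proof (rule lin_fmod[OF lin_strip])
  fix w assume "w \<in> colored (b # f)"
  then obtain y w' where "w = (b, y) # w'" "w' \<in> colored f"
    by (auto simp: colored_Cons)
  then show "strip (b, x) (bvec w) \<in> cmod f"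
    using strip_pre[of "(b, x)" "(b, y)" "bvec w'"] by (simp add: pre_bvec)
qed

lemma strip_zero_imp:
  assumes "v \<in> cmod (b # f)" "strip (b, I1) v = 0" "strip (b, I2) v = 0"
  shows "v = 0"
proof (rule poly_mapping_eqI)
  fix w
  show "Poly_Mapping.lookup v w = Poly_Mapping.lookup 0 w"
  proof (rule ccontr)
    assume nz: "\<not> ?thesis"
    then have "w \<in> colored (b # f)"
      using assms(1) by (auto simp: fmod_def in_keys_iff)
    then obtain x w' where "w = (b, x) # w'" by (auto simp: colored_Cons)
    then have "Poly_Mapping.lookup v w = 0"
      using lookup_strip[of "(b, x)" v w'] assms(2,3) by (cases x) simp_all
    then show False using nz by simp
  qed
qed

text \<open>The pairs of words indexing those matrix coefficients that determine an operator of height \<open>h\<close> commuting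
  with the lowering operators. The height of a colour counts the letters \<open>I2\<close> of the output minus those of the
  input; reading the two words as a lattice path, heights are those of the remaining suffixes.\<close>

fun canonical :: "vbasis list \<Rightarrow> vbasis list \<Rightarrow> (nat \<Rightarrow> int) \<Rightarrow> bool" where
  "canonical [] [] h = (\<forall>b. h b = 0)"
| "canonical ((b, x) # u) ((c, y) # w) h = (b = c \<and> h b \<ge> 0 \<and> \<not> (x = I2 \<and> y = I2 \<and> h b = 0) \<and>
     canonical u w (h(b := h b - of_bool (x = I2) + of_bool (y = I2))))"
| "canonical _ _ h = False"

text \<open>The height is arbitrary because the block with labels \<open>x\<close>, \<open>y\<close>
  of the first strand has its height shifted by these labels. The order in which the blocks are
  shown to vanish is dictated by the terms in which they fail to be invariant.\<close>

theorem canonical_coefficients_determine: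
  assumes X: "lin X" "\<And>v. v \<in> cmod f \<Longrightarrow> X v \<in> cmod f"
    and h: "\<And>w u b. w \<in> colored f \<Longrightarrow> u \<in> Poly_Mapping.keys (X (bvec w)) \<Longrightarrow> int (cnt2 b u) = int (cnt2 b w) + h b"
    and F: "\<And>b v. v \<in> cmod f \<Longrightarrow> Fop b (X v) = X (Fop b v)"
    and can: "\<And>w u. w \<in> colored f \<Longrightarrow> canonical u w h \<Longrightarrow> Poly_Mapping.lookup (X (bvec w)) u = 0"
    and v: "v \<in> cmod f"
  shows "X v = 0"
  using assms
proof (induction f arbitrary: X h v)
  case Nil
  have "X (bvec []) = 0"
  proof (rule poly_mapping_eqI)
    fix u
    show "Poly_Mapping.lookup (X (bvec [])) u = Poly_Mapping.lookup 0 u"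
    proof (cases "u = []")
      case True
      show ?thesis
      proof (rule ccontr)
        assume nz: "\<not> ?thesis"
        then have "[] \<in> Poly_Mapping.keys (X (bvec []))"
          using True by (simp add: in_keys_iff)
        then have "\<forall>b. h b = 0"
          using Nil(3)[of "[]" "[]"] by simp
        then show False
          using Nil(5)[of "[]" "[]"] nz True by simp
      qed
    next
      case False
      then show ?thesis
        using Nil(2)[of "bvec []"] by (auto simp: fmod_def in_keys_iff)
    qed
  qed
  then show ?case
    using lin_eq_on[OF Nil(1), of "\<lambda>v. 0" "colored []" v] Nil(6) by simp
next
  case (Cons b f)
  note X = Cons.prems(1,2) and h = Cons.prems(3) and F = Cons.prems(4) and can = Cons.prems(5)
  show ?case
  proof (cases "h b < 0")
    case True
    \<comment> \<open>A negative height is a positive weight, and there are no canonical pairs to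
      use; but the operator is invariant, so it vanishes.\<close>
    show ?thesis
    proof (rule positive_weight_zero[OF X, of b "nat (- h b)"])
      show "cnt2 b w = cnt2 b u + nat (- h b)"
        if "w \<in> colored (b # f)" "u \<in> Poly_Mapping.keys (X (bvec w))" for w u
        using h[OF that, of b] True by simp
      show "Eop b (Fop b (X v) - X (Fop b v)) = sc (q ^ (2 * nat (- h b))) (Fop b (X (Eop b v)) - X (Fop b (Eop b v)))"
        if "v \<in> cmod (b # f)" for v
        using F[OF that] F[OF Eop_colored[OF that]] by simp
    qed (use True Cons.prems(6) in auto)
  next
    case False
    define Z where "Z x y v = strip (b, x) (X (pre (b, y) v))" for x y v
    have linZ: "lin (Z x y)" for x y
      unfolding Z_def[abs_def] by (intro lin_comp[OF lin_strip lin_comp[OF X(1) lin_pre]])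
    note ZL = lin_simps[OF linZ]
    have Zc: "Z x y v \<in> cmod f" if "v \<in> cmod f" for x y v
      unfolding Z_def by (intro strip_colored X(2) pre_colored that)
    define H where "H x y = h(b := h b - of_bool (x = I2) + of_bool (y = I2))" for x y
    have Zk: "(b, x) # u \<in> Poly_Mapping.keys (X (bvec ((b, y) # w)))"
      if "u \<in> Poly_Mapping.keys (Z x y (bvec w))" for x y u w
      using that by (simp add: Z_def in_keys_iff lookup_strip pre_bvec)
    have Zh: "int (cnt2 c u) = int (cnt2 c w) + H x y c"
      if "w \<in> colored f" "u \<in> Poly_Mapping.keys (Z x y (bvec w))" for c u w x y
      using h[OF _ Zk[OF that(2)], of c] that(1) by (auto simp: colored_Cons H_def split: if_splits)
    have Zcan: "Poly_Mapping.lookup (Z x y (bvec w)) u = 0"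
      if "w \<in> colored f" "canonical u w (H x y)" "\<not> (x = I2 \<and> y = I2 \<and> h b = 0)" for x y u w
      using that can[of "(b, y) # w" "(b, x) # u"] False
      by (simp add: Z_def lookup_strip pre_bvec colored_Cons H_def)
    have Fother: "Fop c (Z x y v) = Z x y (Fop c v)" if "c \<noteq> b" "v \<in> cmod f" for c x y v
    proof -
      have "Fop c (X (pre (b, y) v)) = X (pre (b, y) (Fop c v))"
        using F[OF pre_colored[OF that(2), of b y], of c] that(1) by (simp add: Fop_pre)
      from arg_cong[OF this, of "strip (b, x)"] that(1) show ?thesis
        by (simp add: Z_def strip_Fop)
    qed
    have F2: "X (pre (b, I2) (Fop b v)) = Fop b (X (pre (b, I2) v))"
      and F1: "X (pre (b, I2) (Kinv b v)) + X (pre (b, I1) (Fop b v)) = Fop b (X (pre (b, I1) v))" if "v \<in> cmod f" for v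
      using F[OF pre_colored[OF that, of b I1], of b] F[OF pre_colored[OF that, of b I2], of b] lin_plus[OF X(1)] by (simp_all add: Fop_pre)
    \<comment> \<open>Each block is invariant up to terms from blocks that precede it in the order
      12, 11, 22, 21.\<close>
    have e12: "Z I1 I2 (Fop b v) = Fop b (Z I1 I2 v)"
      and e22: "Z I2 I2 (Fop b v) = Kinv b (Z I1 I2 v) + Fop b (Z I2 I2 v)"
      and e11: "Z I1 I2 (Kinv b v) + Z I1 I1 (Fop b v) = Fop b (Z I1 I1 v)"
      and e21: "Z I2 I2 (Kinv b v) + Z I2 I1 (Fop b v) = Kinv b (Z I1 I1 v) + Fop b (Z I2 I1 v)"
      if "v \<in> cmod f" for v
      using arg_cong[OF F1[OF that], of "strip (b, I1)"] arg_cong[OF F1[OF that], of "strip (b, I2)"]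
        arg_cong[OF F2[OF that], of "strip (b, I1)"] arg_cong[OF F2[OF that], of "strip (b, I2)"]
      by (simp_all add: Z_def strip_Fop strip_simps)
    have IH: "Z x y v = 0"
      if "\<And>v. v \<in> cmod f \<Longrightarrow> Fop b (Z x y v) = Z x y (Fop b v)" "\<not> (x = I2 \<and> y = I2 \<and> h b = 0)" "v \<in> cmod f"
      for x y v
    proof (rule Cons.IH[OF linZ[of x y] Zc Zh[of _ _ x y] _ _ that(3)])
      show "Fop c (Z x y v) = Z x y (Fop c v)" if "v \<in> cmod f" for c v
        using Fother[of c v x y] \<open>\<And>v. v \<in> cmod f \<Longrightarrow> Fop b (Z x y v) = Z x y (Fop b v)\<close>[OF that] that by (cases "c = b") auto
    qed (use Zcan that(2) in auto)
    have z12: "Z I1 I2 v = 0" if "v \<in> cmod f" for v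
      using that e12 by (intro IH) auto
    have z11: "Z I1 I1 v = 0" if "v \<in> cmod f" for v
      using that e11 z12[OF diag_colored] by (intro IH) auto
    have f22: "Fop b (Z I2 I2 v) = Z I2 I2 (Fop b v)" if "v \<in> cmod f" for v
      using e22[OF that] z12[OF that] by simp
    have f21: "Fop b (Z I2 I1 v) - Z I2 I1 (Fop b v) = Z I2 I2 (Kinv b v)" if "v \<in> cmod f" for v
      using e21[OF that] z11[OF that] by (simp add: algebra_simps)
    have z21: "Z I2 I1 v = 0" if v: "v \<in> cmod f" for v
    proof (cases "h b = 0")
      case True
      have k22: "cnt2 b w = cnt2 b u + 0"
        if "w \<in> colored f" "u \<in> Poly_Mapping.keys (Z I2 I2 (bvec w))" for w u
        using Zh[OF that, of b] True by (simp add: H_def)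
      \<comment> \<open>\<open>Z I2 I2\<close> has weight 0 and is invariant under \<open>F\<close>,
        so the lowering of its raising \<open>W\<close> is a multiple of \<open>qint2 0 = 0\<close>.
        As \<open>W\<close> has positive weight, it vanishes, which says that \<open>Z I2 I2\<close>
        commutes with \<open>E\<close> as well.\<close>
      define W where "W v = Eop b (Z I2 I2 v) - sc 1 (Z I2 I2 (Eop b v))" for v
      have linW: "lin W"
        unfolding W_def[abs_def] by (intro lin_diff lin_sc lin_comp[OF lin_Eop linZ] lin_comp[OF linZ lin_Eop])
      have Wc: "W v \<in> cmod f" if "v \<in> cmod f" for v
        unfolding W_def by (intro fmod_diff fmod_sc Zc Eop_colored that)
      have lowW: "Fop b (W v) - W (Fop b v) = 0" if "v \<in> cmod f" for v
      proof -
        have "Fop b (W v) - W (Fop b v) = Eop b ((\<lambda>v. 0) v) - sc (q ^ (2 * 0)) ((\<lambda>v. 0) (Eop b v)) - sc (qint2 0) (Z I2 I2 (Kinv b v))"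
        proof (rule adjoint_lowering[of "Z I2 I2" f b 0 v W "\<lambda>v. Fop b (Z I2 I2 v) - Z I2 I2 (Fop b v)", THEN trans])
          show "Eop b (Fop b (Z I2 I2 v) - Z I2 I2 (Fop b v)) -
              sc (q ^ (2 * 0)) (Fop b (Z I2 I2 (Eop b v)) - Z I2 I2 (Fop b (Eop b v))) -
              sc (qint2 0) (Z I2 I2 (Kinv b v)) =
            Eop b ((\<lambda>v. 0) v) - sc (q ^ (2 * 0)) ((\<lambda>v. 0) (Eop b v)) - sc (qint2 0) (Z I2 I2 (Kinv b v))"
            using f22[OF that] f22[OF Eop_colored[OF that]] by simp
        qed (use linZ Zc k22 that in \<open>auto simp: W_def\<close>)
        then show ?thesis by (simp add: qint2_def)
      qed
      have W0: "W v = 0" if "v \<in> cmod f" for v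
      proof (rule positive_weight_zero[OF linW Wc, of b 1])
        show "cnt2 b w = cnt2 b u + 1" if "w \<in> colored f" "u \<in> Poly_Mapping.keys (W (bvec w))" for w u
          using raised_keys[OF linZ[of I2 I2] Zc[of _ I2 I2] k22 that(1), where u = u and t = 1] that(2)
          by (simp add: W_def)
        show "Eop b (Fop b (W v) - W (Fop b v)) = sc (q ^ (2 * 1)) (Fop b (W (Eop b v)) - W (Fop b (Eop b v)))"
          if "v \<in> cmod f" for v
          using lowW[OF that] lowW[OF Eop_colored[OF that]] by simp
      qed (use that in auto)
      \<comment> \<open>\<open>Z I2 I1\<close> has positive weight but is not yet known to be
        invariant: its lowering is \<open>Z I2 I2\<close> after \<open>Kinv\<close>. This lowering
        is killed by the raising, which is what \<open>positive_weight_zero\<close> asks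
        for.\<close>
      show ?thesis
      proof (rule positive_weight_zero[OF linZ[of I2 I1] Zc[of _ I2 I1], of b 1])
        show "cnt2 b w = cnt2 b u + 1" if "w \<in> colored f" "u \<in> Poly_Mapping.keys (Z I2 I1 (bvec w))" for w u
          using Zh[OF that, of b] True by (simp add: H_def)
        show "Eop b (Fop b (Z I2 I1 v) - Z I2 I1 (Fop b v)) =
            sc (q ^ (2 * 1)) (Fop b (Z I2 I1 (Eop b v)) - Z I2 I1 (Fop b (Eop b v)))" if "v \<in> cmod f" for v
          unfolding f21[OF that] f21[OF Eop_colored[OF that]]
          using W0[OF diag_colored[OF that, of "kinvwt b"]]
          by (simp add: W_def Kinv_Eop ZL power2_eq_square mult.assoc)
      qed (use v in auto)
    next
      case hb: False
      have "Z I2 I2 v = 0" if "v \<in> cmod f" for v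
        using that f22 hb by (intro IH) auto
      then have "Fop b (Z I2 I1 v) = Z I2 I1 (Fop b v)" if "v \<in> cmod f" for v
        using f21[OF that] diag_colored[OF that] by simp
      then show ?thesis
        using v by (intro IH) auto
    qed
    \<comment> \<open>Once \<open>Z I2 I1\<close> is zero, \<open>f21\<close> says that
      \<open>Z I2 I2\<close> vanishes after the invertible operator \<open>Kinv\<close>.\<close>
    have z22: "Z I2 I2 v = 0" if "v \<in> cmod f" for v
    proof -
      have "Z I2 I2 (Kinv b (Kop b v)) = 0"
        using f21[OF diag_colored[OF that, of "kwt b"]] z21 diag_colored[OF that] Fop_colored by simp
      then show ?thesis by simp
    qed
    have "X (bvec w) = 0" if wc: "w \<in> colored (b # f)" for w
    proof -
      obtain y w' where w: "w = (b, y) # w'" "w' \<in> colored f"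
        using wc by (auto simp: colored_Cons)
      have "strip (b, x) (X (bvec w)) = 0" for x
        using z11[of "bvec w'"] z12[of "bvec w'"] z21[of "bvec w'"] z22[of "bvec w'"] w
        by (cases x; cases y) (simp_all add: Z_def pre_bvec)
      then show ?thesis
        using strip_zero_imp[OF X(2)] wc by simp
    qed
    then show ?thesis
      using lin_eq_on[OF X(1), of "\<lambda>v. 0" "colored (b # f)" v] Cons.prems(6) by simp
  qed
qed

section \<open>Intertwiners are generated by the braid operators\<close>

text \<open>By \<open>SGs_pure\<close> the product of the crossings then sends the basis vector of
  \<open>w\<close> to that of \<open>u\<close>, without further terms.\<close>

definition reach :: "vbasis list \<Rightarrow> vbasis list \<Rightarrow> bool" where
  "reach w u \<longleftrightarrow> (\<exists>is. set is \<subseteq> {i. Suc i < length w} \<and> pure is w \<and> perm is w = u)"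

lemma reach_refl: "reach w w"
  unfolding reach_def by (intro exI[of _ "[]"]) simp

lemma reach_trans: "reach w u \<Longrightarrow> reach u v \<Longrightarrow> reach w v"
  unfolding reach_def
proof (elim exE conjE)
  fix xs ys
  assume "set xs \<subseteq> {i. Suc i < length w}" "pure xs w" "perm xs w = u"
    "set ys \<subseteq> {i. Suc i < length u}" "pure ys u" "perm ys u = v"
  then show "\<exists>is. set is \<subseteq> {i. Suc i < length w} \<and> pure is w \<and> perm is w = v"
    by (intro exI[of _ "ys @ xs"]) (auto simp: pure_append)
qed

lemma reach_Cons: "reach w u \<Longrightarrow> reach (x # w) (x # u)"
  unfolding reach_def
proof (elim exE conjE)
  fix xs assume "set xs \<subseteq> {i. Suc i < length w}" "pure xs w" "perm xs w = u"
  then show "\<exists>is. set is \<subseteq> {i. Suc i < length (x # w)} \<and> pure is (x # w) \<and> perm is (x # w) = x # u"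
    by (intro exI[of _ "map Suc xs"]) (auto simp: pure_map_Suc perm_map_Suc)
qed

lemma reach_step: "fst x \<noteq> fst y \<or> snd x = I2 \<and> snd y = I1 \<Longrightarrow> reach (x # y # w) (y # x # w)"
  unfolding reach_def by (intro exI[of _ "[0]"]) (auto simp: pure_cross_def)

text \<open>A letter of another colour is crossed in both directions. Past a letter
  \<open>(b, I2)\<close>, the exchange is made behind the leading letter, and the resulting
  \<open>(b, I1)\<close> then moves to the front.\<close>

lemma reach_exchange:
  assumes "(b, I1) \<notin> set \<alpha>"
  shows "reach ((b, I2) # \<alpha> @ (b, I1) # \<beta>) ((b, I1) # \<alpha> @ (b, I2) # \<beta>)"
  using assms
proof (induction \<alpha>)
  case Nil
  then show ?case by (simp add: reach_step)
next
  case (Cons a \<alpha>)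
  then have IH: "reach ((b, I2) # \<alpha> @ (b, I1) # \<beta>) ((b, I1) # \<alpha> @ (b, I2) # \<beta>)" by simp
  obtain c x where a: "a = (c, x)" by fastforce
  show ?case
  proof (cases "c = b")
    case True
    then have "a = (b, I2)"
      using Cons.prems a by (cases x) auto
    then show ?thesis
      using reach_trans[OF reach_Cons[OF IH, of a] reach_step[of a "(b, I1)"]] by simp
  next
    case False
    show ?thesis
      using reach_trans[OF reach_step[of "(b, I2)" a] reach_trans[OF reach_Cons[OF IH, of a] reach_step[of a "(b, I1)"]]]
        False a by simp
  qed
qed

text \<open>\<open>canonical\<close> without the exclusion of \<open>I2\<close> over
  \<open>I2\<close> at height zero. The construction of pure crossings changes labels of the input
  word and is carried out under this weaker condition.\<close>

fun dominated :: "vbasis list \<Rightarrow> vbasis list \<Rightarrow> (nat \<Rightarrow> int) \<Rightarrow> bool" where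
  "dominated [] [] h = (\<forall>b. h b = 0)"
| "dominated ((b, x) # u) ((c, y) # w) h = (b = c \<and> h b \<ge> 0 \<and>
     dominated u w (h(b := h b - of_bool (x = I2) + of_bool (y = I2))))"
| "dominated _ _ h = False"

lemma canonical_dominated: "canonical u w h \<Longrightarrow> dominated u w h"
  by (induction u w h rule: canonical.induct) auto

lemma canonical_colors: "canonical u w h \<Longrightarrow> map fst u = map fst w"
  by (induction u w h rule: canonical.induct) auto

lemma dominated_nonneg: "dominated u w h \<Longrightarrow> h b \<ge> 0"
  by (induction u w h rule: dominated.induct) (auto split: if_splits)

text \<open>A positive height has to come down to zero, so a letter \<open>(b, I1)\<close> occurs.
  Up to the first one all input letters of colour \<open>b\<close> are \<open>I2\<close> and the
  height stays positive; hence relabelling it lowers these heights by one without making any of them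
  negative.\<close>

lemma dominated_split:
  "dominated u w h \<Longrightarrow> h b > 0 \<Longrightarrow>
    \<exists>\<alpha> \<beta>. w = \<alpha> @ (b, I1) # \<beta> \<and> (b, I1) \<notin> set \<alpha> \<and> dominated u (\<alpha> @ (b, I2) # \<beta>) (h(b := h b - 1))"
proof (induction u w h rule: dominated.induct)
  case (2 c x u c' y w h)
  then have c: "c' = c" "h c \<ge> 0"
    and d: "dominated u w (h(c := h c - of_bool (x = I2) + of_bool (y = I2)))" by auto
  show ?case
  proof (cases "(c, y) = (b, I1)")
    case True
    have "(h(b := h b - 1))(b := (h(b := h b - 1)) b - of_bool (x = I2) + of_bool (I2 = I2)) =
        h(c := h c - of_bool (x = I2) + of_bool (y = I2))"
      using True c(1) by (auto simp: fun_eq_iff)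
    then have dd: "dominated ((c, x) # u) ((b, I2) # w) (h(b := h b - 1))"
      using d c 2(3) True by (simp only: dominated.simps) auto
    show ?thesis
    proof (rule exI[where x = "[]"], rule exI[where x = w], intro conjI)
      show "dominated ((c, x) # u) ([] @ (b, I2) # w) (h(b := h b - 1))"
        using dd by (simp only: append_Nil)
    qed (use True c in auto)
  next
    case False
    let ?h = "h(c := h c - of_bool (x = I2) + of_bool (y = I2))"
    have hb: "?h b > 0"
      using False 2(3) dominated_nonneg[OF d, of b] by (cases y; cases x) auto
    then obtain \<alpha> \<beta> where *: "w = \<alpha> @ (b, I1) # \<beta>" "(b, I1) \<notin> set \<alpha>"
      "dominated u (\<alpha> @ (b, I2) # \<beta>) (?h(b := ?h b - 1))"
      using 2(1)[OF d hb] by blast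
    have hh: "(h(b := h b - 1))(c := (h(b := h b - 1)) c - of_bool (x = I2) + of_bool (y = I2)) = ?h(b := ?h b - 1)"
      by auto
    have hc: "(h(b := h b - 1)) c \<ge> 0"
      using c(2) 2(3) by simp
    show ?thesis
    proof (rule exI[where x = "(c, y) # \<alpha>"], rule exI[where x = \<beta>], intro conjI)
      show "dominated ((c, x) # u) (((c, y) # \<alpha>) @ (b, I2) # \<beta>) (h(b := h b - 1))"
        unfolding append_Cons dominated.simps hh using *(3) hc by blast
    qed (use * False c(1) in auto)
  qed
qed auto

text \<open>Equal first labels are stripped. If the input starts with \<open>I2\<close> and the
  output with \<open>I1\<close>, the first later \<open>(b, I1)\<close> of the input is exchanged to
  the front. The opposite combination would make a height negative.\<close>

lemma dominated_reach: "dominated u w (\<lambda>_. 0) \<Longrightarrow> reach w u"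
proof (induction u arbitrary: w)
  case Nil
  then show ?case by (cases w) (auto simp: reach_refl)
next
  case (Cons e u)
  obtain b x where e: "e = (b, x)" by fastforce
  obtain y w' where w: "w = (b, y) # w'"
    using Cons.prems by (cases w; cases "hd w") (auto simp: e)
  let ?h = "(\<lambda>_. 0 :: int)(b := - of_bool (x = I2) + of_bool (y = I2))"
  have d: "dominated u w' ?h"
    using Cons.prems by (simp add: e w)
  consider "x = y" | "x = I1" "y = I2" | "x = I2" "y = I1" by (cases x; cases y) auto
  then show ?case
  proof cases
    case 1
    then have "?h = (\<lambda>_. 0)" by auto
    then show ?thesis
      using Cons.IH[of w'] d 1 by (simp add: e w reach_Cons)
  next
    case 2
    then obtain \<alpha> \<beta> where *: "w' = \<alpha> @ (b, I1) # \<beta>" "(b, I1) \<notin> set \<alpha>"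
      "dominated u (\<alpha> @ (b, I2) # \<beta>) (?h(b := ?h b - 1))"
      using dominated_split[OF d, of b] by auto
    have "?h(b := ?h b - 1) = (\<lambda>_. 0)"
      using 2 by auto
    then have "reach (\<alpha> @ (b, I2) # \<beta>) u"
      using Cons.IH * by simp
    then show ?thesis
      using reach_trans[OF reach_exchange[OF *(2)] reach_Cons] 2 by (simp add: e w *)
  next
    case 3
    then show ?thesis using dominated_nonneg[OF d, of b] by simp
  qed
qed

text \<open>The exclusion of \<open>I2\<close> over \<open>I2\<close> at height zero, transported
  from the first letters to an arbitrary place: \<open>h b\<close> minus the left-hand side is the
  height of the suffixes starting there.\<close>

lemma canonical_height:
  assumes "canonical u w h" "filter (\<lambda>e. fst e = b) w = A @ (b, I2) # B" "filter (\<lambda>e. fst e = b) u = A' @ (b, I2) # B'"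
    "length A = length A'"
  shows "int (cnt2 b A') - int (cnt2 b A) \<noteq> h b"
  using assms
proof (induction u w h arbitrary: A A' rule: canonical.induct)
  case (2 c x u c' y w h)
  let ?h = "h(c := h c - of_bool (x = I2) + of_bool (y = I2))"
  have c: "c' = c" using 2(2) unfolding canonical.simps by (elim conjE) simp
  have can: "canonical u w ?h" using 2(2) unfolding canonical.simps by (elim conjE)
  note IH = 2(1)[OF can]
  show ?case
  proof (cases "c = b")
    case False
    then show ?thesis using IH[of A A'] 2(3-5) c by simp
  next
    case True
    show ?thesis
    proof (cases A)
      case Nil
      then show ?thesis using 2(2-5) c True by auto
    next
      case (Cons a A1)
      then obtain a' A1' where A': "A' = a' # A1'" using 2(5) by (cases A') auto
      have "a = (b, y)" "a' = (b, x)" "filter (\<lambda>e. fst e = b) w = A1 @ (b, I2) # B"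
        "filter (\<lambda>e. fst e = b) u = A1' @ (b, I2) # B'" "length A1 = length A1'"
        using 2(3-5) c True Cons A' by auto
      then show ?thesis
        using IH[of A1 A1'] True Cons A' by (cases x; cases y) auto
    qed
  qed
qed auto

text \<open>By \<open>mixed_strand\<close>, such a strand has the same labels of its colour in front
  of it before and after the crossings. So \<open>I2\<close> stands over \<open>I2\<close> at height
  zero, which \<open>canonical_height\<close> forbids.\<close>

lemma canonical_unmixed:
  assumes "canonical u w (\<lambda>_. 0)" "map fst w' = map fst w" "set is \<subseteq> {i. Suc i < length w}"
    "pure is w" "pure is w'" "perm is w = u" "p < length w"
  shows "\<not> (snd (w ! p) = I2 \<and> snd (w' ! p) = I1)"
proof
  assume *: "snd (w ! p) = I2 \<and> snd (w' ! p) = I1"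
  have len: "length w' = length w" using arg_cong[OF assms(2), of length] by simp
  \<comment> \<open>Both labellings are superposed on the same coloured strands.\<close>
  define L where "L = map (\<lambda>(e, e'). (fst e, snd e, snd e')) (zip w w')"
  have w: "map (\<lambda>(b, x, x'). (b, x)) L = w"
    unfolding L_def using len by (intro nth_equalityI) auto
  have w': "map (\<lambda>(b, x, x'). (b, x')) L = w'"
    unfolding L_def using len assms(2) by (intro nth_equalityI) (auto simp: list_eq_iff_nth_eq prod_eq_iff)
  define b where "b = fst (w ! p)"
  have "L ! p = (b, I2, I1)"
    using * assms(7) len by (simp add: L_def b_def)
  then have "L = take p L @ (b, I2, I1) # drop (Suc p) L"
    using id_take_nth_drop[of p L] assms(7) len by (simp add: L_def)
  then obtain A B where AB: "filter (\<lambda>e. fst e = b) L = A @ (b, I2, I1) # B"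
    by (metis (mono_tags, lifting) filter.simps(2) filter_append fst_conv)
  obtain A' B' where A'B': "filter (\<lambda>e. fst e = b) (perm is L) = A' @ (b, I2, I1) # B'" "mset A' = mset A"
    using mixed_strand[of "is" L b A B] assms(3-5) w w' AB len by (auto simp: L_def)
  let ?g = "\<lambda>(b, x, x'). (b, x) :: vbasis"
  have g: "filter (\<lambda>e. fst e = b) (map ?g l) = map ?g (filter (\<lambda>e. fst e = b) l)" for l
    by (induction l) auto
  have "filter (\<lambda>e. fst e = b) w = map ?g A @ (b, I2) # map ?g B"
    using AB g[of L] w by simp
  moreover have "filter (\<lambda>e. fst e = b) u = map ?g A' @ (b, I2) # map ?g B'"
    using A'B' g[of "perm is L"] w assms(6) by (simp add: map_perm)
  moreover have "length (map ?g A) = length (map ?g A')"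
    using A'B'(2) by (metis length_map mset_eq_length)
  moreover have "mset (map ?g A') = mset (map ?g A)"
    using A'B'(2) by (simp only: mset_map)
  ultimately show False
    using canonical_height[OF assms(1), of b "map ?g A" "map ?g B" "map ?g A'" "map ?g B'"] by simp
qed

lemma canonical_unique:
  assumes "canonical u w (\<lambda>_. 0)" "canonical u' w' (\<lambda>_. 0)" "map fst w' = map fst w"
    "set is \<subseteq> {i. Suc i < length w}" "pure is w" "pure is w'" "perm is w = u" "perm is w' = u'"
  shows "w' = w"
proof -
  have len: "length w' = length w" using arg_cong[OF assms(3), of length] by simp
  show ?thesis
  proof (rule nth_equalityI[OF len])
    fix p assume p: "p < length w'"
    have "fst (w' ! p) = fst (w ! p)"
      using p len assms(3) by (metis nth_map)
    moreover have "snd (w' ! p) = snd (w ! p)"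
      using canonical_unmixed[OF assms(1,3,4,5,6,7), of p]
        canonical_unmixed[OF assms(2) assms(3)[symmetric] _ assms(6,5,8), of p] assms(4) p len
      by (cases "snd (w' ! p)"; cases "snd (w ! p)") auto
    ultimately show "w' ! p = w ! p" by (simp add: prod_eq_iff)
  qed
qed

text \<open>A list of coefficients and words in the crossings stands for a linear combination,
  compared with \<open>X\<close> on \<open>cmod f\<close> only.\<close>

definition SGspan :: "nat list \<Rightarrow> (vec \<Rightarrow> vec) \<Rightarrow> bool" where
  "SGspan f X \<longleftrightarrow> (\<exists>ts. (\<forall>t\<in>set ts. set (snd t) \<subseteq> {i. Suc i < length f}) \<and>
     (\<forall>v\<in>cmod f. X v = (\<Sum>t\<leftarrow>ts. sc (fst t) (SGs (snd t) v))))"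

lemma SGspan_zero: "(\<And>v. v \<in> cmod f \<Longrightarrow> X v = 0) \<Longrightarrow> SGspan f X"
  unfolding SGspan_def by (intro exI[of _ "[]"]) auto

lemma SGspan_add: "SGspan f X \<Longrightarrow> SGspan f Y \<Longrightarrow> (\<And>v. v \<in> cmod f \<Longrightarrow> Z v = X v + Y v) \<Longrightarrow> SGspan f Z"
  unfolding SGspan_def
proof (elim exE conjE)
  fix ts ts'
  assume "\<forall>t\<in>set ts. set (snd t) \<subseteq> {i. Suc i < length f}" "\<forall>v\<in>cmod f. X v = (\<Sum>t\<leftarrow>ts. sc (fst t) (SGs (snd t) v))"
    "\<forall>t\<in>set ts'. set (snd t) \<subseteq> {i. Suc i < length f}" "\<forall>v\<in>cmod f. Y v = (\<Sum>t\<leftarrow>ts'. sc (fst t) (SGs (snd t) v))"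
    "\<And>v. v \<in> cmod f \<Longrightarrow> Z v = X v + Y v"
  then show "\<exists>ts. (\<forall>t\<in>set ts. set (snd t) \<subseteq> {i. Suc i < length f}) \<and>
     (\<forall>v\<in>cmod f. Z v = (\<Sum>t\<leftarrow>ts. sc (fst t) (SGs (snd t) v)))"
    by (intro exI[of _ "ts @ ts'"]) auto
qed

lemma SGspan_SGs: "set is \<subseteq> {i. Suc i < length f} \<Longrightarrow> (\<And>v. v \<in> cmod f \<Longrightarrow> X v = sc c (SGs is v)) \<Longrightarrow> SGspan f X"
  unfolding SGspan_def by (intro exI[of _ "[(c, is)]"]) auto

lemma SGspan_sum:
  "finite A \<Longrightarrow> (\<And>a. a \<in> A \<Longrightarrow> SGspan f (X a)) \<Longrightarrow> (\<And>v. v \<in> cmod f \<Longrightarrow> Z v = (\<Sum>a\<in>A. X a v)) \<Longrightarrow> SGspan f Z"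
proof (induction A arbitrary: Z rule: finite_induct)
  case empty
  then show ?case by (intro SGspan_zero) simp
next
  case (insert a A)
  have 1: "SGspan f (\<lambda>v. \<Sum>a\<in>A. X a v)"
    by (rule insert.IH) (use insert in auto)
  have 2: "SGspan f (X a)" using insert.prems(1) by simp
  show ?case
    by (rule SGspan_add[OF 2 1]) (use insert in auto)
qed

lemma lin_SGs [simp]: "lin (SGs is)"
  by (induction "is") (auto simp: id_def o_def intro: lin_comp)

lemma SG_colored:
  assumes "Suc i < length f" "v \<in> cmod f"
  shows "SG i v \<in> cmod (swp i f)"
proof (rule lin_fmod[OF lin_SG _ assms(2)])
  fix w assume "w \<in> colored f"
  then show "SG i (bvec w) \<in> cmod (swp i f)"
    using SG_keys[of i w] assms(1) by (auto simp: fmod_def colored_def)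
qed

lemma SGs_colored: "set is \<subseteq> {i. Suc i < length f} \<Longrightarrow> v \<in> cmod f \<Longrightarrow> SGs is v \<in> cmod (perm is f)"
  by (induction "is") (auto intro: SG_colored)

lemma colored_words: "v \<in> cmod f \<Longrightarrow> v \<in> fmod (words (length f))"
  by (rule fmod_mono) (auto simp: colored_def words_def)

lemma SGs_Fop: "set is \<subseteq> {i. Suc i < length f} \<Longrightarrow> v \<in> cmod f \<Longrightarrow> SGs is (Fop b v) = Fop b (SGs is v)"
proof (induction "is")
  case (Cons i "is")
  have "SGs is v \<in> fmod (words (length f))"
    using SGs_colored[of "is" f v] Cons.prems colored_words by fastforce
  then show ?case
    using Cons SG_Fop[of i "length f" "SGs is v"] by simp
qed simp

lemma SGs_mset:
  assumes "u \<in> Poly_Mapping.keys (SGs is (bvec w))"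
  shows "mset u = mset w"
  using assms
proof (induction "is" arbitrary: u)
  case (Cons i "is")
  then obtain u' where "u' \<in> Poly_Mapping.keys (SGs is (bvec w))" "u \<in> Poly_Mapping.keys (SG i (bvec u'))"
    using keys_lin[OF lin_SG, of u i "SGs is (bvec w)"] by auto
  then show ?case
    using Cons.IH SG_mset[of i u'] by (auto simp: fmod_def)
qed simp

lemma finite_colored: "finite (colored f)"
proof (induction f)
  case (Cons b f)
  have "colored (b # f) \<subseteq> (\<lambda>(x, w). (b, x) # w) ` ({I1, I2} \<times> colored f)"
  proof
    fix w assume "w \<in> colored (b # f)"
    then obtain x w' where "w = (b, x) # w'" "w' \<in> colored f" by (auto simp: colored_Cons)
    then show "w \<in> (\<lambda>(x, w). (b, x) # w) ` ({I1, I2} \<times> colored f)"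
      by (cases x) auto
  qed
  then show ?case
    using Cons by (meson finite.emptyI finite_SigmaI finite_imageI finite_insert finite_subset)
qed simp

text \<open>Preservation of the multiset of letters encodes commutation with the group-like
  elements; see \<open>End_mset\<close>. The colour sequences of source and target may
  differ.\<close>

definition intertwiner :: "nat list \<Rightarrow> nat list \<Rightarrow> (vec \<Rightarrow> vec) \<Rightarrow> bool" where
  "intertwiner f g X \<longleftrightarrow> lin X \<and> (\<forall>v\<in>cmod f. X v \<in> cmod g) \<and> (\<forall>b. \<forall>v\<in>cmod f. Fop b (X v) = X (Fop b v)) \<and>
     (\<forall>w\<in>colored f. \<forall>u\<in>Poly_Mapping.keys (X (bvec w)). mset u = mset w)"

text \<open>To each canonical pair belongs a pure product of crossings realizing it. Ordered by the
  loss of inversions, the coefficients of these products at the canonical pairs form a unitriangular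
  matrix, so the coefficients of \<open>X\<close> are eliminated from the highest rank
  downwards.\<close>

lemma intertwiner_spanned:
  assumes X: "intertwiner f f X"
  shows "SGspan f X"
proof -
  define C where "C = {(u, w). w \<in> colored f \<and> canonical u w (\<lambda>_. 0)}"
  \<comment> \<open>On \<open>C\<close> the subtraction of natural numbers is exact, by
    \<open>rank\<close>, and gives the number of crossings of equal colours in
    \<open>J c\<close>.\<close>
  define rk where "rk c = inversions (snd c) - inversions (fst c)" for c :: "vbasis list \<times> vbasis list"
  have "\<exists>is. set is \<subseteq> {i. Suc i < length (snd c)} \<and> pure is (snd c) \<and> perm is (snd c) = fst c" if "c \<in> C" for c
    using dominated_reach[OF canonical_dominated, of "fst c" "snd c"] that by (auto simp: C_def reach_def)
  then obtain J where J: "\<And>c. c \<in> C \<Longrightarrow> set (J c) \<subseteq> {i. Suc i < length (snd c)} \<and> pure (J c) (snd c) \<and> perm (J c) (snd c) = fst c"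
    by metis
  have Cc: "snd c \<in> colored f" "fst c \<in> colored f" "length (snd c) = length f" if "c \<in> C" for c
    using that canonical_colors by (auto simp: C_def colored_def dest: canonical_colors)
  have Jf: "set (J c) \<subseteq> {i. Suc i < length f}" "perm (J c) f = f" if "c \<in> C" for c
  proof -
    show "set (J c) \<subseteq> {i. Suc i < length f}" using J[OF that] Cc[OF that] by simp
    have "perm (J c) (map fst (snd c)) = map fst (fst c)"
      using J[OF that] map_perm[of fst "J c" "snd c"] by simp
    then show "perm (J c) f = f" using Cc[OF that] by (simp add: colored_def)
  qed
  have "C \<subseteq> colored f \<times> colored f" using Cc by (force simp: C_def)
  then have finC: "finite C"
    using finite_colored finite_subset by blast
  have rank: "inversions (snd c) = inversions (fst c) + ncross (J c) f" if "c \<in> C" for c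
    using SGs_pure(2)[of "J c" "snd c"] J[OF that] Cc(1)[OF that] by (simp add: colored_def)
  have coef: "Poly_Mapping.lookup (SGs (J c) (bvec (snd c'))) (fst c') = (if c = c' then 1 else 0)"
    if "c \<in> C" "c' \<in> C" "rk c \<le> rk c'" for c c'
  proof (cases "c = c'")
    case True
    then show ?thesis
      using SGs_pure(1)[of "J c" "snd c"] J[OF that(1)] by simp
  next
    case False
    have "fst c' \<notin> Poly_Mapping.keys (SGs (J c) (bvec (snd c')))"
    proof
      assume k: "fst c' \<in> Poly_Mapping.keys (SGs (J c) (bvec (snd c')))"
      have c': "map fst (snd c') = f" "length (snd c') = length f" using Cc[OF that(2)] by (simp_all add: colored_def)
      \<comment> \<open>\<open>SGs_keys\<close> bounds the rank of \<open>c'\<close> by that of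
        \<open>c\<close>. With the assumed order the bound is attained, so \<open>J c\<close> is
        pure for both source words and \<open>canonical_unique\<close> applies.\<close>
      have "inversions (snd c') = inversions (fst c') + ncross (J c) f"
        using SGs_keys[of "J c" "snd c'" "fst c'"] k Jf[OF that(1)] c' rank[OF that(1)] rank[OF that(2)] that(3)
        by (simp add: rk_def)
      then have "pure (J c) (snd c') \<and> fst c' = perm (J c) (snd c')"
        using SGs_keys[of "J c" "snd c'" "fst c'"] k Jf[OF that(1)] c' by simp
      then have "snd c' = snd c"
        using that(1,2) J[OF that(1)] Cc(1)[OF that(1)] c'(1)
        by (intro canonical_unique[of "fst c" "snd c" "fst c'" "snd c'" "J c"]) (simp_all add: C_def colored_def split_beta)
      then show False
        using \<open>pure (J c) (snd c') \<and> _\<close> J[OF that(1)] False by (auto simp: prod_eq_iff)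
    qed
    then show ?thesis using False by (simp add: in_keys_iff)
  qed
  have main: "SGspan f X"
    if "intertwiner f f X" "\<forall>c\<in>C. rk c \<ge> k \<longrightarrow> Poly_Mapping.lookup (X (bvec (snd c))) (fst c) = 0" for k X
    using that
  proof (induction k arbitrary: X)
    case 0
    have X: "lin X" "\<And>v. v \<in> cmod f \<Longrightarrow> X v \<in> cmod f" "\<And>b v. v \<in> cmod f \<Longrightarrow> Fop b (X v) = X (Fop b v)"
      "\<And>w u. w \<in> colored f \<Longrightarrow> u \<in> Poly_Mapping.keys (X (bvec w)) \<Longrightarrow> mset u = mset w"
      using 0(1) by (auto simp: intertwiner_def)
    show ?case
    proof (rule SGspan_zero)
      show "X v = 0" if "v \<in> cmod f" for v
        by (rule canonical_coefficients_determine[OF X(1,2) _ X(3) _ that, of "\<lambda>_. 0"])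
           (use X(4) 0(2) in \<open>auto simp: C_def\<close>)
    qed
  next
    case (Suc k)
    let ?Ck = "{c \<in> C. rk c = k}"
    define a where "a c = Poly_Mapping.lookup (X (bvec (snd c))) (fst c)" for c
    \<comment> \<open>Subtracting \<open>Y\<close> clears the coefficients of rank \<open>k\<close>
      and leaves those of higher rank at zero.\<close>
    define Y where "Y v = (\<Sum>c\<in>?Ck. sc (a c) (SGs (J c) v))" for v
    have X: "lin X" "\<And>v. v \<in> cmod f \<Longrightarrow> X v \<in> cmod f" "\<And>b v. v \<in> cmod f \<Longrightarrow> Fop b (X v) = X (Fop b v)"
      "\<And>w u. w \<in> colored f \<Longrightarrow> u \<in> Poly_Mapping.keys (X (bvec w)) \<Longrightarrow> mset u = mset w"
      using Suc.prems(1) by (auto simp: intertwiner_def)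
    have linY: "lin Y"
      unfolding Y_def[abs_def] by (intro lin_sums lin_sc lin_SGs)
    have Yc: "Y v \<in> cmod f" if "v \<in> cmod f" for v
      unfolding Y_def using SGs_colored[OF Jf(1) that] Jf(2) by (intro fmod_sum fmod_sc) auto
    have YF: "Fop b (Y v) = Y (Fop b v)" if "v \<in> cmod f" for b v
      unfolding Y_def lin_sum[OF lin_Fop] lin_scale[OF lin_Fop] using SGs_Fop[OF Jf(1) that] by (intro sum.cong) auto
    have Ym: "mset u = mset w" if "u \<in> Poly_Mapping.keys (Y (bvec w))" for u w
    proof -
      have "Y (bvec w) \<in> fmod {u. mset u = mset w}"
        unfolding Y_def using SGs_mset by (intro fmod_sum fmod_sc) (auto simp: fmod_def)
      then show ?thesis using that by (auto simp: fmod_def)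
    qed
    have "intertwiner f f (\<lambda>v. X v - Y v)"
      unfolding intertwiner_def
    proof (intro conjI ballI allI)
      show "lin (\<lambda>v. X v - Y v)" by (rule lin_diff[OF X(1) linY])
      show "X v - Y v \<in> cmod f" if "v \<in> cmod f" for v by (intro fmod_diff X(2) Yc that)
      show "Fop b (X v - Y v) = X (Fop b v) - Y (Fop b v)" if "v \<in> cmod f" for b v
        using X(3)[OF that] YF[OF that] by (simp add: lin_minus[OF lin_Fop])
      show "mset u = mset w" if "w \<in> colored f" "u \<in> Poly_Mapping.keys (X (bvec w) - Y (bvec w))" for u w
      proof -
        have "u \<in> Poly_Mapping.keys (X (bvec w)) \<or> u \<in> Poly_Mapping.keys (Y (bvec w))"
          using that(2) by (auto simp: in_keys_iff lookup_minus)
        then show ?thesis using X(4)[OF that(1)] Ym by blast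
      qed
    qed
    moreover have "Poly_Mapping.lookup (X (bvec (snd c')) - Y (bvec (snd c'))) (fst c') = 0"
      if c': "c' \<in> C" "rk c' \<ge> k" for c'
    proof -
      have "Poly_Mapping.lookup (Y (bvec (snd c'))) (fst c') = (\<Sum>c\<in>?Ck. a c * (if c = c' then 1 else 0))"
        unfolding Y_def lookup_sum lookup_sc using coef[OF _ c'(1)] c'(2) by (intro sum.cong) auto
      also have "\<dots> = (if rk c' = k then a c' else 0)"
        using finC c'(1) by (simp add: if_distrib cong: if_cong)
      finally show ?thesis
        using Suc.prems(2) c' by (auto simp: lookup_minus a_def)
    qed
    ultimately have "SGspan f (\<lambda>v. X v - Y v)"
      by (intro Suc.IH) auto
    moreover have "SGspan f Y"
      by (rule SGspan_sum[of ?Ck f "\<lambda>c v. sc (a c) (SGs (J c) v)"])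
         (use finC Jf in \<open>auto simp: Y_def intro: SGspan_SGs\<close>)
    ultimately show ?case
      by (rule SGspan_add) simp
  qed
  define k where "k = Suc (\<Sum>c\<in>C. rk c)"
  have "rk c < k" if "c \<in> C" for c
    using member_le_sum[OF that, of rk] finC by (simp add: k_def)
  then show ?thesis
    using main[OF X, of k] by fastforce
qed

section \<open>Operators between different colour sequences\<close>

lemma reach_move_left:
  assumes "x \<notin> set S" "snd x = I1" "\<forall>y\<in>set S. snd y = I1"
  shows "reach (S @ x # R) (x # S @ R)"
  using assms
proof (induction S)
  case (Cons y S)
  then have "fst y \<noteq> fst x" by (auto simp: prod_eq_iff)
  then show ?case
    using reach_trans[OF reach_Cons[of "S @ x # R" "x # S @ R" y] reach_step[of y x]] Cons by simp
qed (simp add: reach_refl)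

lemma reach_mset:
  assumes "mset w = mset u" "\<forall>y\<in>set w. snd y = I1"
  shows "reach w u"
  using assms
proof (induction u arbitrary: w)
  case (Cons x u)
  then have "x \<in> set w"
    by (metis list.set_intros(1) mset_eq_setD)
  then obtain S R where w: "w = S @ x # R" "x \<notin> set S"
    by (metis split_list_first)
  then have "reach (S @ R) u"
    using Cons by simp
  then show ?case
    using reach_trans[OF reach_move_left[of x S R] reach_Cons] w Cons.prems(2) by simp
qed (simp add: reach_refl)

text \<open>If all labels are \<open>I1\<close>, a pure crossing never joins equal colours, so
  reachability provides a product of mere flips.\<close>

lemma color_word:
  fixes f g :: "nat list"
  assumes "mset f = mset g"
  obtains "is" where "set is \<subseteq> {i. Suc i < length f}" "perm is f = g" "ncross is f = 0"
proof -
  let ?l = "map (\<lambda>b. (b, I1))"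
  have "mset (?l f) = mset (?l g)" using assms by simp
  then have "reach (?l f) (?l g)" by (intro reach_mset) auto
  then obtain "is" where J: "set is \<subseteq> {i. Suc i < length f}" "pure is (?l f)" "perm is (?l f) = ?l g"
    by (auto simp: reach_def)
  have "map fst (perm is (?l f)) = perm is f"
    by (simp add: map_perm o_def)
  then have p: "perm is f = g" using J(3) by (simp add: o_def)
  have "ncross is f = 0" using J(1,2)
  proof (induction "is")
    case (Cons i "is")
    have "Suc i < length (perm is f)" using Cons.prems(1) by simp
    moreover have "pure_cross i (map (\<lambda>b. (b, I1)) (perm is f))"
      using Cons.prems(2) by (simp add: map_perm)
    ultimately show ?case
      using Cons by (auto simp: pure_cross_def same_col_def)
  qed simp
  then show ?thesis using that J(1) p by blast
qed

lemma ncross_pure: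
  assumes "ncross is f = 0" "set is \<subseteq> {i. Suc i < length f}" "w \<in> colored f"
  shows "pure is w"
  using assms(1,2)
proof (induction "is")
  case (Cons i "is")
  have w: "map fst (perm is w) = perm is f"
    using assms(3) by (simp add: map_perm colored_def)
  have "Suc i < length (perm is w)"
    using Cons.prems(2) assms(3) by (auto simp: colored_def)
  then have "fst (perm is w ! i) = perm is f ! i" "fst (perm is w ! Suc i) = perm is f ! Suc i"
    using w by (simp_all add: nth_map[symmetric] del: nth_map)
  then show ?case
    using Cons by (auto simp: pure_cross_def same_col_def split: if_splits)
qed simp

lemma perm_rev [simp]: "perm (rev is) (perm is f) = f" "perm is (perm (rev is) f) = f"
proof -
  show *: "perm (rev is) (perm is f) = f" for "is" and f :: "'a list"
    by (induction "is" arbitrary: f) auto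
  show "perm is (perm (rev is) f) = f"
    using *[of "rev is" f] by simp
qed

lemma ncross_rev:
  "ncross is f = 0 \<Longrightarrow> set is \<subseteq> {i. Suc i < length f} \<Longrightarrow> ncross (rev is) (perm is f) = 0"
proof (induction "is")
  case (Cons i "is")
  have "Suc i < length (perm is f)" using Cons.prems(2) by simp
  then have "same_col i (swp i (perm is f)) = same_col i (perm is f)"
    by (auto simp: same_col_def nth_swp)
  then show ?case
    using Cons by (simp add: ncross_append)
qed simp

lemma SGs_inverse:
  assumes "ncross is f = 0" "set is \<subseteq> {i. Suc i < length f}" "v \<in> cmod f"
  shows "SGs (rev is) (SGs is v) = v"
proof (rule lin_eq_on[OF lin_comp[OF lin_SGs lin_SGs] lin_id _ assms(3)])
  fix w assume w: "w \<in> colored f"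
  then have len: "length w = length f" by (auto simp: colored_def)
  have w': "perm is w \<in> colored (perm is f)"
    using w by (simp add: colored_def map_perm)
  have "SGs is (bvec w) = bvec (perm is w)"
    using SGs_pure(1)[of "is" w] ncross_pure[OF assms(1,2) w] assms(2) len by simp
  moreover have "SGs (rev is) (bvec (perm is w)) = bvec (perm (rev is) (perm is w))"
    using SGs_pure(1)[of "rev is" "perm is w"] ncross_pure[OF ncross_rev[OF assms(1,2)] _ w'] assms(2) len by simp
  ultimately show "SGs (rev is) (SGs is (bvec w)) = bvec w" by simp
qed

text \<open>If the colour sequences are rearrangements of each other, an invertible product of flips
  identifies target and source. Otherwise preservation of the letters forces \<open>X\<close> to
  vanish.\<close>

theorem intertwiner_SGspan:
  assumes X: "intertwiner f g X"
  shows "SGspan f X"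
proof (cases "mset f = mset g")
  case True
  then obtain "is" where J: "set is \<subseteq> {i. Suc i < length f}" "perm is f = g" "ncross is f = 0"
    by (rule color_word)
  have len: "length g = length f" using True by (metis mset_eq_length)
  have r: "set (rev is) \<subseteq> {i. Suc i < length g}" "perm (rev is) g = f" "ncross (rev is) g = 0"
    using J ncross_rev[OF J(3,1)] len by auto
  define Y where "Y v = SGs (rev is) (X v)" for v
  have "intertwiner f f Y"
    unfolding intertwiner_def
  proof (intro conjI ballI allI)
    show "lin Y"
      unfolding Y_def[abs_def] using X by (intro lin_comp[OF lin_SGs]) (simp add: intertwiner_def)
    show "Y v \<in> cmod f" if "v \<in> cmod f" for v
      using SGs_colored[OF r(1), of "X v"] X that unfolding r(2) by (simp add: Y_def intertwiner_def)
    show "Fop b (Y v) = Y (Fop b v)" if "v \<in> cmod f" for b v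
      using SGs_Fop[OF r(1), of "X v" b] X that by (simp add: Y_def intertwiner_def)
    show "mset u = mset w" if wu: "w \<in> colored f" "u \<in> Poly_Mapping.keys (Y (bvec w))" for u w
    proof -
      obtain u' where "u' \<in> Poly_Mapping.keys (X (bvec w))" "u \<in> Poly_Mapping.keys (SGs (rev is) (bvec u'))"
        using keys_lin[OF lin_SGs, of u "rev is" "X (bvec w)"] wu(2) unfolding Y_def by blast
      then show ?thesis
        using SGs_mset[of u "rev is" u'] X wu(1) by (auto simp: intertwiner_def)
    qed
  qed
  then have "SGspan f Y" by (rule intertwiner_spanned)
  then obtain ts where ts: "\<forall>t\<in>set ts. set (snd t) \<subseteq> {i. Suc i < length f}"
    "\<And>v. v \<in> cmod f \<Longrightarrow> Y v = (\<Sum>t\<leftarrow>ts. sc (fst t) (SGs (snd t) v))"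
    unfolding SGspan_def by blast
  have "X v = (\<Sum>t\<leftarrow>map (\<lambda>t. (fst t, is @ snd t)) ts. sc (fst t) (SGs (snd t) v))" if "v \<in> cmod f" for v
  proof -
    have "X v \<in> cmod g" using X that by (simp add: intertwiner_def)
    then have "X v = SGs is (Y v)"
      using SGs_inverse[OF r(3,1), of "X v"] by (simp add: Y_def)
    also have "\<dots> = (\<Sum>t\<leftarrow>ts. SGs is (sc (fst t) (SGs (snd t) v)))"
      unfolding ts(2)[OF that] by (induction ts) (simp_all add: lin_simps[OF lin_SGs])
    finally show ?thesis
      by (simp add: o_def lin_scale[OF lin_SGs])
  qed
  then show ?thesis
    unfolding SGspan_def using ts(1) J(1) by (intro exI[of _ "map (\<lambda>t. (fst t, is @ snd t)) ts"]) auto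
next
  case False
  have X0: "X (bvec w) = 0" if w: "w \<in> colored f" for w
  proof -
    have "u \<notin> Poly_Mapping.keys (X (bvec w))" for u
    proof
      assume u: "u \<in> Poly_Mapping.keys (X (bvec w))"
      moreover have "X (bvec w) \<in> cmod g"
        using X w by (simp add: intertwiner_def)
      ultimately have "u \<in> colored g"
        by (auto simp: fmod_def)
      moreover have "mset u = mset w"
        using X w u by (auto simp: intertwiner_def)
      ultimately have "mset g = mset f"
        using w unfolding colored_def by (metis (mono_tags, lifting) mem_Collect_eq mset_map)
      then show False using False by simp
    qed
    then show ?thesis by (metis keys_eq_empty equals0I)
  qed
  show ?thesis
  proof (rule SGspan_zero)
    show "X v = 0" if "v \<in> cmod f" for v
      using lin_eq_on[OF _ lin_const0, of X "colored f" v] X0 that X by (simp add: intertwiner_def)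
  qed
qed

section \<open>The algebra of braids and ties\<close>

text \<open>Generators are numbered from 0 here, so that \<open>S i\<close> crosses the list positions \<open>i\<close> and \<open>Suc i\<close>.\<close>

locale bttl_algebra = vector_space scl
  for scl :: "kq \<Rightarrow> 'a::ring_1 \<Rightarrow> 'a" +
  fixes n :: nat and S S' E :: "nat \<Rightarrow> 'a"
  assumes scl_left: "scl c x * y = scl c (x * y)"
    and scl_right: "x * scl c y = scl c (x * y)"
    and SS': "Suc i < n \<Longrightarrow> S i * S' i = 1" and S'S: "Suc i < n \<Longrightarrow> S' i * S i = 1"
    and EE: "Suc i < n \<Longrightarrow> E i * E i = E i"
    and SE: "Suc i < n \<Longrightarrow> S i * E i = E i * S i"
    and E_comm: "Suc i < n \<Longrightarrow> Suc j < n \<Longrightarrow> E i * E j = E j * E i"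
    and S_far: "Suc i < j \<Longrightarrow> Suc j < n \<Longrightarrow> S i * S j = S j * S i"
    and SE_far: "Suc i < j \<Longrightarrow> Suc j < n \<Longrightarrow> S i * E j = E j * S i"
    and ES_far: "Suc i < j \<Longrightarrow> Suc j < n \<Longrightarrow> E i * S j = S j * E i"
    and S_braid: "Suc (Suc i) < n \<Longrightarrow> S i * S (Suc i) * S i = S (Suc i) * S i * S (Suc i)"
    and ESS: "Suc (Suc i) < n \<Longrightarrow> E i * S (Suc i) * S i = S (Suc i) * S i * E (Suc i)"
      "Suc (Suc i) < n \<Longrightarrow> E (Suc i) * S i * S (Suc i) = S i * S (Suc i) * E i"
    and ESS': "Suc (Suc i) < n \<Longrightarrow> E i * S (Suc i) * S' i = S (Suc i) * S' i * E (Suc i)"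
    and EES: "Suc (Suc i) < n \<Longrightarrow> E i * E (Suc i) * S i = E (Suc i) * S i * E (Suc i)"
      "Suc (Suc i) < n \<Longrightarrow> E (Suc i) * E i * S (Suc i) = E i * S (Suc i) * E i"
    and S_quad: "Suc i < n \<Longrightarrow> S i * S i = scl (q - inverse q) (S i * E i) + 1"
    and TL: "2 < n \<Longrightarrow> E 0 * E 1 * (1 - scl (inverse q) (S 0) - scl (inverse q) (S 1)
           + scl (inverse q ^ 2) (S 0 * S 1) + scl (inverse q ^ 2) (S 1 * S 0)
           - scl (inverse q ^ 3) (S 0 * S 1 * S 0)) = 0"
begin

definition conj :: "nat \<Rightarrow> 'a \<Rightarrow> 'a" where
  "conj k x = S k * x * S' k"

lemma S_cancel: "Suc i < n \<Longrightarrow> S i * (S' i * x) = x" "Suc i < n \<Longrightarrow> S' i * (S i * x) = x"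
  using SS' S'S by (simp_all add: mult.assoc[symmetric])

lemma conj_mult: "Suc k < n \<Longrightarrow> conj k (x * y) = conj k x * conj k y"
  by (simp add: conj_def mult.assoc S_cancel)

lemma conj_fixed: "Suc k < n \<Longrightarrow> S k * x = x * S k \<Longrightarrow> conj k x = x"
  by (simp add: conj_def mult.assoc SS')

lemma inverse_unique: "a * x = 1 \<Longrightarrow> x * b = 1 \<Longrightarrow> a = b" for a b x :: 'a
  by (metis mult.assoc mult_1_left mult_1_right)

lemma S'_far: "Suc i < j \<Longrightarrow> Suc j < n \<Longrightarrow> S' i * S' j = S' j * S' i"
proof (rule inverse_unique[where x = "S j * S i"])
  assume *: "Suc i < j" "Suc j < n"
  then have i: "Suc i < n" by simp
  show "S' i * S' j * (S j * S i) = 1"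
    using * i by (simp add: mult.assoc S_cancel S'S)
  show "S j * S i * (S' j * S' i) = 1"
    unfolding S_far[OF *, symmetric] using * i by (simp add: mult.assoc S_cancel SS')
qed

lemma conj_far: "Suc i < j \<Longrightarrow> Suc j < n \<Longrightarrow> conj i (conj j x) = conj j (conj i x)"
proof -
  assume *: "Suc i < j" "Suc j < n"
  have "conj i (conj j x) = (S i * S j) * x * (S' j * S' i)"
    by (simp add: conj_def mult.assoc)
  also have "\<dots> = conj j (conj i x)"
    unfolding S_far[OF *] S'_far[OF *, symmetric] by (simp add: conj_def mult.assoc)
  finally show ?thesis .
qed

lemma S'_braid: "Suc (Suc i) < n \<Longrightarrow> S' i * S' (Suc i) * S' i = S' (Suc i) * S' i * S' (Suc i)"
proof -
  assume i: "Suc (Suc i) < n"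
  then have i': "Suc i < n" by simp
  let ?a = "S' i * S' (Suc i) * S' i" and ?b = "S' (Suc i) * S' i * S' (Suc i)"
  have "?a * (S i * S (Suc i) * S i) = 1"
    using i i' by (simp add: mult.assoc S_cancel SS' S'S)
  moreover have "(S (Suc i) * S i * S (Suc i)) * ?b = 1"
    using i i' by (simp add: mult.assoc S_cancel SS' S'S)
  ultimately show ?thesis
    unfolding S_braid[OF i] by (rule inverse_unique)
qed

lemma conj_braid: "Suc (Suc i) < n \<Longrightarrow> conj i (conj (Suc i) (conj i x)) = conj (Suc i) (conj i (conj (Suc i) x))"
proof -
  assume i: "Suc (Suc i) < n"
  have "conj i (conj (Suc i) (conj i x)) = (S i * S (Suc i) * S i) * x * (S' i * S' (Suc i) * S' i)"
    by (simp add: conj_def mult.assoc)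
  also have "\<dots> = conj (Suc i) (conj i (conj (Suc i) x))"
    unfolding S_braid[OF i] S'_braid[OF i] by (simp add: conj_def mult.assoc)
  finally show ?thesis .
qed

text \<open>The tie between strands \<open>i\<close> and \<open>i + 2\<close> arises from
  \<open>E i\<close> by conjugation with \<open>S (Suc i)\<close> or its inverse, and from
  \<open>E (Suc i)\<close> by conjugation with \<open>S i\<close> or its inverse. \<open>ESS\<close>
  and \<open>ESS'\<close> identify all four.\<close>

lemma conj_E_near:
  assumes "Suc (Suc i) < n"
  shows "conj (Suc i) (E i) = conj i (E (Suc i))" "conj (Suc i) (conj (Suc i) (E i)) = E i"
    "conj i (conj (Suc i) (E i)) = E (Suc i)"
proof -
  have i: "Suc i < n" using assms by simp
  have 1: "conj i (E (Suc i)) = S' (Suc i) * E i * S (Suc i)"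
  proof -
    have "S' (Suc i) * E i * S (Suc i) = S' (Suc i) * (E i * S (Suc i) * S i) * S' i"
      using i by (simp add: mult.assoc SS')
    also have "\<dots> = conj i (E (Suc i))"
      unfolding ESS(1)[OF assms] using assms i by (simp add: conj_def mult.assoc S_cancel)
    finally show ?thesis ..
  qed
  have 2: "S' (Suc i) * E i * S (Suc i) = S' i * E (Suc i) * S i"
  proof -
    have "S' (Suc i) * E i * S (Suc i) = S' (Suc i) * (E i * S (Suc i) * S' i) * S i"
      using i by (simp add: mult.assoc S'S)
    also have "\<dots> = S' i * E (Suc i) * S i"
      unfolding ESS'[OF assms] using assms i by (simp add: mult.assoc S_cancel)
    finally show ?thesis .
  qed
  have 3: "S' i * E (Suc i) * S i = conj (Suc i) (E i)"
  proof -
    have "S' i * E (Suc i) * S i = S' i * (E (Suc i) * S i * S (Suc i)) * S' (Suc i)"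
      using assms by (simp add: mult.assoc SS')
    also have "\<dots> = conj (Suc i) (E i)"
      unfolding ESS(2)[OF assms] using assms i by (simp add: conj_def mult.assoc S_cancel)
    finally show ?thesis .
  qed
  show "conj (Suc i) (E i) = conj i (E (Suc i))" using 1 2 3 by simp
  show "conj (Suc i) (conj (Suc i) (E i)) = E i"
    using assms by (simp only: 3[symmetric] 2[symmetric]) (simp add: conj_def mult.assoc S_cancel SS')
  show "conj i (conj (Suc i) (E i)) = E (Suc i)"
    using i by (simp only: 3[symmetric]) (simp add: conj_def mult.assoc S_cancel SS')
qed

text \<open>\<open>X i j\<close> is the tie between the strands \<open>i < j\<close>; its value for \<open>j \<le> i\<close> is immaterial.\<close>

primrec X :: "nat \<Rightarrow> nat \<Rightarrow> 'a" where
  "X i 0 = 1"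
| "X i (Suc j) = (if j \<le> i then E i else conj j (X i j))"

definition Xs :: "nat \<Rightarrow> nat \<Rightarrow> 'a" where
  "Xs i j = X (min i j) (max i j)"

definition tr :: "nat \<Rightarrow> nat \<Rightarrow> nat" where
  "tr k a = (if a = k then Suc k else if a = Suc k then k else a)"

lemma tr_tr [simp]: "tr k (tr k a) = a"
  by (simp add: tr_def)

lemma tr_eq_iff [simp]: "tr k a = tr k b \<longleftrightarrow> a = b"
  by (auto simp: tr_def)

lemma tr_less: "Suc k < n \<Longrightarrow> a < n \<Longrightarrow> tr k a < n"
  by (auto simp: tr_def)

lemma Xs_less [simp]: "i < j \<Longrightarrow> Xs i j = X i j" "j < i \<Longrightarrow> Xs i j = X j i"
  by (simp_all add: Xs_def)

text \<open>On ties, conjugation by crossings factors through the symmetric group. The cases compare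
  \<open>k\<close> with the two ends of the tie: it lies beyond them, between them, or at one of
  them.\<close>

lemma conj_X: "i < j \<Longrightarrow> j < n \<Longrightarrow> Suc k < n \<Longrightarrow> conj k (X i j) = Xs (tr k i) (tr k j)"
proof (induction j arbitrary: k rule: less_induct)
  case (less j)
  then obtain m where j: "j = Suc m" by (cases j) auto
  show ?case
  proof (cases "m = i")
    case True
    have Xij: "X i j = E i" by (simp add: j True)
    consider "Suc k < i" | "Suc k = i" | "k = i" | "k = Suc i" | "k > Suc i" by linarith
    then show ?thesis
    proof cases
      case 1
      then show ?thesis
        using less.prems SE_far[of k i] by (simp add: Xij j True tr_def conj_fixed)
    next
      case 2
      then show ?thesis
        using less.prems conj_E_near(1)[of k] by (auto simp: Xij j True tr_def)
    next
      case 3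
      then show ?thesis
        using less.prems SE[of i] by (simp add: Xij j True tr_def conj_fixed)
    next
      case 4
      then show ?thesis
        using less.prems by (simp add: Xij j True tr_def)
    next
      case 5
      then show ?thesis
        using less.prems ES_far[of i k] by (simp add: Xij j True tr_def conj_fixed)
    qed
  next
    case False
    then have m: "i < m" "m < n" "Suc m < n" using less.prems j by auto
    have Xij: "X i j = conj m (X i m)" using m by (simp add: j)
    have IH: "conj k (X i m) = Xs (tr k i) (tr k m)" if "Suc k < n" for k
      using less.IH[of m k] m that j by simp
    consider "k > j" | "k = j" | "k = m" | "Suc k = m" "k > i" | "Suc k < m" "k > i"
      | "k = i" "Suc i < m" | "k = i" "Suc i = m" | "Suc k \<le> i"
      using less.prems j by linarith
    then show ?thesis
    proof cases
      case 1
      then show ?thesis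
        using conj_far[of m k "X i m"] IH[of k] less.prems j m by (simp add: Xij tr_def)
    next
      case 2
      then show ?thesis
        using less.prems j m by (simp add: tr_def)
    next
      case 3
      \<comment> \<open>The involution property at the upper end, inherited through the braid
        relation from the previous strand.\<close>
      have "conj m (conj m (X i m)) = X i m"
      proof (cases "m = Suc i")
        case True
        then show ?thesis using conj_E_near(2)[of i] m by simp
      next
        case False
        then obtain l where l: "m = Suc l" "i < l" using m by (cases m) auto
        let ?Y = "X i l"
        have Y: "X i m = conj l ?Y" using l by simp
        have mY: "conj m ?Y = ?Y"
          using less.IH[of l m] l j m by (simp add: tr_def)
        have llY: "conj l (conj l ?Y) = ?Y"
          using IH[of l] l m unfolding Y by (simp add: tr_def)
        have "conj m (conj m (conj l ?Y)) = conj m (conj m (conj l (conj m ?Y)))"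
          by (simp add: mY)
        also have "\<dots> = conj m (conj l (conj m (conj l ?Y)))"
          using conj_braid[of l ?Y] l m by simp
        also have "\<dots> = conj l (conj m (conj l (conj l ?Y)))"
          using conj_braid[of l "conj l ?Y"] l m by simp
        finally show ?thesis by (simp add: Y llY mY)
      qed
      then show ?thesis
        using 3 j m by (simp add: Xij tr_def)
    next
      case 4
      let ?Y = "X i k"
      have Y: "X i m = conj k ?Y" using 4 by auto
      have mY: "conj m ?Y = ?Y"
        using less.IH[of k m] 4 j m by (simp add: tr_def)
      have "conj k (conj m (conj k ?Y)) = conj m (conj k (conj m ?Y))"
        using conj_braid[of k ?Y] 4 m by auto
      then show ?thesis
        using 4 j m by (simp add: Xij Y mY tr_def)
    next
      case 5
      then show ?thesis
        using conj_far[of k m "X i m"] IH[of k] j m by (simp add: Xij tr_def)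
    next
      case 6
      then show ?thesis
        using conj_far[of k m "X i m"] IH[of k] j m by (simp add: Xij tr_def)
    next
      case 7
      then show ?thesis
        using conj_E_near(3)[of i] j m by (auto simp: Xij tr_def)
    next
      case 8
      then show ?thesis
        using conj_far[of k m "X i m"] IH[of k] j m by (auto simp: Xij tr_def)
    qed
  qed
qed

lemma conj_Xs: "i \<noteq> j \<Longrightarrow> i < n \<Longrightarrow> j < n \<Longrightarrow> Suc k < n \<Longrightarrow> conj k (Xs i j) = Xs (tr k i) (tr k j)"
  using conj_X[of i j k] conj_X[of j i k] by (cases "i < j") (auto simp: Xs_def min.commute max.commute)

lemma S_Xs: "i \<noteq> j \<Longrightarrow> i < n \<Longrightarrow> j < n \<Longrightarrow> Suc k < n \<Longrightarrow> Xs i j * S k = S k * Xs (tr k i) (tr k j)"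
  using conj_Xs[of "tr k i" "tr k j" k] by (simp add: conj_def tr_less) (metis S'S mult.assoc mult_1_right)

lemma conj_commute:
  assumes "Suc k < n" "x * y = y * x"
  shows "conj k x * conj k y = conj k y * conj k x"
  using assms by (simp add: conj_mult[symmetric])

text \<open>The tie is shortened at one end by a conjugation that fixes \<open>E i\<close>. This
  fails only for ties from strand \<open>i\<close> or \<open>i - 1\<close> to strand
  \<open>i + 2\<close>, which are conjugated into commuting elements directly.\<close>

lemma E_X_commute: "Suc i < n \<Longrightarrow> k < l \<Longrightarrow> l < n \<Longrightarrow> E i * X k l = X k l * E i"
proof (induction "l - k" arbitrary: k l rule: less_induct)
  case less
  have cE: "conj m (E i) = E i" if "Suc m < n" "m = i \<or> Suc m < i \<or> m > Suc i" for m
    using that less.prems(1) SE SE_far ES_far by (intro conj_fixed) auto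
  have left: "E i * X k l = X k l * E i" if "Suc k < l" "k = i \<or> Suc k < i \<or> k > Suc i"
  proof -
    have "X k l = conj k (X (Suc k) l)"
      using conj_X[of "Suc k" l k] that less.prems by (simp add: tr_def)
    then show ?thesis
      using conj_commute[of k "E i" "X (Suc k) l"] less.hyps[of l "Suc k"] less.prems that cE[of k] by simp
  qed
  obtain m where l: "l = Suc m" using less.prems by (cases l) auto
  consider "m = k" | "k < m" "m = i \<or> Suc m < i \<or> m > Suc i" | "k < m" "Suc m = i" | "k < m" "m = Suc i"
    using less.prems l by linarith
  then show ?case
  proof cases
    case 1
    then show ?thesis using E_comm[of i k] less.prems by (simp add: l)
  next
    case 2
    then show ?thesis
      using conj_commute[of m "E i" "X k m"] less.hyps[of m k] less.prems cE[of m] by (simp add: l)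
  next
    case 3
    then show ?thesis using left l by auto
  next
    case 4
    consider "k = i" | "Suc k = i" | "Suc k < i" using 4 by linarith
    then show ?thesis
    proof cases
      case 1
      have "X i l = conj i (E (Suc i))"
        using conj_E_near(1)[of i] less.prems 4 l by simp
      then show ?thesis
        using conj_commute[of i "E i" "E (Suc i)"] E_comm[of i "Suc i"] cE[of i] less.prems 1 4 l by simp
    next
      case 2
      let ?a = "conj i (E k)" and ?b = "conj i (E (Suc i))"
      have n: "Suc (Suc i) < n" using less.prems l 4 by simp
      have "?a * ?b = ?b * ?a"
        using n 2 E_comm[of k "Suc i"] by (intro conj_commute) auto
      moreover have "conj (Suc i) ?b = E i"
        using conj_E_near(1,2)[of i] n by simp
      moreover have "conj (Suc i) ?a = X k l"
        using 2 4 l by auto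
      ultimately show ?thesis
        using conj_commute[of "Suc i" ?a ?b] n by simp
    next
      case 3
      then show ?thesis using left l 4 by simp
    qed
  qed
qed

lemma Xs_commute:
  "i \<noteq> j \<Longrightarrow> k \<noteq> l \<Longrightarrow> i < n \<Longrightarrow> j < n \<Longrightarrow> k < n \<Longrightarrow> l < n \<Longrightarrow> Xs i j * Xs k l = Xs k l * Xs i j"
proof -
  have *: "X i j * Xs k l = Xs k l * X i j" if "i < j" "j < n" "k \<noteq> l" "k < n" "l < n" for i j k l
    using that
  proof (induction j arbitrary: k l)
    case (Suc m)
    show ?case
    proof (cases "m = i")
      case True
      then show ?thesis
        using Suc.prems E_X_commute[of i k l] E_X_commute[of i l k] by (cases "k < l") auto
    next
      case False
      have "conj m (X i m) * conj m (Xs (tr m k) (tr m l)) = conj m (Xs (tr m k) (tr m l)) * conj m (X i m)"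
        using Suc False by (intro conj_commute Suc.IH) (auto simp: tr_less)
      then show ?thesis
        using Suc.prems False conj_Xs[of "tr m k" "tr m l" m] by (simp add: tr_less)
    qed
  qed simp
  assume "i \<noteq> j" "k \<noteq> l" "i < n" "j < n" "k < n" "l < n"
  then show ?thesis
    using *[of i j k l] *[of j i k l] by (cases "i < j") auto
qed

lemma X_idem: "i < j \<Longrightarrow> j < n \<Longrightarrow> X i j * X i j = X i j"
proof (induction j)
  case (Suc m)
  then show ?case
    using EE[of i] conj_mult[of m "X i m" "X i m"] by (cases "m = i") auto
qed simp

text \<open>Conjugation by crossings reduces three strands to adjacent ones, where the relations
  \<open>EES\<close> say that any two of the three ties have the same product.\<close>

lemma X_trans:
  "i < j \<Longrightarrow> j < k \<Longrightarrow> k < n \<Longrightarrow> X i j * X j k = X i j * X i k \<and> X i j * X j k = X i k * X j k"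
proof (induction "j + k" arbitrary: j k rule: less_induct)
  case less
  consider "Suc j < k" | "k = Suc j" "Suc i < j" | "k = Suc j" "j = Suc i" using less.prems by linarith
  then show ?case
  proof cases
    case 1
    then obtain m where k: "k = Suc m" by (cases k) auto
    have c: "conj m (X i j) = X i j" "conj m (X j m) = X j k" "conj m (X i m) = X i k"
      using 1 less.prems conj_X[of i j m] by (auto simp: k tr_def)
    have "X i j * X j m = X i j * X i m \<and> X i j * X j m = X i m * X j m"
      using less.hyps[of j m] less.prems 1 k by auto
    then have "conj m (X i j * X j m) = conj m (X i j * X i m) \<and> conj m (X i j * X j m) = conj m (X i m * X j m)"
      by metis
    moreover have m: "Suc m < n" using less.prems k by simp
    ultimately show ?thesis
      unfolding conj_mult[OF m] c by blast
  next
    case 2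
    then obtain m where j: "j = Suc m" "i < m" by (cases j) auto
    have c: "conj m (X i m) = X i j" "conj m (X m k) = X j k" "conj m (X i k) = X i k"
    proof -
      show "conj m (X i m) = X i j" using j by simp
      have "conj m (X m k) = Xs (tr m m) (tr m k)" "conj m (X i k) = Xs (tr m i) (tr m k)"
        using j 2 less.prems by (auto intro!: conj_X simp del: X.simps)
      moreover have "tr m k = k" "tr m i = i" "tr m m = j" using j 2 by (auto simp: tr_def)
      ultimately show "conj m (X m k) = X j k" "conj m (X i k) = X i k"
        using j 2 by (simp_all del: X.simps)
    qed
    have "X i m * X m k = X i m * X i k \<and> X i m * X m k = X i k * X m k"
      using less.hyps[of m k] less.prems j by auto
    then have "conj m (X i m * X m k) = conj m (X i m * X i k) \<and> conj m (X i m * X m k) = conj m (X i k * X m k)"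
      by metis
    moreover have m: "Suc m < n" using less.prems j by simp
    ultimately show ?thesis
      unfolding conj_mult[OF m] c by blast
  next
    case 3
    then have n: "Suc (Suc i) < n" using less.prems by simp
    have X: "X i j = E i" "X j k = E (Suc i)" "X i k = conj (Suc i) (E i)" using 3 by auto
    have "E i * conj (Suc i) (E i) = E (Suc i) * E i"
    proof -
      have "E i * conj (Suc i) (E i) = (E i * S (Suc i) * E i) * S' (Suc i)"
        by (simp add: conj_def mult.assoc)
      then show ?thesis
        unfolding EES(2)[OF n, symmetric] using n by (simp add: mult.assoc SS')
    qed
    moreover have "E (Suc i) * conj i (E (Suc i)) = E i * E (Suc i)"
    proof -
      have "E (Suc i) * conj i (E (Suc i)) = (E (Suc i) * S i * E (Suc i)) * S' i"
        by (simp add: conj_def mult.assoc)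
      then show ?thesis
        unfolding EES(1)[OF n, symmetric] using n by (simp add: mult.assoc SS')
    qed
    moreover have "conj i (E (Suc i)) * E (Suc i) = E (Suc i) * conj i (E (Suc i))"
      using Xs_commute[of i k j k] 3 n conj_E_near(1)[OF n] by simp
    ultimately show ?thesis
      using E_comm[of i "Suc i"] n conj_E_near(1)[OF n] unfolding X by simp
  qed
qed

text \<open>The elements fixed under left multiplication by the idempotent of the partition into
  equal entries of \<open>f\<close>. Only coincidences among the entries matter.\<close>

definition has_type :: "'c list \<Rightarrow> 'a \<Rightarrow> bool" where
  "has_type f x \<longleftrightarrow> length f = n \<and> (\<forall>i j. i < j \<longrightarrow> j < n \<longrightarrow> X i j * x = (if f ! i = f ! j then x else 0))"

lemma has_type_Xs:
  "has_type f x \<Longrightarrow> i \<noteq> j \<Longrightarrow> i < n \<Longrightarrow> j < n \<Longrightarrow> Xs i j * x = (if f ! i = f ! j then x else 0)"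
  by (cases "i < j") (auto simp: has_type_def)

lemma has_type_E: "has_type f x \<Longrightarrow> Suc i < n \<Longrightarrow> E i * x = (if f ! i = f ! Suc i then x else 0)"
proof -
  assume "has_type f x" "Suc i < n"
  then show ?thesis using has_type_Xs[of f x i "Suc i"] by simp
qed

lemma has_type_S:
  assumes "has_type f x" "Suc k < n"
  shows "has_type (swp k f) (S k * x)"
  unfolding has_type_def
proof (intro conjI allI impI)
  show "length (swp k f) = n" using assms by (simp add: has_type_def)
  fix i j assume ij: "i < j" "j < n"
  have "X i j * (S k * x) = S k * (Xs (tr k i) (tr k j) * x)"
    using S_Xs[of i j k] ij assms(2) by (simp add: mult.assoc[symmetric])
  moreover have "swp k f ! a = f ! tr k a" if "a < n" for a
    using that assms by (simp add: nth_swp tr_def has_type_def)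
  ultimately show "X i j * (S k * x) = (if swp k f ! i = swp k f ! j then S k * x else 0)"
    using has_type_Xs[OF assms(1), of "tr k i" "tr k j"] ij assms(2) by (simp add: tr_less)
qed

definition W :: "nat list \<Rightarrow> 'a" where
  "W is = prod_list (map S is)"

lemma W_simps [simp]: "W [] = 1" "W (i # is) = S i * W is" "W (xs @ ys) = W xs * W ys"
  by (simp_all add: W_def)

lemma has_type_W: "has_type f x \<Longrightarrow> set is \<subseteq> {i. Suc i < n} \<Longrightarrow> has_type (perm is f) (W is * x)"
  by (induction "is") (auto simp: mult.assoc intro: has_type_S)

end

text \<open>Permutations are encoded by their codes: the first entry \<open>k\<close> says that the first strand crosses over the next
  \<open>k\<close> ones after the remaining strands have been permuted according to the rest of the code.\<close>

primrec cw :: "nat \<Rightarrow> nat list \<Rightarrow> nat list" where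
  "cw m [] = []"
| "cw m (k # c) = rev [m..<m + k] @ cw (Suc m) c"

text \<open>A strand can cross over at most the strands that follow it; these are the Lehmer codes
  of permutations.\<close>

primrec valid_code :: "nat list \<Rightarrow> bool" where
  "valid_code [] = True"
| "valid_code (k # c) = (k \<le> length c \<and> valid_code c)"

text \<open>The source and target labellings of a coloured code: a strand has label \<open>I2\<close> if it crosses over a later strand
  of its colour. A code is good if no strand crosses over a strand of its colour with label \<open>I2\<close>.\<close>

fun labels :: "nat list \<Rightarrow> nat list \<Rightarrow> vbasis list \<times> vbasis list" where
  "labels (k # c) (b # f) = (let (l, u) = labels c f; x = (b, if b \<in> fst ` set (take k u) then I2 else I1)
     in (x # l, take k u @ x # drop k u))"
| "labels _ _ = ([], [])"

fun good :: "nat list \<Rightarrow> nat list \<Rightarrow> bool" where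
  "good (k # c) (b # f) = (good c f \<and> (b, I2) \<notin> set (take k (snd (labels c f))))"
| "good _ _ = True"

lemma cw_range: "valid_code c \<Longrightarrow> set (cw m c) \<subseteq> {i. Suc i < m + length c}"
proof (induction c arbitrary: m)
  case (Cons k c)
  from Cons.IH[of "Suc m"] Cons.prems show ?case by auto
qed simp

lemma length_cw: "length (cw m c) = sum_list c"
  by (induction c arbitrary: m) auto

lemma map_add_upt_right: "map ((+) k) [m..<l] = [m + k..<l + k]"
  by (induction l) (auto simp: add.commute)

lemma cw_shift: "cw (m + k) c = map ((+) k) (cw m c)"
proof (induction c arbitrary: m)
  case (Cons a c)
  have "map ((+) k) [m..<m + a] = [m + k..<m + k + a]"
    by (simp add: map_add_upt_right ac_simps)
  then show ?case
    using Cons[of "Suc m"] by (simp add: rev_map[symmetric])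
qed simp

lemma cw_Suc: "cw (Suc m) c = map Suc (cw m c)"
  using cw_shift[of m 1 c] by (simp add: plus_1_eq_Suc)

lemma perm_map_add: "perm (map ((+) (length A)) is) (A @ f) = A @ perm is f"
proof (induction A)
  case (Cons a A)
  have "map ((+) (length (a # A))) is = map Suc (map ((+) (length A)) is)" by simp
  then show ?case
    using Cons by (simp only: append_Cons perm_map_Suc)
next
  case Nil
  have "map ((+) (length [])) is = is" by (induction "is") auto
  then show ?case by simp
qed

lemma swp_append: "swp (length A) (A @ x # y # B) = A @ y # x # B"
  by (induction A) auto

lemma perm_run: "k \<le> length f \<Longrightarrow> perm (rev [0..<k]) (a # f) = take k f @ a # drop k f"
proof (induction k)
  case (Suc k)
  then have f: "drop k f = f ! k # drop (Suc k) f" by (simp add: Cons_nth_drop_Suc)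
  have "perm (rev [0..<Suc k]) (a # f) = swp k (take k f @ a # f ! k # drop (Suc k) f)"
    using Suc f by simp
  also have "\<dots> = take k f @ f ! k # a # drop (Suc k) f"
    using swp_append[of "take k f" a "f ! k" "drop (Suc k) f"] Suc.prems by simp
  finally show ?case using Suc.prems by (simp add: take_Suc_conv_app_nth)
qed simp

lemma perm_cw_Cons:
  assumes "k \<le> length f"
  shows "perm (cw 0 (k # c)) (a # f) = take k (perm (cw 0 c) f) @ a # drop k (perm (cw 0 c) f)"
  using perm_run[of k "perm (cw 0 c) f" a] assms by (simp add: cw_Suc perm_map_Suc)

lemma labels_length: "length c = length f \<Longrightarrow> length (fst (labels c f)) = length f \<and> length (snd (labels c f)) = length f"
  by (induction c f rule: labels.induct) (auto simp: Let_def split: prod.splits)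

lemma labels_perm:
  "length c = length f \<Longrightarrow> valid_code c \<Longrightarrow>
    map fst (fst (labels c f)) = f \<and> snd (labels c f) = perm (cw 0 c) (fst (labels c f))"
proof (induction c f rule: labels.induct)
  case (1 k c b f)
  obtain l u where lu: "labels c f = (l, u)" by fastforce
  have "map fst l = f" "u = perm (cw 0 c) l" using 1 lu by auto
  moreover have "k \<le> length l" using 1(2,3) labels_length[of c f] lu by auto
  ultimately show ?case
    by (simp add: lu Let_def perm_cw_Cons del: cw.simps)
qed auto

lemma pure_run:
  assumes "k \<le> length w" "\<forall>y\<in>set (take k w). fst x \<noteq> fst y \<or> snd x = I2 \<and> snd y = I1"
  shows "pure (rev [0..<k]) (x # w)"
  using assms
proof (induction k)
  case (Suc k)
  have w: "perm (rev [0..<k]) (x # w) = take k w @ x # drop k w"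
    using Suc.prems by (intro perm_run) simp
  have "w ! k \<in> set (take (Suc k) w)" using Suc.prems by (simp add: take_Suc_conv_app_nth)
  then have "pure_cross k (take k w @ x # drop k w)"
    using Suc.prems by (auto simp: pure_cross_def nth_append)
  moreover have "set (take k w) \<subseteq> set (take (Suc k) w)"
    by (simp add: set_take_subset_set_take)
  ultimately show ?case
    using Suc w by auto
qed simp

text \<open>By goodness a strand meets only labels \<open>I1\<close> of its colour, and it carries
  \<open>I2\<close> as soon as it meets one.\<close>

lemma labels_pure: "length c = length f \<Longrightarrow> valid_code c \<Longrightarrow> good c f \<Longrightarrow> pure (cw 0 c) (fst (labels c f))"
proof (induction c f rule: labels.induct)
  case (1 k c b f)
  obtain l u where lu: "labels c f = (l, u)" by fastforce
  let ?x = "(b, if b \<in> fst ` set (take k u) then I2 else I1)"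
  have l: "pure (cw 0 c) l" "u = perm (cw 0 c) l" "k \<le> length u"
    using 1 lu labels_perm[of c f] labels_length[of c f] by auto
  have g: "(b, I2) \<notin> set (take k u)" using 1(4) lu by simp
  have "fst ?x \<noteq> fst y \<or> snd ?x = I2 \<and> snd y = I1" if y: "y \<in> set (take k u)" for y
  proof (cases "fst y = b")
    case True
    then have "snd y = I1" using g y by (cases y; cases "snd y") auto
    moreover have "b \<in> fst ` set (take k u)" using y True by force
    ultimately show ?thesis by simp
  qed simp
  then have "pure (rev [0..<k]) (?x # u)"
    using l(3) by (intro pure_run) auto
  then show ?case
    using l by (simp add: lu Let_def pure_append cw_Suc pure_map_Suc perm_map_Suc)
qed auto

text \<open>Purity forbids a strand to cross over a letter equal to its own, so in the target the
  first strand is the first occurrence of its letter. This recovers the first entry of the code, and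
  deleting the letter leads to the rest.\<close>

lemma code_unique:
  assumes "length c = length w" "length c' = length w" "valid_code c" "valid_code c'"
    "pure (cw 0 c) w" "pure (cw 0 c') w" "perm (cw 0 c) w = perm (cw 0 c') w"
  shows "c = c'"
  using assms
proof (induction c arbitrary: c' w)
  case (Cons k c)
  obtain k' d where c': "c' = k' # d" using Cons.prems by (cases c') auto
  obtain x v where w: "w = x # v" using Cons.prems by (cases w) auto
  let ?u = "perm (cw 0 c) v" and ?u' = "perm (cw 0 d) v"
  have k: "k \<le> length v" "k' \<le> length v" using Cons.prems c' w by auto
  have p: "pure (cw 0 c) v" "pure (rev [0..<k]) (x # ?u)" "pure (cw 0 d) v" "pure (rev [0..<k']) (x # ?u')"
    using Cons.prems(5,6) by (simp_all add: c' w pure_append cw_Suc pure_map_Suc perm_map_Suc)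
  have notin: "x \<notin> set (take k u)" if "pure (rev [0..<k]) (x # u)" "k \<le> length u" for u k
    using that
  proof (induction k)
    case (Suc k)
    have u: "perm (rev [0..<k]) (x # u) = take k u @ x # drop k u"
      using Suc.prems by (intro perm_run) simp
    have "pure_cross k (take k u @ x # drop k u)"
      using Suc.prems u by simp
    then have "u ! k \<noteq> x"
      using Suc.prems by (auto simp: pure_cross_def nth_append)
    then show ?case
      using Suc by (simp add: take_Suc_conv_app_nth)
  qed simp
  have eq: "take k ?u @ x # drop k ?u = take k' ?u' @ x # drop k' ?u'"
    using Cons.prems(7) k unfolding c' w by (simp add: perm_cw_Cons del: cw.simps)
  have "takeWhile (\<lambda>y. y \<noteq> x) (take k u @ x # drop k u) = take k u" if "x \<notin> set (take k u)" for u k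
    using that by (subst takeWhile_append2) auto
  then have t: "take k ?u = take k' ?u'"
    using notin[OF p(2)] notin[OF p(4)] k eq by (metis length_perm)
  then have "k = k'" using k by (metis length_perm length_take min.absorb2)
  moreover have "?u = ?u'"
    using eq t by (metis append_take_drop_id list.inject same_append_eq)
  ultimately show ?case
    using Cons.IH[of v d] Cons.prems c' w p by auto
qed simp

section \<open>Words in the crossings reduced to good codes\<close>

context bttl_algebra
begin

text \<open>A crossing slides along the strand that passes over it: within the range of the run its
  index shifts by one, beyond the range it is unchanged.\<close>

lemma W_run_commute:
  assumes "m + k < n"
  shows "Suc j < k \<Longrightarrow> S (m + j) * W (rev [m..<m + k]) = W (rev [m..<m + k]) * S (Suc (m + j))"
    and "k < j \<Longrightarrow> Suc (m + j) < n \<Longrightarrow> S (m + j) * W (rev [m..<m + k]) = W (rev [m..<m + k]) * S (m + j)"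
proof -
  have far: "S i * W xs = W xs * S i" if "\<forall>x\<in>set xs. Suc x < i \<and> Suc i < n \<or> Suc i < x \<and> Suc x < n" for i xs
    using that
  proof (induction xs)
    case (Cons x xs)
    then have "S i * S x = S x * S i"
      using S_far[of i x] S_far[of x i] by auto
    then show ?case using Cons by (simp add: mult.assoc[symmetric]) (simp add: mult.assoc)
  qed simp
  show "k < j \<Longrightarrow> Suc (m + j) < n \<Longrightarrow> S (m + j) * W (rev [m..<m + k]) = W (rev [m..<m + k]) * S (m + j)"
    by (intro far) auto
  assume j: "Suc j < k"
  let ?p = "m + j"
  have split: "[m..<m + k] = [m..<?p] @ [?p, Suc ?p] @ [Suc (Suc ?p)..<m + k]"
    using j upt_add_eq_append[of m ?p "k - j"] by (simp add: upt_conv_Cons)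
  let ?A = "W (rev [Suc (Suc ?p)..<m + k])" and ?B = "W (rev [m..<?p])"
  have R: "W (rev [m..<m + k]) = ?A * (S (Suc ?p) * (S ?p * ?B))"
    unfolding split by (simp add: mult.assoc)
  have A: "S ?p * ?A = ?A * S ?p" using j assms by (intro far) auto
  have B: "S (Suc ?p) * ?B = ?B * S (Suc ?p)" using j assms by (intro far) auto
  have "S ?p * W (rev [m..<m + k]) = ?A * (S ?p * S (Suc ?p) * S ?p) * ?B"
    unfolding R using A by (simp add: mult.assoc[symmetric])
  also have "\<dots> = ?A * (S (Suc ?p) * S ?p) * (S (Suc ?p) * ?B)"
    using S_braid[of ?p] j assms by (simp add: mult.assoc)
  also have "\<dots> = W (rev [m..<m + k]) * S (Suc ?p)"
    unfolding R B by (simp add: mult.assoc)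
  finally show "S (m + j) * W (rev [m..<m + k]) = W (rev [m..<m + k]) * S (Suc (m + j))" .
qed

text \<open>The crossing either lengthens the code or can be split off on the left. Compared with
  the first run it extends it (\<open>j = k\<close>), cancels its last step
  (\<open>k = Suc j\<close>), or slides through to the rest of the code.\<close>

lemma S_cw:
  assumes "valid_code c" "Suc j < length c" "m + length c \<le> n"
  shows "(\<exists>c'. valid_code c' \<and> length c' = length c \<and> S (m + j) * W (cw m c) = W (cw m c') \<and> sum_list c' = Suc (sum_list c)) \<or>
    (\<exists>c'. valid_code c' \<and> length c' = length c \<and> W (cw m c) = S (m + j) * W (cw m c') \<and> sum_list c = Suc (sum_list c'))"
  using assms
proof (induction c arbitrary: m j)
  case (Cons k c)
  let ?R = "W (rev [m..<m + k])"
  have k: "m + k < n" "k \<le> length c" using Cons.prems by auto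
  have lift: ?case if ij: "Suc i < length c" "S (m + j) * ?R = ?R * S (Suc m + i)" for i
  proof -
    have *: "S (m + j) * W (cw m (k # c)) = ?R * (S (Suc m + i) * W (cw (Suc m) c))"
      using ij(2) by (simp add: mult.assoc[symmetric])
    have "Suc m + length c \<le> n" using Cons.prems by simp
    have "valid_code c" using Cons.prems by simp
    show ?thesis
      using Cons.IH[OF \<open>valid_code c\<close> ij(1) \<open>Suc m + length c \<le> n\<close>]
    proof (elim disjE exE conjE)
      fix c' assume c': "valid_code c'" "length c' = length c" "S (Suc m + i) * W (cw (Suc m) c) = W (cw (Suc m) c')"
        "sum_list c' = Suc (sum_list c)"
      show ?thesis
        using * c' k by (intro disjI1 exI[of _ "k # c'"]) auto
    next
      fix c' assume c': "valid_code c'" "length c' = length c" "W (cw (Suc m) c) = S (Suc m + i) * W (cw (Suc m) c')"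
        "sum_list c = Suc (sum_list c')"
      have "W (cw m (k # c)) = (S (m + j) * ?R) * W (cw (Suc m) c')"
        unfolding ij(2) by (simp add: c'(3) mult.assoc)
      then show ?thesis
        using c' k by (intro disjI2 exI[of _ "k # c'"]) (auto simp: mult.assoc)
    qed
  qed
  consider "k < j" | "j = k" | "k = Suc j" | "Suc j < k" by linarith
  then show ?case
  proof cases
    case 1
    then have "Suc m + (j - 1) = m + j" by simp
    then show ?thesis
      using lift[of "j - 1"] W_run_commute(2)[OF k(1) 1] Cons.prems 1 by simp
  next
    case 2
    then show ?thesis
      using Cons.prems by (intro disjI1 exI[of _ "Suc k # c"]) (auto simp: mult.assoc)
  next
    case 3
    then show ?thesis
      using Cons.prems by (intro disjI2 exI[of _ "j # c"]) (auto simp: mult.assoc)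
  next
    case 4
    then show ?thesis
      using lift[of j] W_run_commute(1)[OF k(1) 4] k by simp
  qed
qed simp

lemma span_mult_left:
  assumes "x \<in> span B" "\<And>b. b \<in> B \<Longrightarrow> s * b \<in> span C"
  shows "s * x \<in> span C"
  using assms(1)
proof (induction rule: span_induct_alt)
  case base
  then show ?case by (simp add: span_zero)
next
  case (step c x y)
  then show ?case
    using assms(2) by (simp add: distrib_left scl_right span_add span_scale)
qed

definition wspan :: "'a \<Rightarrow> nat \<Rightarrow> 'a set" where
  "wspan x L = span {W is * x | is. set is \<subseteq> {i. Suc i < n} \<and> length is < L}"

lemma wspan_W: "set is \<subseteq> {i. Suc i < n} \<Longrightarrow> length is < L \<Longrightarrow> W is * x \<in> wspan x L"
  unfolding wspan_def by (intro span_base) auto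

lemma wspan_mult:
  assumes "y \<in> wspan x L" "set is \<subseteq> {i. Suc i < n}" "length is + L \<le> L'"
  shows "W is * y \<in> wspan x L'"
  using assms(1) unfolding wspan_def
proof (rule span_mult_left)
  fix b assume "b \<in> {W is * x | is. set is \<subseteq> {i. Suc i < n} \<and> length is < L}"
  then obtain js where "b = W js * x" "set js \<subseteq> {i. Suc i < n}" "length js < L" by blast
  then show "W is * b \<in> span {W is * x | is. set is \<subseteq> {i. Suc i < n} \<and> length is < L'}"
    using assms(2,3) by (intro span_base CollectI exI[of _ "is @ js"]) (auto simp: mult.assoc)
qed

definition cspan :: "'a \<Rightarrow> nat \<Rightarrow> 'a set" where
  "cspan x L = span {W (cw 0 c) * x | c. valid_code c \<and> length c = n \<and> sum_list c \<le> L}"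

lemma cspan_W: "valid_code c \<Longrightarrow> length c = n \<Longrightarrow> sum_list c \<le> L \<Longrightarrow> W (cw 0 c) * x \<in> cspan x L"
  unfolding cspan_def by (intro span_base) auto

text \<open>When \<open>S_cw\<close> splits off a crossing, its square appears. The quadratic
  relation removes it, and the tie in that relation acts as 0 or 1 on an element with a
  type.\<close>

lemma W_in_cspan:
  assumes x: "has_type f x" and "set is \<subseteq> {i. Suc i < n}"
  shows "W is * x \<in> cspan x (length is)"
  using assms(2)
proof (induction "is")
  case Nil
  have z: "valid_code (replicate m 0)" "cw j (replicate m 0) = []" "sum_list (replicate m 0) = (0 :: nat)" for m j
    by (induction m arbitrary: j) auto
  have "W (cw 0 (replicate n 0)) * x \<in> cspan x 0"
    by (intro cspan_W) (simp_all add: z)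
  then show ?case by (simp add: z)
next
  case (Cons i "is")
  then have i: "Suc i < n" by simp
  have "S i * (W is * x) \<in> cspan x (Suc (length is))"
    unfolding cspan_def
  proof (rule span_mult_left)
    show "W is * x \<in> span {W (cw 0 c) * x | c. valid_code c \<and> length c = n \<and> sum_list c \<le> length is}"
      using Cons by (simp add: cspan_def)
    fix b assume "b \<in> {W (cw 0 c) * x | c. valid_code c \<and> length c = n \<and> sum_list c \<le> length is}"
    then obtain c where c: "b = W (cw 0 c) * x" "valid_code c" "length c = n" "sum_list c \<le> length is" by blast
    have ic: "Suc i < length c" "0 + length c \<le> n" using c i by simp_all
    show "S i * b \<in> span {W (cw 0 c) * x | c. valid_code c \<and> length c = n \<and> sum_list c \<le> Suc (length is)}"
      unfolding cspan_def[symmetric]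
      using S_cw[OF c(2) ic]
    proof (elim disjE exE conjE)
      fix c' assume c': "valid_code c'" "length c' = length c" "S (0 + i) * W (cw 0 c) = W (cw 0 c')" "sum_list c' = Suc (sum_list c)"
      then have "S i * b = W (cw 0 c') * x"
        by (simp add: c(1) mult.assoc[symmetric])
      then show "S i * b \<in> cspan x (Suc (length is))"
        using cspan_W[of c'] c c' by simp
    next
      fix c' assume c': "valid_code c'" "length c' = length c" "W (cw 0 c) = S (0 + i) * W (cw 0 c')" "sum_list c = Suc (sum_list c')"
      let ?y = "W (cw 0 c') * x"
      have ty: "has_type (perm (cw 0 c') f) ?y"
        using has_type_W[OF x] cw_range[OF c'(1), of 0] c' c by simp
      have "S i * b = (S i * S i) * ?y"
        by (simp add: c(1) c' mult.assoc)
      also have "\<dots> = scl (q - inverse q) (S i * (E i * ?y)) + ?y"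
        unfolding S_quad[OF i] by (simp add: distrib_right scl_left mult.assoc)
      also have "\<dots> \<in> cspan x (Suc (length is))"
      proof -
        have "?y \<in> cspan x (Suc (length is))" "S i * ?y \<in> cspan x (Suc (length is))"
          using cspan_W[of c'] cspan_W[of c] c c' by (simp_all add: mult.assoc[symmetric])
        then show ?thesis
          using has_type_E[OF ty i] unfolding cspan_def
          by (auto intro: span_add span_scale)
      qed
      finally show "S i * b \<in> cspan x (Suc (length is))" .
    qed
  qed
  then show ?case by (simp add: mult.assoc)
qed

text \<open>The relation is given for the first three strands. The invertible product
  \<open>?D\<close> of three consecutive crossings conjugates it one strand further.\<close>

lemma TL_at:
  "Suc (Suc i) < n \<Longrightarrow> E i * E (Suc i) * (1 - scl (inverse q) (S i) - scl (inverse q) (S (Suc i))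
     + scl (inverse q ^ 2) (S i * S (Suc i)) + scl (inverse q ^ 2) (S (Suc i) * S i)
     - scl (inverse q ^ 3) (S i * S (Suc i) * S i)) = 0"
proof (induction i)
  case 0
  then show ?case using TL by simp
next
  case (Suc i)
  let ?a = "S i" and ?b = "S (Suc i)" and ?c = "S (Suc (Suc i))"
  let ?D = "?a * (?b * ?c)"
  have n: "Suc (Suc i) < n" "Suc (Suc (Suc i)) < n" using Suc.prems by auto
  note br = S_braid[OF n(1)] S_braid[OF n(2)] and fr = S_far[of i "Suc (Suc i)"]
  have ac: "?a * ?c = ?c * ?a" using n by (intro fr) auto
  have a: "?b * ?D = ?D * ?a"
  proof -
    have "?b * ?D = (?b * ?a * ?b) * ?c" by (simp only: mult.assoc)
    also have "\<dots> = ?a * ?b * (?a * ?c)" unfolding br(1)[symmetric] by (simp only: mult.assoc)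
    finally show ?thesis by (simp only: ac mult.assoc)
  qed
  have b: "?c * ?D = ?D * ?b"
  proof -
    have "?c * ?D = (?c * ?a) * ?b * ?c" by (simp only: mult.assoc)
    also have "\<dots> = ?a * (?c * ?b * ?c)" unfolding ac[symmetric] by (simp only: mult.assoc)
    finally show ?thesis unfolding br(2)[symmetric] by (simp only: mult.assoc)
  qed
  have e1: "E (Suc i) * ?D = ?D * E i"
  proof -
    have "E (Suc i) * ?D = (E (Suc i) * ?a * ?b) * ?c" by (simp only: mult.assoc)
    also have "\<dots> = ?a * ?b * (E i * ?c)" unfolding ESS(2)[OF n(1)] by (simp only: mult.assoc)
    finally show ?thesis using ES_far[of i "Suc (Suc i)"] n by (simp only: mult.assoc)
  qed
  have e2: "E (Suc (Suc i)) * ?D = ?D * E (Suc i)"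
  proof -
    have "E (Suc (Suc i)) * ?D = (E (Suc (Suc i)) * ?a) * ?b * ?c" by (simp only: mult.assoc)
    also have "\<dots> = ?a * (E (Suc (Suc i)) * ?b * ?c)"
      unfolding SE_far[OF lessI n(2), symmetric] by (simp only: mult.assoc)
    finally show ?thesis unfolding ESS(2)[OF n(2)] by (simp only: mult.assoc)
  qed
  let ?P = "\<lambda>E1 E2 a b. E1 * E2 * (1 - scl (inverse q) a - scl (inverse q) b
     + scl (inverse q ^ 2) (a * b) + scl (inverse q ^ 2) (b * a) - scl (inverse q ^ 3) (a * b * a))"
  have mv: "(x * y) * ?D = ?D * (x' * y')" if "x * ?D = ?D * x'" "y * ?D = ?D * y'" for x x' y y'
  proof -
    have "(x * y) * ?D = (x * ?D) * y'" by (simp only: mult.assoc that(2))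
    then show ?thesis by (simp only: that(1) mult.assoc)
  qed
  have lin: "scl t x * ?D = ?D * scl t x'" if "x * ?D = ?D * x'" for t x x'
    using that by (simp add: scl_left scl_right)
  have add: "(x + y) * ?D = ?D * (x' + y')" "(x - y) * ?D = ?D * (x' - y')" if "x * ?D = ?D * x'" "y * ?D = ?D * y'" for x x' y y'
    using that by (simp_all add: distrib_left distrib_right left_diff_distrib right_diff_distrib)
  have "?P (E (Suc i)) (E (Suc (Suc i))) ?b ?c * ?D = ?D * ?P (E i) (E (Suc i)) ?a ?b"
    by (intro mv add lin a b e1 e2) simp
  also have "\<dots> = 0" using Suc.IH n by simp
  finally have "?P (E (Suc i)) (E (Suc (Suc i))) ?b ?c * (?D * (S' (Suc (Suc i)) * (S' (Suc i) * S' i))) = 0"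
    by (simp add: mult.assoc[symmetric])
  moreover have "?D * (S' (Suc (Suc i)) * (S' (Suc i) * S' i)) = 1"
    using n by (simp add: mult.assoc S_cancel SS')
  ultimately show ?case by simp
qed

text \<open>The two ties fix all six terms of the Temperley--Lieb relation, which can therefore be
  solved for its longest word.\<close>

lemma three_crossings:
  assumes y: "has_type f y" and i: "Suc (Suc i) < n" and f: "f ! i = f ! Suc i" "f ! Suc i = f ! Suc (Suc i)"
  shows "W [Suc i, i, Suc i] * y \<in> wspan y 3"
proof -
  let ?a = "S i" and ?b = "S (Suc i)" and ?r = "inverse q"
  have "length f = n" using y by (simp add: has_type_def)
  have e: "E i * (E (Suc i) * (W is * y)) = W is * y" if "set is \<subseteq> {i, Suc i}" for "is"
  proof -
    have "perm is f ! i = f ! i \<and> perm is f ! Suc i = f ! i \<and> perm is f ! Suc (Suc i) = f ! i"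
      using that
    proof (induction "is")
      case Nil
      then show ?case using f by simp
    next
      case (Cons j "is")
      then have "j = i \<or> j = Suc i" by auto
      then show ?case
        using Cons i \<open>length f = n\<close> by (auto simp: nth_swp)
    qed
    moreover have "has_type (perm is f) (W is * y)"
      using that i by (intro has_type_W[OF y]) auto
    ultimately show ?thesis
      using has_type_E[of "perm is f" "W is * y"] i by simp
  qed
  have "0 = E i * E (Suc i) * (1 - scl ?r ?a - scl ?r ?b + scl (?r ^ 2) (?a * ?b) + scl (?r ^ 2) (?b * ?a)
      - scl (?r ^ 3) (?b * ?a * ?b)) * y"
    using TL_at[OF i] unfolding S_braid[OF i] by simp
  also have "\<dots> = y - scl ?r (?a * y) - scl ?r (?b * y) + scl (?r ^ 2) (W [i, Suc i] * y) + scl (?r ^ 2) (W [Suc i, i] * y)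
      - scl (?r ^ 3) (W [Suc i, i, Suc i] * y)"
    using e[of "[]"] e[of "[i]"] e[of "[Suc i]"] e[of "[i, Suc i]"] e[of "[Suc i, i]"] e[of "[Suc i, i, Suc i]"]
    by (simp add: distrib_left distrib_right left_diff_distrib right_diff_distrib scl_left scl_right mult.assoc)
  finally have "scl (?r ^ 3) (W [Suc i, i, Suc i] * y) =
      y - scl ?r (?a * y) - scl ?r (?b * y) + scl (?r ^ 2) (W [i, Suc i] * y) + scl (?r ^ 2) (W [Suc i, i] * y)"
    by (simp add: algebra_simps)
  also have "\<dots> \<in> wspan y 3"
    using wspan_W[of "[]" 3 y] wspan_W[of "[i]" 3 y] wspan_W[of "[Suc i]" 3 y] wspan_W[of "[i, Suc i]" 3 y] wspan_W[of "[Suc i, i]" 3 y] i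
    unfolding wspan_def by (intro span_add span_diff span_scale) simp_all
  finally have "scl (q ^ 3) (scl (?r ^ 3) (W [Suc i, i, Suc i] * y)) \<in> wspan y 3"
    unfolding wspan_def by (rule span_scale)
  moreover have "q ^ 3 * ?r ^ 3 = 1"
    by (simp add: power_mult_distrib[symmetric])
  ultimately show ?thesis by simp
qed

lemma run_pass:
  assumes "m + k < n" "\<forall>j\<in>set u. Suc j < k"
  shows "W (rev [m..<m + k]) * W (map ((+) (Suc m)) u) = W (map ((+) m) u) * W (rev [m..<m + k])"
  using assms(2)
proof (induction u)
  case (Cons j u)
  then have "W (rev [m..<m + k]) * W (map ((+) (Suc m)) (j # u)) =
      (S (m + j) * W (rev [m..<m + k])) * W (map ((+) (Suc m)) u)"
    using W_run_commute(1)[OF assms(1), of j] by (simp add: mult.assoc)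
  also have "\<dots> = S (m + j) * (W (map ((+) m) u) * W (rev [m..<m + k]))"
    unfolding mult.assoc by (subst Cons.IH) (use Cons.prems in auto)
  finally show ?case by (simp only: list.map W_simps mult.assoc)
qed simp

text \<open>A strand of label \<open>I2\<close> crosses over one of its colour. The word is factored
  at such a crossing so that everything performed afterwards, namely \<open>u\<close>, stays within
  the first \<open>k\<close> positions. A further strand crossing over these positions can then
  slide past \<open>u\<close> and meets both strands of the crossing. The factorization is uniform
  in the shift \<open>m\<close>, as the recursion over codes changes it.\<close>

lemma bad_crossing:
  assumes "length c = length f" "valid_code c" "(b, I2) \<in> set (take k (snd (labels c f)))"
  shows "\<exists>u i t. (\<forall>m. m + length c \<le> n \<longrightarrow> W (cw m c) = W (map ((+) m) u) * (S (m + i) * W (map ((+) m) t))) \<and>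
    set u \<subseteq> {j. Suc j < k} \<and> Suc i < k \<and> length u + 1 + length t = sum_list c \<and>
    set t \<subseteq> {j. Suc j < length f} \<and> Suc i < length f \<and> perm t f ! i = b \<and> perm t f ! Suc i = b"
  using assms
proof (induction c f arbitrary: k rule: labels.induct)
  case (1 k1 c1 b1 f1)
  obtain l1 u1 where lu: "labels c1 f1 = (l1, u1)" by fastforce
  let ?x = "(b1, if b1 \<in> fst ` set (take k1 u1) then I2 else I1)"
  have len: "length c1 = length f1" "length u1 = length f1" "k1 \<le> length f1" "valid_code c1"
    using 1(2,3) labels_length[of c1 f1] lu by auto
  have in_k: "(b, I2) \<in> set (take k (take k1 u1 @ ?x # drop k1 u1))"
    using 1(4) by (simp add: lu Let_def)
  have IH: "\<exists>u i t. (\<forall>m. m + length c1 \<le> n \<longrightarrow> W (cw m c1) = W (map ((+) m) u) * (S (m + i) * W (map ((+) m) t))) \<and>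
    set u \<subseteq> {j. Suc j < k'} \<and> Suc i < k' \<and> length u + 1 + length t = sum_list c1 \<and>
    set t \<subseteq> {j. Suc j < length f1} \<and> Suc i < length f1 \<and> perm t f1 ! i = b \<and> perm t f1 ! Suc i = b"
    if "(b, I2) \<in> set (take k' u1)" for k'
    using 1(1)[OF len(1,4), of k'] that lu by simp
  have mr: "map ((+) m) (rev [a..<l]) = rev [m + a..<m + l]" for m a l :: nat
    by (simp add: rev_map[symmetric] map_add_upt_right add.commute)
  have mS: "map ((+) m) (map Suc xs) = map ((+) (Suc m)) xs" for m and xs :: "nat list"
    by simp
  have run_n: "m + k1 < n" if "m + length (k1 # c1) \<le> n" for m
    using that len by simp
  show ?case
  proof (cases "k \<le> k1")
    case True
    then have "(b, I2) \<in> set (take k u1)"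
      using in_k len by simp
    then obtain u i t where *: "\<And>m. m + length c1 \<le> n \<Longrightarrow> W (cw m c1) = W (map ((+) m) u) * (S (m + i) * W (map ((+) m) t))"
      "set u \<subseteq> {j. Suc j < k}" "Suc i < k" "length u + 1 + length t = sum_list c1"
      "set t \<subseteq> {j. Suc j < length f1}" "Suc i < length f1" "perm t f1 ! i = b" "perm t f1 ! Suc i = b"
      using IH[of k] by blast
    let ?t = "rev [0..<k1] @ map Suc t"
    have "W (cw m (k1 # c1)) = W (map ((+) m) u) * (S (m + i) * W (map ((+) m) ?t))" if m: "m + length (k1 # c1) \<le> n" for m
    proof -
      let ?R = "W (rev [m..<m + k1])"
      \<comment> \<open>The new run passes over all positions used by \<open>u\<close> and by the
        crossing, so they slide through it with their indices lowered by one.\<close>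
      have R: "?R * W (map ((+) (Suc m)) (u @ [i])) = W (map ((+) m) (u @ [i])) * ?R"
        using *(2,3) True run_n[OF m] by (intro run_pass) auto
      have "W (cw m (k1 # c1)) = ?R * (W (map ((+) (Suc m)) u) * (S (Suc m + i) * W (map ((+) (Suc m)) t)))"
        using *(1)[of "Suc m"] m by simp
      also have "\<dots> = ?R * W (map ((+) (Suc m)) (u @ [i])) * W (map ((+) (Suc m)) t)"
        by (simp add: mult.assoc)
      also have "\<dots> = W (map ((+) m) u) * (S (m + i) * (?R * W (map ((+) (Suc m)) t)))"
        unfolding R by (simp add: mult.assoc)
      also have "?R * W (map ((+) (Suc m)) t) = W (map ((+) m) ?t)"
        unfolding map_append mr mS by simp
      finally show ?thesis .
    qed
    moreover have "perm ?t (b1 # f1) = take k1 (perm t f1) @ b1 # drop k1 (perm t f1)"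
      using perm_run[of k1 "perm t f1" b1] len by (simp add: perm_map_Suc)
    then have "perm ?t (b1 # f1) ! i = b" "perm ?t (b1 # f1) ! Suc i = b"
      using * True len by (simp_all add: nth_append)
    moreover have "set ?t \<subseteq> {j. Suc j < length (b1 # f1)}"
      using *(5) len by auto
    ultimately show ?thesis
      using *(2-6) by (intro exI[of _ u] exI[of _ i] exI[of _ ?t]) auto
  next
    case False
    show ?thesis
    proof (cases "(b, I2) = ?x")
      case True
      \<comment> \<open>Here the newly added strand has the label \<open>I2\<close>. Its run is cut
        where it crosses over a strand of its colour, at position \<open>p\<close>.\<close>
      then have b: "b1 = b" "b \<in> fst ` set (take k1 u1)" by (auto split: if_splits)
      then obtain p where p: "p < k1" "fst (u1 ! p) = b"
        using len by (auto simp: in_set_conv_nth)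
      let ?u = "rev [Suc p..<k1]" and ?t = "rev [0..<p] @ cw 1 c1"
      have split: "[m..<m + k1] = [m..<m + p] @ (m + p) # [Suc (m + p)..<m + k1]" for m
        using p upt_add_eq_append[of m "m + p" "k1 - p"] by (simp add: upt_conv_Cons)
      have "W (cw m (k1 # c1)) = W (map ((+) m) ?u) * (S (m + p) * W (map ((+) m) ?t))" for m
        unfolding map_append mr using cw_shift[of 1 m c1] by (simp add: split mult.assoc)
      moreover have "perm ?t (b1 # f1) = take p (map fst u1) @ b1 # drop p (map fst u1)"
      proof -
        have "perm (cw 0 c1) f1 = map fst u1"
          using labels_perm[OF len(1,4)] lu map_perm[of fst "cw 0 c1" l1] by simp
        then show ?thesis
          using perm_run[of p "map fst u1" b1] p len cw_Suc[of 0 c1] by (simp add: perm_map_Suc)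
      qed
      then have "perm ?t (b1 # f1) ! p = b" "perm ?t (b1 # f1) ! Suc p = b"
        using p b len by (simp_all add: nth_append)
      moreover have "set ?t \<subseteq> {j. Suc j < length (b1 # f1)}"
        using p len cw_range[OF len(4), of 1] by auto
      moreover have "length ?u + 1 + length ?t = sum_list (k1 # c1)"
        using p by (simp add: length_cw)
      ultimately show ?thesis
        using p False len by (intro exI[of _ ?u] exI[of _ p] exI[of _ ?t]) auto
    next
      case x: False
      \<comment> \<open>The strand in question is an older one; \<open>?x\<close> occupies one of
        the first \<open>k\<close> places, whence \<open>k - 1\<close>.\<close>
      have "(b, I2) \<in> set (take (k - 1) u1)"
      proof -
        have "take k (take k1 u1 @ ?x # drop k1 u1) = take k1 u1 @ ?x # take (k - 1 - k1) (drop k1 u1)"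
          using False len by (simp add: take_Cons' Suc_diff_Suc)
        moreover have "take (k - 1) u1 = take k1 u1 @ take (k - 1 - k1) (drop k1 u1)"
          using False take_add[of k1 "k - 1 - k1" u1] by simp
        ultimately show ?thesis using in_k x by auto
      qed
      then obtain u i t where *: "\<And>m. m + length c1 \<le> n \<Longrightarrow> W (cw m c1) = W (map ((+) m) u) * (S (m + i) * W (map ((+) m) t))"
        "set u \<subseteq> {j. Suc j < k - 1}" "Suc i < k - 1" "length u + 1 + length t = sum_list c1"
        "set t \<subseteq> {j. Suc j < length f1}" "Suc i < length f1" "perm t f1 ! i = b" "perm t f1 ! Suc i = b"
        using IH[of "k - 1"] by blast
      let ?u = "rev [0..<k1] @ map Suc u" and ?t = "map Suc t"
      have "W (cw m (k1 # c1)) = W (map ((+) m) ?u) * (S (m + Suc i) * W (map ((+) m) ?t))" if m: "m + length (k1 # c1) \<le> n" for m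
        unfolding map_append mr mS using *(1)[of "Suc m"] m by (simp add: mult.assoc)
      moreover have "perm ?t (b1 # f1) ! Suc i = b" "perm ?t (b1 # f1) ! Suc (Suc i) = b"
        using *(7,8) by (simp_all add: perm_map_Suc)
      moreover have "set ?u \<subseteq> {j. Suc j < k}"
        using *(2) False by auto
      moreover have "set ?t \<subseteq> {j. Suc j < length (b1 # f1)}"
        using *(5) by auto
      ultimately show ?thesis
        using *(3,4,6) by (intro exI[of _ ?u] exI[of _ "Suc i"] exI[of _ ?t]) auto
    qed
  qed
qed auto

text \<open>At the innermost failure of goodness a strand crosses over one that itself crosses over
  a third of the same colour. Sliding the other crossings away makes the three adjacent, and
  \<open>three_crossings\<close> replaces them by shorter words.\<close>

lemma bad_code:
  assumes "has_type (A @ f) x" "length c = length f" "valid_code c" "\<not> good c f"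
  shows "W (cw (length A) c) * x \<in> wspan x (sum_list c)"
  using assms
proof (induction c f arbitrary: A rule: good.induct)
  case (1 k c b f)
  let ?m = "length A"
  let ?R = "W (rev [?m..<?m + k])"
  have n: "?m + length (b # f) = n" using 1(2) by (simp add: has_type_def)
  have len: "length c = length f" "valid_code c" "k \<le> length f" using 1(3,4) by auto
  have k: "?m + k < n" using len n by simp
  show ?case
  proof (cases "good c f")
    case False
    have "W (cw (length (A @ [b])) c) * x \<in> wspan x (sum_list c)"
      by (rule "1.IH") (use 1(2) len False in auto)
    then have h: "W (cw (Suc ?m) c) * x \<in> wspan x (sum_list c)" by simp
    have "?R * (W (cw (Suc ?m) c) * x) \<in> wspan x (k + sum_list c)"
      by (rule wspan_mult[OF h]) (use k in auto)
    then show ?thesis by (simp add: mult.assoc)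
  next
    case True
    then have "(b, I2) \<in> set (take k (snd (labels c f)))" using 1(5) by simp
    then obtain u i t where *: "\<And>m. m + length c \<le> n \<Longrightarrow> W (cw m c) = W (map ((+) m) u) * (S (m + i) * W (map ((+) m) t))"
      "set u \<subseteq> {j. Suc j < k}" "Suc i < k" "length u + 1 + length t = sum_list c"
      "set t \<subseteq> {j. Suc j < length f}" "Suc i < length f" "perm t f ! i = b" "perm t f ! Suc i = b"
      using bad_crossing[OF len(1,2)] by blast
    let ?p = "?m + i"
    \<comment> \<open>Performed before the three crossings, \<open>?t\<close> brings the new strand
      and the two strands of \<open>bad_crossing\<close>, all of colour \<open>b\<close>, to the
      positions \<open>?p\<close>, \<open>?p + 1\<close> and \<open>?p + 2\<close>.\<close>
    let ?t = "rev [?m..<?p] @ map ((+) (Suc ?m)) t"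
    define y where "y = W ?t * x"
    have tn: "set ?t \<subseteq> {i. Suc i < n}"
      using *(5,6) n by auto
    have "perm ?t (A @ b # f) = A @ (take i (perm t f) @ b # drop i (perm t f))"
    proof -
      have "map ((+) (Suc ?m)) t = map ((+) ?m) (map Suc t)" by simp
      moreover have "rev [?m..<?p] = map ((+) ?m) (rev [0..<i])"
        by (simp add: rev_map[symmetric] map_add_upt_right add.commute)
      ultimately have "?t = map ((+) ?m) (rev [0..<i] @ map Suc t)" by simp
      then have "perm ?t (A @ b # f) = A @ perm (rev [0..<i] @ map Suc t) (b # f)"
        by (simp only: perm_map_add)
      then show ?thesis
        using perm_run[of i "perm t f" b] *(6) by (simp add: perm_map_Suc)
    qed
    then have "has_type (A @ (take i (perm t f) @ b # drop i (perm t f))) y"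
      using has_type_W[OF 1(2) tn] by (simp add: y_def)
    moreover have "(A @ (take i (perm t f) @ b # drop i (perm t f))) ! (?m + l) = b" if "l = i \<or> l = Suc i \<or> l = Suc (Suc i)" for l
      using that * by (auto simp: nth_append)
    from this[of i] this[of "Suc i"] this[of "Suc (Suc i)"]
    have "(A @ (take i (perm t f) @ b # drop i (perm t f))) ! ?p = b"
      "(A @ (take i (perm t f) @ b # drop i (perm t f))) ! Suc ?p = b"
      "(A @ (take i (perm t f) @ b # drop i (perm t f))) ! Suc (Suc ?p) = b" by simp_all
    ultimately have y3: "W [Suc ?p, ?p, Suc ?p] * y \<in> wspan y 3"
      using *(3) k by (intro three_crossings) auto
    have lift: "wspan y 3 \<subseteq> wspan x (3 + length ?t)"
      unfolding wspan_def[of y]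
    proof (rule span_minimal)
      show "{W is * y | is. set is \<subseteq> {i. Suc i < n} \<and> length is < 3} \<subseteq> wspan x (3 + length ?t)"
      proof clarify
        fix "is" assume "set is \<subseteq> {i. Suc i < n}" "length is < 3"
        then have "W (is @ ?t) * x \<in> wspan x (3 + length ?t)"
          using tn by (intro wspan_W) auto
        then show "W is * y \<in> wspan x (3 + length ?t)"
          by (simp add: y_def mult.assoc)
      qed
    qed (simp add: wspan_def)
    let ?A = "rev [Suc (Suc ?p)..<?m + k]"
    have split: "[?m..<?m + k] = [?m..<?p] @ [?p, Suc ?p] @ [Suc (Suc ?p)..<?m + k]"
      using *(3) upt_add_eq_append[of ?m ?p "k - i"] by (simp add: upt_conv_Cons)
    have far: "W xs * S i = S i * W xs" if "\<forall>x\<in>set xs. Suc x < i" "Suc i < n" for i xs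
      using that
    proof (induction xs)
      case (Cons x xs)
      then have "S x * S i = S i * S x" by (intro S_far) auto
      then show ?case using Cons by (simp add: mult.assoc) (simp add: mult.assoc[symmetric])
    qed simp
    have "W (cw ?m (k # c)) = ?R * (W (map ((+) (Suc ?m)) u) * (S (Suc ?m + i) * W (map ((+) (Suc ?m)) t)))"
      using *(1)[of "Suc ?m"] n len by simp
    also have "\<dots> = (?R * W (map ((+) (Suc ?m)) u)) * (S (Suc ?p) * W (map ((+) (Suc ?m)) t))"
      by (simp add: mult.assoc)
    also have "?R * W (map ((+) (Suc ?m)) u) = W (map ((+) ?m) u) * ?R"
      using *(2) k by (intro run_pass) auto
    also have "?R = W ?A * (S (Suc ?p) * (S ?p * W (rev [?m..<?p])))"
      unfolding split by (simp add: mult.assoc)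
    finally have "W (cw ?m (k # c)) * x =
      W (map ((+) ?m) u) * (W ?A * (S (Suc ?p) * (S ?p * ((W (rev [?m..<?p]) * S (Suc ?p)) * (W (map ((+) (Suc ?m)) t) * x)))))"
      by (simp only: mult.assoc)
    \<comment> \<open>This commutation collects the pattern
      \<open>S (Suc ?p) * S ?p * S (Suc ?p)\<close> directly in front of \<open>y\<close>.\<close>
    also have "W (rev [?m..<?p]) * S (Suc ?p) = S (Suc ?p) * W (rev [?m..<?p])"
      using *(3) k by (intro far) auto
    finally have "W (cw ?m (k # c)) * x = W (map ((+) ?m) u @ ?A) * (W [Suc ?p, ?p, Suc ?p] * y)"
      unfolding y_def W_simps by (simp only: mult.assoc mult_1_left mult_1_right)
    also have "\<dots> \<in> wspan x (sum_list (k # c))"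
    proof (rule wspan_mult)
      show "W [Suc ?p, ?p, Suc ?p] * y \<in> wspan x (3 + length ?t)" using y3 lift by blast
      show "set (map ((+) ?m) u @ ?A) \<subseteq> {i. Suc i < n}" using *(2) k by auto
      show "length (map ((+) ?m) u @ ?A) + (3 + length ?t) \<le> sum_list (k # c)"
        using *(3,4) by simp
    qed
    finally show ?thesis .
  qed
qed auto

definition gspan :: "nat list \<Rightarrow> 'a \<Rightarrow> 'a set" where
  "gspan f x = span {W (cw 0 c) * x | c. valid_code c \<and> length c = n \<and> good c f}"

text \<open>A word is a combination of codes that are not longer. A bad code is a combination of
  strictly shorter words, to which the induction applies.\<close>

theorem W_in_gspan:
  assumes x: "has_type f x" and "set is \<subseteq> {i. Suc i < n}"
  shows "W is * x \<in> gspan f x"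
  using assms(2)
proof (induction "length is" arbitrary: "is" rule: less_induct)
  case less
  have lf: "length f = n" using x by (simp add: has_type_def)
  have "cspan x (length is) \<subseteq> gspan f x"
    unfolding cspan_def
  proof (rule span_minimal)
    show "{W (cw 0 c) * x | c. valid_code c \<and> length c = n \<and> sum_list c \<le> length is} \<subseteq> gspan f x"
    proof
      fix b assume "b \<in> {W (cw 0 c) * x | c. valid_code c \<and> length c = n \<and> sum_list c \<le> length is}"
      then obtain c where b: "b = W (cw 0 c) * x" and c: "valid_code c" "length c = n" "sum_list c \<le> length is" by blast
      show "b \<in> gspan f x"
      proof (cases "good c f")
        case True
        then show ?thesis
          using c b unfolding gspan_def by (intro span_base) auto
      next
        case False
        have "W (cw (length ([] :: nat list)) c) * x \<in> wspan x (sum_list c)"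
          by (rule bad_code[of "[]" f]) (use x c False lf in auto)
        moreover have "wspan x (sum_list c) \<subseteq> gspan f x"
          unfolding wspan_def
        proof (rule span_minimal)
          show "{W is * x | is. set is \<subseteq> {i. Suc i < n} \<and> length is < sum_list c} \<subseteq> gspan f x"
            using less.hyps c(3) by fastforce
        qed (simp add: gspan_def)
        ultimately show ?thesis using b by auto
      qed
    qed
  qed (simp add: gspan_def)
  then show ?case using W_in_cspan[OF x less.prems] by blast
qed

end

section \<open>Idempotents of partitions\<close>

context bttl_algebra
begin

abbreviation Xp :: "nat \<times> nat \<Rightarrow> 'a" where
  "Xp p \<equiv> X (fst p) (snd p)"

primrec proj :: "(nat \<times> nat) set \<Rightarrow> (nat \<times> nat) list \<Rightarrow> 'a" where
  "proj Y [] = 1"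
| "proj Y (p # ps) = (if p \<in> Y then Xp p else 1 - Xp p) * proj Y ps"

definition all_pairs :: "(nat \<times> nat) list" where
  "all_pairs = filter (\<lambda>(i, j). i < j) (List.product [0..<n] [0..<n])"

lemma set_all_pairs: "set all_pairs = {(i, j). i < j \<and> j < n}"
  by (auto simp: all_pairs_def)

lemma distinct_all_pairs: "distinct all_pairs"
  by (simp add: all_pairs_def distinct_product)

lemma Xp_proj:
  assumes "set ps \<subseteq> {(i, j). i < j \<and> j < n}" "p \<in> set ps"
  shows "Xp p * proj Y ps = (if p \<in> Y then proj Y ps else 0)"
  using assms
proof (induction ps)
  case (Cons p' ps)
  obtain i j where p: "p = (i, j)" "i < j" "j < n" using Cons.prems by auto
  obtain k l where p': "p' = (k, l)" "k < l" "l < n" using Cons.prems by auto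
  show ?case
  proof (cases "p = p'")
    case True
    have "Xp p' * Xp p' = Xp p'" using X_idem[of k l] p' by simp
    then show ?thesis
      using True by (simp add: mult.assoc[symmetric] right_diff_distrib)
  next
    case False
    then have "p \<in> set ps" using Cons.prems by simp
    moreover have "Xp p * Xp p' = Xp p' * Xp p"
      using Xs_commute[of i j k l] p p' by simp
    then have "Xp p * (if p' \<in> Y then Xp p' else 1 - Xp p') = (if p' \<in> Y then Xp p' else 1 - Xp p') * Xp p"
      by (simp add: left_diff_distrib right_diff_distrib)
    then have "Xp p * proj Y (p' # ps) = (if p' \<in> Y then Xp p' else 1 - Xp p') * (Xp p * proj Y ps)"
      by (simp only: proj.simps mult.assoc[symmetric])
    ultimately show ?thesis using Cons by simp
  qed
qed simp

text \<open>Expansion of the product of \<open>Xp p + (1 - Xp p) = 1\<close> over the pairs.\<close>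

lemma sum_proj: "distinct ps \<Longrightarrow> (\<Sum>Y\<in>Pow (set ps). proj Y ps) = 1"
proof (induction ps)
  case (Cons p ps)
  have tail: "proj (insert p Y) ps = proj Y ps" for Y
  proof -
    have "\<forall>p'\<in>set ps. p' \<noteq> p" using Cons.prems by auto
    then show ?thesis by (induction ps) auto
  qed
  have inj: "inj_on (insert p) (Pow (set ps))"
    using Cons.prems by (auto simp: inj_on_def)
  have "(\<Sum>Y\<in>Pow (set (p # ps)). proj Y (p # ps)) =
      (\<Sum>Y\<in>Pow (set ps). proj Y (p # ps)) + (\<Sum>Y\<in>Pow (set ps). proj (insert p Y) (p # ps))"
    using Cons.prems by (subst list.set(2), subst Pow_insert, subst sum.union_disjoint)
      (auto simp: sum.reindex[OF inj])
  also have "\<dots> = (\<Sum>Y\<in>Pow (set ps). (1 - Xp p) * proj Y ps) + (\<Sum>Y\<in>Pow (set ps). Xp p * proj Y ps)"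
    using Cons.prems by (intro arg_cong2[of _ _ _ _ "(+)"] sum.cong) (auto simp: tail)
  also have "\<dots> = 1"
    using Cons by (simp add: sum.distrib[symmetric] left_diff_distrib)
  finally show ?case .
qed simp

definition pattern :: "'c list \<Rightarrow> (nat \<times> nat) set" where
  "pattern f = {(i, j). i < j \<and> j < n \<and> f ! i = f ! j}"

text \<open>If the product is nonzero, \<open>X_trans\<close> forbids exactly two of the three pairs
  of a triple of strands to lie in \<open>Y\<close>, so \<open>Y\<close> is the set of related pairs
  of an equivalence relation.\<close>

lemma proj_type:
  assumes "Y \<subseteq> set all_pairs" "proj Y all_pairs \<noteq> 0"
  obtains f :: "nat list" where "length f = n" "set f \<subseteq> {1..n}" "Y = pattern f" "has_type f (proj Y all_pairs)"
proof -
  let ?P = "proj Y all_pairs"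
  have e: "X i j * ?P = (if (i, j) \<in> Y then ?P else 0)" if "i < j" "j < n" for i j
    using Xp_proj[of all_pairs "(i, j)" Y] that by (simp add: set_all_pairs)
  have tri: "((i, j) \<in> Y \<and> (j, k) \<in> Y \<longleftrightarrow> (i, j) \<in> Y \<and> (i, k) \<in> Y) \<and> ((i, j) \<in> Y \<and> (j, k) \<in> Y \<longleftrightarrow> (i, k) \<in> Y \<and> (j, k) \<in> Y)"
    if "i < j" "j < k" "k < n" for i j k
  proof -
    have "X i j * X j k * ?P = X i j * X i k * ?P" "X i j * X j k * ?P = X i k * X j k * ?P"
      using X_trans[OF that] by metis+
    then show ?thesis
      unfolding mult.assoc
      using e[of i j] e[of j k] e[of i k] that assms(2) by (auto split: if_splits)
  qed
  have Yn: "i < j \<and> j < n" if "(i, j) \<in> Y" for i j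
    using that assms(1) by (auto simp: set_all_pairs)
  define R where "R a b \<longleftrightarrow> a = b \<or> (a, b) \<in> Y \<or> (b, a) \<in> Y" for a b
  have sym: "R a b \<Longrightarrow> R b a" for a b by (auto simp: R_def)
  have trans: "R a c" if "R a b" "R b c" for a b c
  proof -
    consider "a = b \<or> b = c \<or> a = c" | "a < b" "b < c" | "a < c" "c < b" | "b < a" "a < c" | "b < c" "c < a"
      | "c < a" "a < b" | "c < b" "b < a" by linarith
    then show ?thesis
    proof cases
      case 1
      then show ?thesis using that by (auto simp: R_def)
    next
      case 2
      then show ?thesis using that tri[of a b c] by (auto simp: R_def dest: Yn)
    next
      case 3
      then show ?thesis using that tri[of a c b] by (auto simp: R_def dest: Yn)
    next
      case 4
      then show ?thesis using that tri[of b a c] by (auto simp: R_def dest: Yn)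
    next
      case 5
      then show ?thesis using that tri[of b c a] by (auto simp: R_def dest: Yn)
    next
      case 6
      then show ?thesis using that tri[of c a b] by (auto simp: R_def dest: Yn)
    next
      case 7
      then show ?thesis using that tri[of c b a] by (auto simp: R_def dest: Yn)
    qed
  qed
  \<comment> \<open>A strand gets as its colour one more than the least strand of its block, hence a
    number in \<open>{1..n}\<close>.\<close>
  define g where "g j = Suc (LEAST a. R a j)" for j
  have g: "g i = g j \<longleftrightarrow> R i j" for i j
  proof
    assume "g i = g j"
    then have "(LEAST a. R a i) = (LEAST a. R a j)" by (simp add: g_def)
    moreover have "R (LEAST a. R a k) k" for k
      by (rule LeastI[of _ k]) (simp add: R_def)
    ultimately show "R i j" using sym trans by metis
  next
    assume "R i j"
    then have "R a i \<longleftrightarrow> R a j" for a using sym trans by blast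
    then show "g i = g j" by (simp add: g_def)
  qed
  let ?f = "map g [0..<n]"
  have "g j \<le> n" if "j < n" for j
    using Least_le[of "\<lambda>a. R a j" j] that by (simp add: g_def R_def)
  then have "set ?f \<subseteq> {1..n}" by (auto simp: g_def)
  moreover have Y: "Y = pattern ?f"
  proof -
    have "(i, j) \<in> Y \<longleftrightarrow> (i, j) \<in> pattern ?f" for i j
    proof (cases "i < j \<and> j < n")
      case True
      then show ?thesis using g[of i j] Yn[of j i] by (auto simp: pattern_def R_def)
    next
      case False
      then show ?thesis using Yn[of i j] by (auto simp: pattern_def)
    qed
    then show ?thesis by auto
  qed
  moreover have "has_type ?f ?P"
    unfolding has_type_def using e Y by (auto simp: pattern_def)
  ultimately show ?thesis
    using that[of ?f] by simp
qed

end

lemma same_pattern_permutation: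
  fixes f g :: "nat list"
  assumes "length f = length g" "set f \<subseteq> {1..d}" "set g \<subseteq> {1..d}"
    and pat: "\<And>i j. i < length f \<Longrightarrow> j < length f \<Longrightarrow> f ! i = f ! j \<longleftrightarrow> g ! i = g ! j"
  obtains s where "s permutes {1..d}" "map s f = g"
proof -
  define h where "h b = g ! (LEAST i. i < length f \<and> f ! i = b)" for b
  have h: "h (f ! i) = g ! i" if "i < length f" for i
  proof -
    let ?k = "LEAST k. k < length f \<and> f ! k = f ! i"
    have "?k < length f \<and> f ! ?k = f ! i"
      by (rule LeastI[of _ i]) (use that in simp)
    then have "g ! ?k = g ! i" using pat[of ?k i] that by blast
    then show ?thesis by (simp add: h_def)
  qed
  have "inj_on h (set f)"
  proof (rule inj_onI)
    fix x y assume "x \<in> set f" "y \<in> set f" "h x = h y"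
    then show "x = y" using h pat by (metis in_set_conv_nth)
  qed
  moreover have "h ` set f = set g"
    using h assms(1) by (force simp: in_set_conv_nth image_iff)
  ultimately have b1: "bij_betw h (set f) (set g)" by (simp add: bij_betw_def)
  then have "card (set f) = card (set g)" by (rule bij_betw_same_card)
  then have "card ({1..d} - set f) = card ({1..d} - set g)"
    using assms(2,3) by (simp add: card_Diff_subset)
  then obtain h' where b2: "bij_betw h' ({1..d} - set f) ({1..d} - set g)"
    using finite_same_card_bij[of "{1..d} - set f" "{1..d} - set g"] by auto
  define s where "s x = (if x \<in> set f then h x else if x \<in> {1..d} then h' x else x)" for x
  have "bij_betw s (set f) (set g)" using b1 by (rule bij_betw_cong[THEN iffD1, rotated]) (simp add: s_def)
  moreover have "bij_betw s ({1..d} - set f) ({1..d} - set g)"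
    using b2 by (rule bij_betw_cong[THEN iffD1, rotated]) (simp add: s_def)
  ultimately have "bij_betw s (set f \<union> ({1..d} - set f)) (set g \<union> ({1..d} - set g))"
    by (rule bij_betw_combine) auto
  moreover have "set f \<union> ({1..d} - set f) = {1..d}" "set g \<union> ({1..d} - set g) = {1..d}"
    using assms(2,3) by auto
  ultimately have "bij_betw s {1..d} {1..d}" by simp
  then have "s permutes {1..d}"
    by (rule bij_imp_permutes) (use assms(2) in \<open>auto simp: s_def\<close>)
  moreover have "map s f = g"
    using h assms(1) by (intro nth_equalityI) (auto simp: s_def)
  ultimately show ?thesis by (rule that)
qed

section \<open>The algebra of braids and ties as a type\<close>

definition main_claim :: "nat \<Rightarrow> nat \<Rightarrow> bool" where
  "main_claim d n \<longleftrightarrow> Psi d n ` carrier (BTTL n) = carrier (End_UqS d n) \<and>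
     (inj_on (Psi d n) (carrier (BTTL n)) \<longleftrightarrow> n \<le> d)"

text \<open>The abstract results on the algebra of braids and ties are about a type of class \<open>ring_1\<close>. As a type cannot
  depend on \<open>n\<close>, the carrier of the algebra is made into a type for one number \<open>n0\<close>, chosen to violate the claim
  in case any number does.\<close>

definition n0 :: nat where
  "n0 = (if \<exists>n d. n \<ge> 1 \<and> d \<ge> 1 \<and> \<not> main_claim d n then SOME n. \<exists>d. n \<ge> 1 \<and> d \<ge> 1 \<and> \<not> main_claim d n else 1)"

lemma n0_claim:
  assumes "\<And>d. d \<ge> 1 \<Longrightarrow> main_claim d n0" "n \<ge> 1" "d \<ge> 1"
  shows "main_claim d n"
proof (rule ccontr)
  assume "\<not> main_claim d n"
  then have ex: "\<exists>n d. n \<ge> 1 \<and> d \<ge> 1 \<and> \<not> main_claim d n" using assms by blast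
  then have "\<exists>d. n0 \<ge> 1 \<and> d \<ge> 1 \<and> \<not> main_claim d n0"
    unfolding n0_def using someI_ex[OF ex] by simp
  then show False using assms(1) by blast
qed

typedef bt = "carrier (BTTL n0)"
  using Tb.pclass_closed[OF Tb.zero_one_carrier(1)] by (auto simp: BTTL_def)

interpretation B: ring "BTTL n0"
  unfolding BTTL_def by (rule Tb.ring_presented)

text \<open>The class \<open>ring_1\<close> demands \<open>0 \<noteq> 1\<close>, and the unit acts
  as the identity on a nonzero tensor power.\<close>

lemma BTTL_nontrivial: "\<one>\<^bsub>BTTL n\<^esub> \<noteq> \<zero>\<^bsub>BTTL n\<^esub>"
proof
  assume "\<one>\<^bsub>BTTL n\<^esub> = \<zero>\<^bsub>BTTL n\<^esub>"
  then have "Psi 1 n (pclass (TBgens n) (BTTLrels n) 1) = Psi 1 n (pclass (TBgens n) (BTTLrels n) 0)"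
    by (simp add: BTTL_def Tb.presented_simps(2) Tb.pclass_zero)
  then have "(\<lambda>v\<in>tpow 1 n. v) = (\<lambda>v\<in>tpow 1 n. 0)"
    by (simp add: Psi_pclass Tb.zero_one_carrier word_act_simps)
  moreover have "bvec (replicate n (1, I1)) \<in> tpow 1 n"
    by (auto simp: tbasis_def)
  ultimately have "(bvec (replicate n (1, I1)) :: vec) = 0"
    by (metis (mono_tags, lifting) restrict_apply')
  then have "Poly_Mapping.lookup (bvec (replicate n (1, I1)) :: vec) (replicate n (1, I1)) = 0"
    by (simp only: lookup_zero)
  then show False by simp
qed

instantiation bt :: ring_1
begin

definition "0 = Abs_bt \<zero>\<^bsub>BTTL n0\<^esub>"
definition "1 = Abs_bt \<one>\<^bsub>BTTL n0\<^esub>"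
definition "x + y = Abs_bt (Rep_bt x \<oplus>\<^bsub>BTTL n0\<^esub> Rep_bt y)"
definition "x * y = Abs_bt (Rep_bt x \<otimes>\<^bsub>BTTL n0\<^esub> Rep_bt y)"
definition "- x = Abs_bt (\<ominus>\<^bsub>BTTL n0\<^esub> Rep_bt x)"
definition "x - y = x + - y" for x y :: bt

instance
proof
  note defs = zero_bt_def one_bt_def plus_bt_def times_bt_def uminus_bt_def minus_bt_def
  fix a b c :: bt
  show "a * b * c = a * (b * c)" "a + b + c = a + (b + c)" "a + b = b + a" "0 + a = a" "- a + a = 0"
    "a - b = a + - b" "(a + b) * c = a * c + b * c" "a * (b + c) = a * b + a * c" "1 * a = a" "a * 1 = a"
    by (simp_all add: defs Rep_bt Abs_bt_inverse Rep_bt_inverse B.m_assoc B.a_ac B.l_neg B.r_neg B.l_distr B.r_distr)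
  show "(0 :: bt) \<noteq> 1"
    using BTTL_nontrivial[of n0] by (simp add: defs Abs_bt_inject)
qed

end

abbreviation Fr :: "(tbgen, kq) free set" where
  "Fr \<equiv> carrier (free_alg (TBgens n0))"

definition cl :: "(tbgen, kq) free \<Rightarrow> bt" where
  "cl p = Abs_bt (pclass (TBgens n0) (BTTLrels n0) p)"

definition scl :: "kq \<Rightarrow> bt \<Rightarrow> bt" where
  "scl c x = Abs_bt (c \<odot>\<^bsub>BTTL n0\<^esub> Rep_bt x)"

lemma Rep_cl: "p \<in> Fr \<Longrightarrow> Rep_bt (cl p) = pclass (TBgens n0) (BTTLrels n0) p"
  using Tb.pclass_closed by (simp add: cl_def Abs_bt_inverse BTTL_def)

lemma bt_cases: obtains p where "p \<in> Fr" "x = cl p"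
proof -
  have "Rep_bt x \<in> carrier (BTTL n0)" by (rule Rep_bt)
  then obtain p where "p \<in> Fr" "Rep_bt x = pclass (TBgens n0) (BTTLrels n0) p"
    by (auto simp: BTTL_def Tb.presented_carrier)
  then have "Rep_bt x = Rep_bt (cl p)" using Rep_cl[of p] by simp
  then have "x = cl p" by (simp only: Rep_bt_inject)
  then show ?thesis by (rule that[OF \<open>p \<in> Fr\<close>])
qed

lemma cl_simps:
  "p \<in> Fr \<Longrightarrow> r \<in> Fr \<Longrightarrow> cl (p + r) = cl p + cl r"
  "p \<in> Fr \<Longrightarrow> r \<in> Fr \<Longrightarrow> cl (p * r) = cl p * cl r"
  "cl 1 = 1" "cl 0 = 0" "p \<in> Fr \<Longrightarrow> cl (sc c p) = scl c (cl p)"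
  by (simp_all add: plus_bt_def times_bt_def one_bt_def zero_bt_def scl_def Rep_cl)
     (simp_all add: cl_def BTTL_def Tb.pclass_add Tb.pclass_mult Tb.presented_simps(2) Tb.pclass_zero Tb.pclass_smult)

lemma cl_diff: "p \<in> Fr \<Longrightarrow> r \<in> Fr \<Longrightarrow> cl (p - r) = cl p - cl r"
  using cl_simps(1)[of "p - r" r] Tb.free_carrier_closed[of p n0 r] by (simp add: algebra_simps)

lemma cl_rel: "r \<in> BTTLrels n0 \<Longrightarrow> cl r = 0"
proof -
  assume r: "r \<in> BTTLrels n0"
  then have "r \<in> Fr" using BTTLrels_carrier by blast
  then have "pclass (TBgens n0) (BTTLrels n0) r = pclass (TBgens n0) (BTTLrels n0) 0"
    using Tb.rel_in_ideal[OF r] by (subst Tb.pclass_eq_iff) (simp_all add: Tb.zero_one_carrier)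
  then show ?thesis
    using cl_simps(4) by (simp add: cl_def)
qed

lemma TBgens_Suc [simp]:
  "TS (Suc i) \<in> TBgens n \<longleftrightarrow> Suc i < n" "TSinv (Suc i) \<in> TBgens n \<longleftrightarrow> Suc i < n" "TE (Suc i) \<in> TBgens n \<longleftrightarrow> Suc i < n"
  by (auto simp: TBgens_def)

lemma Fr_closed [simp]:
  "p \<in> Fr \<Longrightarrow> r \<in> Fr \<Longrightarrow> p + r \<in> Fr" "p \<in> Fr \<Longrightarrow> r \<in> Fr \<Longrightarrow> p * r \<in> Fr"
  "p \<in> Fr \<Longrightarrow> r \<in> Fr \<Longrightarrow> p - r \<in> Fr" "p \<in> Fr \<Longrightarrow> sc c p \<in> Fr" "0 \<in> Fr" "1 \<in> Fr"
  using Tb.free_carrier_closed[of p n0 r] Tb.free_carrier_closed[of p n0 p] Tb.zero_one_carrier by auto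

definition Sb :: "nat \<Rightarrow> bt" where "Sb i = cl (tS (Suc i))"
definition Sb' :: "nat \<Rightarrow> bt" where "Sb' i = cl (tSinv (Suc i))"
definition Eb :: "nat \<Rightarrow> bt" where "Eb i = cl (tE (Suc i))"

lemma scl_laws:
  "scl c (x + y) = scl c x + scl c y" "scl (a + b) x = scl a x + scl b x" "scl a (scl b x) = scl (a * b) x"
  "scl 1 x = x" "scl c x * y = scl c (x * y)" "x * scl c y = scl c (x * y)"
proof -
  obtain p where p: "p \<in> Fr" "x = cl p" by (rule bt_cases)
  obtain r where r: "r \<in> Fr" "y = cl r" by (rule bt_cases)
  show "scl c (x + y) = scl c x + scl c y" "scl (a + b) x = scl a x + scl b x" "scl a (scl b x) = scl (a * b) x"
    "scl 1 x = x" "scl c x * y = scl c (x * y)" "x * scl c y = scl c (x * y)"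
    using p r by (simp_all add: cl_simps(1,2,5)[symmetric] sc_add_left sc_mult_left sc_mult_right)
qed

lemma rel_eq: "p - r \<in> BTTLrels n0 \<Longrightarrow> p \<in> Fr \<Longrightarrow> r \<in> Fr \<Longrightarrow> cl p = cl r"
  using cl_rel[of "p - r"] cl_diff[of p r] by simp

lemma TBrels_I:
  assumes "i \<in> {1..<n}"
  shows "tS i * tSinv i - 1 \<in> BTTLrels n" "tSinv i * tS i - 1 \<in> BTTLrels n" "tE i * tE i - tE i \<in> BTTLrels n"
    "tS i * tE i - tE i * tS i \<in> BTTLrels n" "j \<in> {1..<n} \<Longrightarrow> tE i * tE j - tE j * tE i \<in> BTTLrels n"
    "tS i * tS i - (sc (q - inverse q) (tS i * tE i) + 1) \<in> BTTLrels n"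
proof -
  have "x \<in> BTTLrels n" if "x \<in> {tS i * tSinv i - 1, tSinv i * tS i - 1, tE i * tE i - tE i, tS i * tE i - tE i * tS i}" for x
    unfolding BTTLrels_def TBrels_def
    by (rule UnI1, rule UnI1, rule UnI1, rule UnI1, rule UnI1, rule UN_I[OF assms], rule that)
  then show "tS i * tSinv i - 1 \<in> BTTLrels n" "tSinv i * tS i - 1 \<in> BTTLrels n" "tE i * tE i - tE i \<in> BTTLrels n"
    "tS i * tE i - tE i * tS i \<in> BTTLrels n"
    by blast+
  show "tE i * tE j - tE j * tE i \<in> BTTLrels n" if "j \<in> {1..<n}"
    unfolding BTTLrels_def TBrels_def
    by (rule UnI1, rule UnI1, rule UnI1, rule UnI1, rule UnI2, rule UN_I[OF assms], rule UN_I[OF that], rule insertI1)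
  show "tS i * tS i - (sc (q - inverse q) (tS i * tE i) + 1) \<in> BTTLrels n"
    unfolding BTTLrels_def
    by (rule UnI1, rule UnI2, rule UN_I[OF assms], rule insertI1)
qed

lemma TBrels_far:
  assumes "i \<in> {1..<n}" "j \<in> {1..<n}" "i + 1 < j \<or> j + 1 < i"
  shows "tS i * tS j - tS j * tS i \<in> BTTLrels n" "tS i * tE j - tE j * tS i \<in> BTTLrels n"
proof -
  have "x \<in> BTTLrels n" if "x \<in> {tS i * tS j - tS j * tS i, tS i * tE j - tE j * tS i}" for x
    unfolding BTTLrels_def TBrels_def
    by (rule UnI1, rule UnI1, rule UnI1, rule UnI2, rule UN_I[of "(i, j)"]) (use assms that in \<open>simp_all only: prod.case mem_Collect_eq simp_thms\<close>)
  then show "tS i * tS j - tS j * tS i \<in> BTTLrels n" "tS i * tE j - tE j * tS i \<in> BTTLrels n"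
    by blast+
qed

lemma TBrels_near:
  assumes "i \<in> {1..<n}" "j \<in> {1..<n}" "i + 1 = j \<or> j + 1 = i"
  shows "tS i * tS j * tS i - tS j * tS i * tS j \<in> BTTLrels n" "tE i * tS j * tS i - tS j * tS i * tE j \<in> BTTLrels n"
    "tE i * tS j * tSinv i - tS j * tSinv i * tE j \<in> BTTLrels n" "tE i * tE j * tS i - tE j * tS i * tE j \<in> BTTLrels n"
proof -
  have "x \<in> BTTLrels n" if "x \<in> {tS i * tS j * tS i - tS j * tS i * tS j,
         tE i * tS j * tS i - tS j * tS i * tE j,
         tE i * tS j * tSinv i - tS j * tSinv i * tE j,
         tE i * tE j * tS i - tE j * tS i * tE j,
         tE j * tS i * tE j - tS i * tE j * tE i}" for x
    unfolding BTTLrels_def TBrels_def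
    by (rule UnI1, rule UnI1, rule UnI2, rule UN_I[of "(i, j)"]) (use assms that in \<open>simp_all only: prod.case mem_Collect_eq simp_thms\<close>)
  then show "tS i * tS j * tS i - tS j * tS i * tS j \<in> BTTLrels n" "tE i * tS j * tS i - tS j * tS i * tE j \<in> BTTLrels n"
    "tE i * tS j * tSinv i - tS j * tSinv i * tE j \<in> BTTLrels n" "tE i * tE j * tS i - tE j * tS i * tE j \<in> BTTLrels n"
    by blast+
qed

lemma Sb_rels:
  "Suc i < n0 \<Longrightarrow> Sb i * Sb' i = 1" "Suc i < n0 \<Longrightarrow> Sb' i * Sb i = 1" "Suc i < n0 \<Longrightarrow> Eb i * Eb i = Eb i"
  "Suc i < n0 \<Longrightarrow> Sb i * Eb i = Eb i * Sb i" "Suc i < n0 \<Longrightarrow> Suc j < n0 \<Longrightarrow> Eb i * Eb j = Eb j * Eb i"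
  "Suc i < n0 \<Longrightarrow> Sb i * Sb i = scl (q - inverse q) (Sb i * Eb i) + 1"
  using rel_eq[OF TBrels_I(1)[of "Suc i"]] rel_eq[OF TBrels_I(2)[of "Suc i"]] rel_eq[OF TBrels_I(3)[of "Suc i"]]
    rel_eq[OF TBrels_I(4)[of "Suc i"]] rel_eq[OF TBrels_I(5)[of "Suc i" n0 "Suc j"]] rel_eq[OF TBrels_I(6)[of "Suc i"]]
  by (simp_all add: Sb_def Sb'_def Eb_def cl_simps)

lemma Sb_far:
  assumes "Suc i < j" "Suc j < n0"
  shows "Sb i * Sb j = Sb j * Sb i" "Sb i * Eb j = Eb j * Sb i" "Eb i * Sb j = Sb j * Eb i"
proof -
  have i: "Suc i < n0" using assms by simp
  show "Sb i * Sb j = Sb j * Sb i" "Sb i * Eb j = Eb j * Sb i"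
    using rel_eq[OF TBrels_far(1)[of "Suc i" n0 "Suc j"]] rel_eq[OF TBrels_far(2)[of "Suc i" n0 "Suc j"]] assms i
    by (simp_all add: Sb_def Eb_def cl_simps)
  show "Eb i * Sb j = Sb j * Eb i"
    using rel_eq[OF TBrels_far(2)[of "Suc j" n0 "Suc i"]] assms i by (simp add: Sb_def Eb_def cl_simps)
qed

lemma Sb_near:
  assumes n: "Suc i < n0" "Suc j < n0" and ij: "j = Suc i \<or> i = Suc j"
  shows "Sb i * Sb j * Sb i = Sb j * Sb i * Sb j" "Eb i * Sb j * Sb i = Sb j * Sb i * Eb j"
    "Eb i * Sb j * Sb' i = Sb j * Sb' i * Eb j" "Eb i * Eb j * Sb i = Eb j * Sb i * Eb j"
proof -
  have *: "Suc i \<in> {1..<n0}" "Suc j \<in> {1..<n0}" "Suc i + 1 = Suc j \<or> Suc j + 1 = Suc i"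
    using n ij by auto
  show "Sb i * Sb j * Sb i = Sb j * Sb i * Sb j" "Eb i * Sb j * Sb i = Sb j * Sb i * Eb j"
    "Eb i * Sb j * Sb' i = Sb j * Sb' i * Eb j" "Eb i * Eb j * Sb i = Eb j * Sb i * Eb j"
    using rel_eq[OF TBrels_near(1)[OF *]] rel_eq[OF TBrels_near(2)[OF *]] rel_eq[OF TBrels_near(3)[OF *]]
      rel_eq[OF TBrels_near(4)[OF *]] n
    by (simp_all add: Sb_def Sb'_def Eb_def cl_simps)
qed

lemma Sb_TL:
  assumes "2 < n0"
  shows "Eb 0 * Eb 1 * (1 - scl (inverse q) (Sb 0) - scl (inverse q) (Sb 1) + scl (inverse q ^ 2) (Sb 0 * Sb 1)
    + scl (inverse q ^ 2) (Sb 1 * Sb 0) - scl (inverse q ^ 3) (Sb 0 * Sb 1 * Sb 0)) = 0"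
proof -
  let ?r = "tE 1 * tE 2 * (1 - sc (inverse q) (tS 1) - sc (inverse q) (tS 2)
           + sc (inverse q ^ 2) (tS 1 * tS 2) + sc (inverse q ^ 2) (tS 2 * tS 1)
           - sc (inverse q ^ 3) (tS 1 * tS 2 * tS 1))"
  have "?r \<in> BTTLrels n0" unfolding BTTLrels_def using assms by simp
  then have "cl ?r = 0" by (rule cl_rel)
  moreover have g: "tS 1 \<in> Fr" "tS 2 \<in> Fr" "tE 1 \<in> Fr" "tE 2 \<in> Fr"
    using assms by (auto simp: TBgens_def)
  have "cl ?r = cl (tE 1) * cl (tE 2) * (1 - scl (inverse q) (cl (tS 1)) - scl (inverse q) (cl (tS 2))
           + scl (inverse q ^ 2) (cl (tS 1) * cl (tS 2)) + scl (inverse q ^ 2) (cl (tS 2) * cl (tS 1))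
           - scl (inverse q ^ 3) (cl (tS 1) * cl (tS 2) * cl (tS 1)))"
    by (simp only: cl_simps cl_diff g Fr_closed)
  ultimately show ?thesis
    by (simp add: Sb_def Eb_def numeral_2_eq_2)
qed

global_interpretation bt: bttl_algebra scl n0 Sb Sb' Eb
  by (unfold_locales; (rule scl_laws | (rule Sb_rels Sb_far Sb_TL; assumption) | (rule Sb_near; simp)))

section \<open>The action on tensor powers\<close>

definition bt_act :: "bt \<Rightarrow> vec \<Rightarrow> vec" where
  "bt_act x v = the_elem ((\<lambda>p. word_act tbop p v) ` Rep_bt x)"

abbreviation V0 :: "vec set" where "V0 \<equiv> fmod (words n0)"

lemma bt_act_cl: "p \<in> Fr \<Longrightarrow> v \<in> V0 \<Longrightarrow> bt_act (cl p) v = word_act tbop p v"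
  unfolding bt_act_def by (subst Rep_cl) (simp_all add: Tb.coset_act)

lemma Psi_Rep: "Psi d n0 (Rep_bt x) = (\<lambda>v\<in>tpow d n0. bt_act x v)"
  by (auto simp: Psi_def bt_act_def)

lemma bt_act_closed: "v \<in> V0 \<Longrightarrow> bt_act x v \<in> V0"
  using bt_cases[of x] Tb.word_act_closed[of _ n0 v] bt_act_cl by metis

lemma bt_act_simps:
  assumes "v \<in> V0"
  shows "bt_act (x + y) v = bt_act x v + bt_act y v" "bt_act (x * y) v = bt_act x (bt_act y v)" "bt_act 1 v = v" "bt_act 0 v = 0"
    "bt_act (scl c x) v = sc c (bt_act x v)" "bt_act (x - y) v = bt_act x v - bt_act y v"
proof -
  obtain p where p: "p \<in> Fr" "x = cl p" by (rule bt_cases)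
  obtain r where r: "r \<in> Fr" "y = cl r" by (rule bt_cases)
  show "bt_act (x + y) v = bt_act x v + bt_act y v" "bt_act (x * y) v = bt_act x (bt_act y v)" "bt_act (scl c x) v = sc c (bt_act x v)"
    "bt_act (x - y) v = bt_act x v - bt_act y v"
    using p r assms Tb.word_act_closed[of r n0 v]
    by (simp_all add: cl_simps(1,2,5)[symmetric] cl_diff[symmetric] bt_act_cl word_act_simps Tb.word_act_mult)
  show "bt_act 1 v = v" "bt_act 0 v = 0"
    using assms bt_act_cl[of 1 v] bt_act_cl[of 0 v] by (simp_all add: cl_simps(3,4) word_act_simps)
qed

lemma bt_act_lin:
  assumes "u \<in> V0" "v \<in> V0"
  shows "bt_act x (u + v) = bt_act x u + bt_act x v" "bt_act x (sc c v) = sc c (bt_act x v)"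
proof -
  obtain p where p: "p \<in> Fr" "x = cl p" by (rule bt_cases)
  show "bt_act x (u + v) = bt_act x u + bt_act x v" "bt_act x (sc c v) = sc c (bt_act x v)"
    using p assms by (simp_all add: bt_act_cl fmod_add fmod_sc lin_simps[OF Tb.word_act_lin2])
qed

lemma bt_act_sum: "finite A \<Longrightarrow> v \<in> V0 \<Longrightarrow> bt_act (\<Sum>a\<in>A. f a) v = (\<Sum>a\<in>A. bt_act (f a) v)"
  by (induction A rule: finite_induct) (simp_all add: bt_act_simps)

lemma bt_act_gens:
  assumes "Suc i < n0" "v \<in> V0"
  shows "bt_act (Sb i) v = SG i v" "bt_act (Eb i) v = EP i v" "bt_act (Sb' i) v = SGinv i v"
  using assms by (simp_all add: Sb_def Eb_def Sb'_def bt_act_cl)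

lemma bt_act_W: "set is \<subseteq> {i. Suc i < n0} \<Longrightarrow> v \<in> V0 \<Longrightarrow> bt_act (bt.W is) v = SGs is v"
proof (induction "is")
  case (Cons i "is")
  have "SGs is v \<in> V0"
    using Cons bt_act_closed[of v "bt.W is"] by simp
  then show ?case
    using Cons by (simp add: bt_act_simps bt_act_gens)
qed (simp add: bt_act_simps)

lemma bt_act_Sact: "inj s \<Longrightarrow> v \<in> V0 \<Longrightarrow> bt_act x (Sact s v) = Sact s (bt_act x v)"
proof -
  assume s: "inj s" and v: "v \<in> V0"
  obtain p where p: "p \<in> Fr" "x = cl p" by (rule bt_cases)
  have "Sact s v \<in> V0"
    by (rule lin_fmod[OF lin_Sact _ v]) (auto simp: Sact_bvec words_def)
  then show ?thesis
    using Tb.word_act_commute[OF lin_Sact[of s] _ p(1) v, where h = tbop] tbop_Sact[OF s] p v by (simp add: bt_act_cl)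
qed

lemma SGinv_keys:
  assumes "Suc k < length w" "u \<in> Poly_Mapping.keys (SGinv k (bvec w))"
  shows "map fst u = swp k (map fst w)"
proof -
  have "u \<in> Poly_Mapping.keys (SG k (bvec w)) \<or> u \<in> Poly_Mapping.keys (EP k (bvec w))"
    using assms(2) unfolding SGinv_def by (auto simp: in_keys_iff lookup_minus)
  then show ?thesis
  proof
    assume "u \<in> Poly_Mapping.keys (EP k (bvec w))"
    then have u: "u = w" "fst (w ! k) = fst (w ! Suc k)"
      using assms(1) by (auto simp: EP_bvec split: if_splits)
    have "swp k (map fst w) = map fst w"
      using u(2) assms(1) by (intro nth_equalityI) (auto simp: nth_swp)
    then show ?thesis using u by simp
  qed (use SG_keys[OF assms(1)] in simp)
qed

text \<open>\<open>bt_act x\<close> is controlled only on \<open>V0\<close>. A representative of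
  \<open>x\<close> provides a globally linear operator, for which comparison on basis vectors is
  available.\<close>

lemma bt_act_eq_on:
  assumes "B \<subseteq> words n0" "lin g" "\<And>w. w \<in> B \<Longrightarrow> bt_act x (bvec w) = g (bvec w)" "v \<in> fmod B"
  shows "bt_act x v = g v"
proof -
  obtain p where p: "p \<in> Fr" "x = cl p" by (rule bt_cases)
  have "word_act tbop p (bvec w) = g (bvec w)" if w: "w \<in> B" for w
  proof -
    have "(bvec w :: vec) \<in> V0" using w assms(1) by auto
    then show ?thesis using assms(3)[OF w] bt_act_cl[OF p(1)] p(2) by simp
  qed
  then have "word_act tbop p v = g v"
    by (rule lin_eq_on[OF Tb.word_act_lin2 assms(2) _ assms(4)])
  then show ?thesis
    using bt_act_cl[OF p(1)] fmod_mono[OF assms(4,1)] p(2) by simp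
qed

text \<open>In the conjugation by \<open>S m\<close>, the inverse crossing moves the colour of
  strand \<open>m + 1\<close> to strand \<open>m\<close>, where the induction applies, and the
  crossing moves it back.\<close>

lemma bt_act_X:
  assumes "i < j" "j < n0" "w \<in> words n0"
  shows "bt_act (bt.X i j) (bvec w) = (if fst (w ! i) = fst (w ! j) then bvec w else 0)"
  using assms
proof (induction j arbitrary: w)
  case (Suc m)
  have len: "length w = n0" and wV: "(bvec w :: vec) \<in> V0" using Suc.prems by (auto simp: words_def)
  show ?case
  proof (cases "m = i")
    case True
    then show ?thesis using Suc.prems len wV by (simp add: bt_act_gens EP_bvec)
  next
    case False
    let ?v = "SGinv m (bvec w)"
    have m: "Suc m < n0" using Suc.prems by simp
    have vV: "?v \<in> V0" using bt_act_closed[OF wV, of "Sb' m"] bt_act_gens[OF m wV] by simp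
    have "bt_act (bt.X i (Suc m)) (bvec w) = SG m (bt_act (bt.X i m) ?v)"
      using False Suc.prems m wV vV bt_act_closed[OF vV]
      by (simp add: bt.conj_def bt_act_simps bt_act_gens)
    also have "bt_act (bt.X i m) ?v = (if fst (w ! i) = fst (w ! Suc m) then ?v else 0)"
    proof -
      have "bt_act (bt.X i m) (bvec u) = (if fst (w ! i) = fst (w ! Suc m) then bvec u else 0)"
        if u: "u \<in> Poly_Mapping.keys ?v" for u
      proof -
        have "map fst u = swp m (map fst w)" using SGinv_keys[of m w u] u m len by simp
        then have "map fst u ! i = fst (w ! i)" "map fst u ! m = fst (w ! Suc m)" "length u = n0"
          using False Suc.prems len by (auto simp: nth_swp dest: arg_cong[of _ _ length])
        then show ?thesis
          using Suc.IH[of u] False Suc.prems by (simp add: words_def)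
      qed
      moreover have "Poly_Mapping.keys ?v \<subseteq> words n0" using vV by (simp add: fmod_def)
      moreover have "lin (\<lambda>v. if fst (w ! i) = fst (w ! Suc m) then v else (0 :: vec))" by (simp add: lin_def)
      moreover have "?v \<in> fmod (Poly_Mapping.keys ?v)" by (simp add: fmod_def)
      ultimately show ?thesis
        using bt_act_eq_on[of "Poly_Mapping.keys ?v" "\<lambda>v. if fst (w ! i) = fst (w ! Suc m) then v else 0"] by blast
    qed
    finally show ?thesis
      using rel_inv(1)[of m n0 "bvec w"] m wV by auto
  qed
qed simp

definition cpattern :: "vbasis list \<Rightarrow> (nat \<times> nat) set" where
  "cpattern w = {(i, j). i < j \<and> j < n0 \<and> fst (w ! i) = fst (w ! j)}"

lemma bt_act_proj:
  assumes "set ps \<subseteq> {(i, j). i < j \<and> j < n0}" "w \<in> words n0"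
  shows "bt_act (bt.proj Y ps) (bvec w) = (if \<forall>p\<in>set ps. p \<in> Y \<longleftrightarrow> p \<in> cpattern w then bvec w else 0)"
  using assms(1)
proof (induction ps)
  case Nil
  then show ?case using assms(2) by (simp add: bt_act_simps)
next
  case (Cons p ps)
  obtain i j where p: "p = (i, j)" "i < j" "j < n0" using Cons.prems by auto
  have wV: "(bvec w :: vec) \<in> V0" using assms(2) by simp
  define a where "a = (if p \<in> Y then bt.Xp p else 1 - bt.Xp p)"
  have a: "bt_act a (bvec w) = (if p \<in> Y \<longleftrightarrow> p \<in> cpattern w then bvec w else 0)"
    using bt_act_X[OF p(2,3) assms(2)] p wV by (auto simp: a_def bt_act_simps cpattern_def)
  have a0: "bt_act a 0 = 0"
    using bt_act_lin(2)[of 0 0 a 0] by simp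
  have "bt_act (bt.proj Y (p # ps)) (bvec w) = bt_act a (bt_act (bt.proj Y ps) (bvec w))"
    using wV by (simp add: bt_act_simps(2) a_def)
  then show ?case
    using Cons a a0 by auto
qed

lemma bt_act_proj_all:
  assumes "Y \<subseteq> set bt.all_pairs" "w \<in> words n0"
  shows "bt_act (bt.proj Y bt.all_pairs) (bvec w) = (if Y = cpattern w then bvec w else 0)"
proof -
  have "(\<forall>p\<in>set bt.all_pairs. p \<in> Y \<longleftrightarrow> p \<in> cpattern w) \<longleftrightarrow> Y = cpattern w"
    using assms(1) by (auto simp: bt.set_all_pairs cpattern_def)
  then show ?thesis
    using bt_act_proj[of bt.all_pairs w Y] assms(2) by (simp add: bt.set_all_pairs)
qed

lemma cpattern_pattern: "length f = n0 \<Longrightarrow> map fst w = f \<Longrightarrow> cpattern w = bt.pattern f"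
  by (auto simp: cpattern_def bt.pattern_def)

lemma bt_act_proj_cmod:
  assumes "length f = n0" "v \<in> cmod f" "Y \<subseteq> set bt.all_pairs"
  shows "bt_act (bt.proj Y bt.all_pairs) v = (if Y = bt.pattern f then v else 0)"
proof (rule bt_act_eq_on[OF _ _ _ assms(2)])
  show "colored f \<subseteq> words n0" using assms(1) by (auto simp: colored_def words_def)
  show "bt_act (bt.proj Y bt.all_pairs) (bvec w) = (if Y = bt.pattern f then bvec w else 0)" if "w \<in> colored f" for w
  proof -
    have w: "map fst w = f" using that by (simp add: colored_def)
    then have "w \<in> words n0" using assms(1) by (auto simp: words_def)
    then show ?thesis
      using bt_act_proj_all[OF assms(3)] cpattern_pattern[OF assms(1) w] by simp
  qed
qed (simp add: lin_def)

section \<open>Injectivity\<close>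

lemma Sb'_eq: "Suc i < n0 \<Longrightarrow> Sb' i = Sb i - scl (q - inverse q) (Eb i)"
proof -
  assume i: "Suc i < n0"
  have "Sb i = Sb' i * (Sb i * Sb i)"
    using Sb_rels(2)[OF i] by (simp add: mult.assoc[symmetric])
  also have "\<dots> = scl (q - inverse q) (Sb' i * Sb i * Eb i) + Sb' i"
    by (simp add: Sb_rels(6)[OF i] distrib_left scl_laws mult.assoc)
  also have "\<dots> = scl (q - inverse q) (Eb i) + Sb' i"
    using Sb_rels(2)[OF i] by simp
  finally show ?thesis by (simp add: algebra_simps)
qed

lemma cl_sum: "finite A \<Longrightarrow> (\<And>a. a \<in> A \<Longrightarrow> f a \<in> Fr) \<Longrightarrow> (\<Sum>a\<in>A. f a) \<in> Fr \<and> cl (\<Sum>a\<in>A. f a) = (\<Sum>a\<in>A. cl (f a))"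
  by (induction A rule: finite_induct) (simp_all add: cl_simps)

text \<open>Ties act as 0 or 1 on elements with a type, and inverse crossings are combinations of
  crossings and ties. So every generator preserves the span of the words in the crossings times
  \<open>P\<close>.\<close>

lemma mult_in_gspan:
  assumes P: "bt.has_type f P"
  shows "x * P \<in> bt.gspan f P"
proof -
  define T where "T = {bt.W is * P | is. set is \<subseteq> {i. Suc i < n0}}"
  have S: "Sb i * y \<in> bt.span T" if i: "Suc i < n0" and y: "y \<in> bt.span T" for i y
  proof (rule bt.span_mult_left[OF y])
    fix z assume "z \<in> T"
    then obtain "is" where z: "z = bt.W is * P" "set is \<subseteq> {i. Suc i < n0}" by (auto simp: T_def)
    then have "Sb i * z = bt.W (i # is) * P" by (simp add: mult.assoc)
    moreover have "set (i # is) \<subseteq> {i. Suc i < n0}" using z(2) i by simp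
    ultimately have "Sb i * z \<in> T" unfolding T_def by blast
    then show "Sb i * z \<in> bt.span T" by (rule bt.span_base)
  qed
  have E: "Eb i * y \<in> bt.span T" if i: "Suc i < n0" and y: "y \<in> bt.span T" for i y
  proof (rule bt.span_mult_left[OF y])
    fix z assume z': "z \<in> T"
    then obtain "is" where z: "z = bt.W is * P" "set is \<subseteq> {i. Suc i < n0}" by (auto simp: T_def)
    have "Eb i * z = z \<or> Eb i * z = 0"
      using bt.has_type_E[OF bt.has_type_W[OF P z(2)] i] z(1) by auto
    then show "Eb i * z \<in> bt.span T"
      using bt.span_base[OF z'] bt.span_zero by auto
  qed
  have g: "cl (gen a) * y \<in> bt.span T" if a: "a \<in> TBgens n0" and y: "y \<in> bt.span T" for a y
  proof -
    obtain i where i: "Suc i < n0" "a \<in> {TS (Suc i), TSinv (Suc i), TE (Suc i)}"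
    proof -
      obtain j where "j \<in> {1..<n0}" "a \<in> {TS j, TSinv j, TE j}"
        using a by (auto simp: TBgens_def)
      then show ?thesis using that[of "j - 1"] by auto
    qed
    have "Sb' i * y \<in> bt.span T"
      using S[OF i(1) y] E[OF i(1) y]
      by (simp add: Sb'_eq[OF i(1)] left_diff_distrib scl_laws bt.span_diff bt.span_scale)
    then show ?thesis
      using S[OF i(1) y] E[OF i(1) y] i(2) by (auto simp: Sb_def Sb'_def Eb_def)
  qed
  have w: "bvec (FM l) \<in> Fr \<and> cl (bvec (FM l)) * P \<in> bt.span T" if "set l \<subseteq> TBgens n0" for l
    using that
  proof (induction l)
    case Nil
    have "1 * P \<in> T" unfolding T_def using bt.W_simps(1) by (metis (mono_tags, lifting) empty_set empty_subsetI mem_Collect_eq)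
    then show ?case
      using bt.span_base[of "1 * P" T] by (simp add: one_free[symmetric] cl_simps)
  next
    case (Cons a l)
    have e: "bvec (FM (a # l)) = gen a * (bvec (FM l) :: (tbgen, kq) free)"
      by (simp add: gen_def mult_single plus_fmon_def)
    have a: "gen a \<in> Fr" using Cons.prems by simp
    have "cl (bvec (FM (a # l))) * P = cl (gen a) * (cl (bvec (FM l)) * P)"
      using Cons a by (simp add: e cl_simps mult.assoc)
    then show ?case
      using Cons a g[of a "cl (bvec (FM l)) * P"] e Fr_closed(2)[of "gen a" "bvec (FM l)"] by simp
  qed
  obtain p where p: "p \<in> Fr" "x = cl p" by (rule bt_cases)
  have "x * P \<in> bt.span T"
  proof -
    have k: "bvec m \<in> Fr \<and> cl (bvec m) * P \<in> bt.span T" if "m \<in> Poly_Mapping.keys p" for m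
    proof -
      have "set (letters m) \<subseteq> TBgens n0" using p(1) that by (auto simp: carrier_free_alg fmod_def)
      then show ?thesis using w[of "letters m"] by simp
    qed
    have "cl p = cl (\<Sum>m\<in>Poly_Mapping.keys p. sc (Poly_Mapping.lookup p m) (bvec m))"
      using vec_expand[of p] by simp
    also have "\<dots> = (\<Sum>m\<in>Poly_Mapping.keys p. cl (sc (Poly_Mapping.lookup p m) (bvec m)))"
      using cl_sum[of "Poly_Mapping.keys p" "\<lambda>m. sc (Poly_Mapping.lookup p m) (bvec m)"] k by simp
    also have "\<dots> = (\<Sum>m\<in>Poly_Mapping.keys p. scl (Poly_Mapping.lookup p m) (cl (bvec m)))"
      using k by (intro sum.cong) (simp_all add: cl_simps)
    finally have "x * P = (\<Sum>m\<in>Poly_Mapping.keys p. scl (Poly_Mapping.lookup p m) (cl (bvec m) * P))"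
      by (simp add: p(2) sum_distrib_right scl_laws)
    then show ?thesis
      using k by (auto intro!: bt.span_sum bt.span_scale)
  qed
  moreover have "bt.span T \<subseteq> bt.gspan f P"
  proof (rule bt.span_minimal)
    show "T \<subseteq> bt.gspan f P" using bt.W_in_gspan[OF P] by (auto simp: T_def)
    show "bt.subspace (bt.gspan f P)" unfolding bt.gspan_def by (rule bt.subspace_span)
  qed
  ultimately show ?thesis by blast
qed

lemma finite_codes: "finite {c. valid_code c \<and> length c = n}"
proof (rule finite_subset[OF _ finite_lists_length_eq[of "{..n}" n]])
  have "set c \<subseteq> {..length c}" if "valid_code c" for c
    using that by (induction c) auto
  then show "{c. valid_code c \<and> length c = n} \<subseteq> {c. set c \<subseteq> {..n} \<and> length c = n}" by auto
qed simp

text \<open>Among the codes which occur in a relation, take one with the maximal number of crossings of equal colours. No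
  other one of them contributes to the coefficient of its target labelling in the image of its source labelling.\<close>

lemma good_codes_independent:
  assumes "finite C" "\<And>c. c \<in> C \<Longrightarrow> valid_code c \<and> length c = length f \<and> good c f"
    and zero: "\<And>v. v \<in> cmod f \<Longrightarrow> (\<Sum>c\<in>C. sc (a c) (SGs (cw 0 c) v)) = 0"
    and "c \<in> C"
  shows "a c = 0"
proof (rule ccontr)
  assume "a c \<noteq> 0"
  let ?C = "{c \<in> C. a c \<noteq> 0}" and ?N = "\<lambda>c. ncross (cw 0 c) f"
  have "finite ?C" "?C \<noteq> {}" using assms(1,4) \<open>a c \<noteq> 0\<close> by auto
  then have "Max (?N ` ?C) \<in> ?N ` ?C" by (intro Max_in) auto
  then obtain d where "d \<in> ?C" and d: "?N d = Max (?N ` ?C)" by auto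
  have max: "?N c \<le> ?N d" if "c \<in> ?C" for c
    unfolding d using \<open>finite ?C\<close> that by (intro Max_ge) auto
  define w where "w = fst (labels d f)"
  define u where "u = perm (cw 0 d) w"
  have dC: "valid_code d" "length d = length f" "good d f" "a d \<noteq> 0" "d \<in> C" using \<open>d \<in> ?C\<close> assms(2) by auto
  have w: "map fst w = f" "length w = length f" "pure (cw 0 d) w"
    using labels_perm[OF dC(2,1)] labels_length[OF dC(2)] labels_pure[OF dC(2,1,3)] by (auto simp: w_def)
  have rng: "set (cw 0 c) \<subseteq> {i. Suc i < length w}" if "c \<in> C" for c
    using cw_range[of c 0] assms(2)[OF that] w(2) by auto
  have du: "SGs (cw 0 d) (bvec w) = bvec u" "inversions w = inversions u + ?N d"
    using SGs_pure[OF rng[OF dC(5)] w(3)] w(1) by (simp_all add: u_def)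
  have "a c * Poly_Mapping.lookup (SGs (cw 0 c) (bvec w)) u = (if c = d then a d else 0)" if c: "c \<in> C" for c
  proof (cases "c = d")
    case False
    have "u \<notin> Poly_Mapping.keys (SGs (cw 0 c) (bvec w))" if ac: "a c \<noteq> 0"
    proof
      assume u: "u \<in> Poly_Mapping.keys (SGs (cw 0 c) (bvec w))"
      have "?N c \<le> ?N d" using max c ac by simp
      then have "pure (cw 0 c) w \<and> u = perm (cw 0 c) w"
        using SGs_keys[OF rng[OF c] u] du(2) w(1) by auto
      then have "c = d"
        using code_unique[of c w d] assms(2)[OF c] dC w by (simp add: u_def)
      then show False using False by simp
    qed
    then show ?thesis using False by (auto simp: in_keys_iff)
  qed (simp add: du)
  then have "(\<Sum>c\<in>C. a c * Poly_Mapping.lookup (SGs (cw 0 c) (bvec w)) u) = a d"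
    using assms(1) dC(5) by simp
  moreover have "Poly_Mapping.lookup (\<Sum>c\<in>C. sc (a c) (SGs (cw 0 c) (bvec w))) u = 0"
    by (subst zero) (auto simp: colored_def w)
  ultimately show False
    using dC(4) by (simp add: lookup_sum)
qed

text \<open>\<open>x * P\<close> is a combination of good codes times \<open>P\<close>. On
  \<open>cmod f\<close>, where \<open>P\<close> is the identity, it acts through the operators of
  these codes, which are independent.\<close>

lemma faithful_on_type:
  assumes P: "bt.has_type f P" and id: "\<And>v. v \<in> cmod f \<Longrightarrow> bt_act P v = v" and x: "\<And>v. v \<in> cmod f \<Longrightarrow> bt_act x v = 0"
  shows "x * P = 0"
proof -
  have lf: "length f = n0" using P by (simp add: bt.has_type_def)
  let ?C = "{c. valid_code c \<and> length c = n0 \<and> good c f}" and ?g = "\<lambda>c. bt.W (cw 0 c) * P"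
  have fin: "finite ?C" by (rule finite_subset[OF _ finite_codes[of n0]]) auto
  have im: "{bt.W (cw 0 c) * P | c. valid_code c \<and> length c = n0 \<and> good c f} = ?g ` ?C" by auto
  have "x * P \<in> bt.span (?g ` ?C)"
    using mult_in_gspan[OF P, of x] unfolding bt.gspan_def im .
  \<comment> \<open>Different codes might give the same multiple of \<open>P\<close>; one code is
    kept for each element.\<close>
  obtain C where C: "C \<subseteq> ?C" "inj_on ?g C" "?g ` ?C = ?g ` C"
    using subset_image_inj[of "?g ` ?C" ?g ?C] by auto
  have finC: "finite C" using C(1) fin finite_subset by blast
  have "x * P \<in> bt.span (?g ` C)" using \<open>x * P \<in> bt.span (?g ` ?C)\<close> C(3) by simp
  then obtain r where "x * P = (\<Sum>y\<in>?g ` C. scl (r y) y)"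
    using bt.span_finite[of "?g ` C"] finC by auto
  then have xP: "x * P = (\<Sum>c\<in>C. scl (r (?g c)) (?g c))"
    by (simp add: sum.reindex[OF C(2)])
  have "r (?g c) = 0" if "c \<in> C" for c
  proof (rule good_codes_independent[OF finC _ _ that, of f "\<lambda>c. r (?g c)"])
    show "valid_code c \<and> length c = length f \<and> good c f" if "c \<in> C" for c using that C(1) lf by auto
    fix v assume v: "v \<in> cmod f"
    then have vV: "v \<in> V0" using colored_words lf by metis
    have "bt_act (scl (r (?g c)) (?g c)) v = sc (r (?g c)) (SGs (cw 0 c) v)" if "c \<in> C" for c
    proof -
      have "valid_code c" "length c = n0" using that C(1) by auto
      then have "set (cw 0 c) \<subseteq> {i. Suc i < n0}" using cw_range[of c 0] by simp
      then show ?thesis using id[OF v] vV by (simp add: bt_act_simps bt_act_W)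
    qed
    then have "(\<Sum>c\<in>C. sc (r (?g c)) (SGs (cw 0 c) v)) = bt_act (x * P) v"
      using finC vV by (simp add: xP bt_act_sum)
    also have "\<dots> = 0" using id[OF v] x[OF v] vV by (simp add: bt_act_simps)
    finally show "(\<Sum>c\<in>C. sc (r (?g c)) (SGs (cw 0 c) v)) = 0" .
  qed
  then show ?thesis
    using bt.scale_zero_left by (simp add: xP)
qed

lemma cmod_tpow: "set f \<subseteq> {1..d} \<Longrightarrow> v \<in> cmod f \<Longrightarrow> v \<in> tpow d (length f)"
  by (erule fmod_mono) (fastforce simp: colored_def tbasis_def mem_Times_iff)

text \<open>With at least as many colours as strands, every partition of the strands is realized by
  a colouring, so each summand of \<open>x\<close> is detected.\<close>

lemma faithful:
  assumes "n0 \<le> d" and x: "\<And>v. v \<in> tpow d n0 \<Longrightarrow> bt_act x v = 0"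
  shows "x = 0"
proof -
  have "x * bt.proj Y bt.all_pairs = 0" if Y: "Y \<in> Pow (set bt.all_pairs)" for Y
  proof (cases "bt.proj Y bt.all_pairs = 0")
    case False
    then obtain f :: "nat list" where f: "length f = n0" "set f \<subseteq> {1..n0}" "Y = bt.pattern f"
      "bt.has_type f (bt.proj Y bt.all_pairs)"
      using bt.proj_type[of Y] Y by blast
    show ?thesis
    proof (rule faithful_on_type[OF f(4)])
      show "bt_act (bt.proj Y bt.all_pairs) v = v" if "v \<in> cmod f" for v
        using bt_act_proj_cmod[OF f(1) that, of Y] Y f(3) by simp
      show "bt_act x v = 0" if "v \<in> cmod f" for v
      proof (rule x)
        have "set f \<subseteq> {1..d}" using f(2) assms(1) by auto
        then show "v \<in> tpow d n0" using cmod_tpow[OF _ that] f(1) by simp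
      qed
    qed
  qed simp
  then have "(\<Sum>Y\<in>Pow (set bt.all_pairs). x * bt.proj Y bt.all_pairs) = 0"
    by (intro sum.neutral) blast
  then show ?thesis
    using bt.sum_proj[OF bt.distinct_all_pairs] by (simp add: sum_distrib_left[symmetric])
qed

text \<open>The idempotent of the partition into singletons requires pairwise different colours,
  which \<open>d\<close> colours cannot provide.\<close>

lemma not_faithful:
  assumes "d < n0"
  shows "\<exists>x. x \<noteq> 0 \<and> (\<forall>v\<in>tpow d n0. bt_act x v = 0)"
proof (intro exI conjI ballI)
  let ?P = "bt.proj {} bt.all_pairs"
  have "cpattern w \<noteq> {}" if w: "w \<in> tbasis d n0" for w
  proof -
    have "fst ` set w \<subseteq> {1..d}" "length w = n0" using w by (auto simp: tbasis_def)
    then have "card (set (map fst w)) \<le> d"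
      using card_mono[of "{1..d}" "set (map fst w)"] by simp
    then have "\<not> distinct (map fst w)"
      using distinct_card[of "map fst w"] assms \<open>length w = n0\<close> by auto
    then obtain i j where "i < n0" "j < n0" "i \<noteq> j" "fst (w ! i) = fst (w ! j)"
      using \<open>length w = n0\<close> by (auto simp: distinct_conv_nth)
    then have "(i, j) \<in> cpattern w \<or> (j, i) \<in> cpattern w"
      by (auto simp: cpattern_def)
    then show ?thesis by blast
  qed
  then have zero: "bt_act ?P (bvec w) = 0" if "w \<in> tbasis d n0" for w
    using bt_act_proj_all[of "{}" w] that tbasis_words[of d n0] by (metis empty_subsetI subsetD)
  show "bt_act ?P v = 0" if "v \<in> tpow d n0" for v
    by (rule bt_act_eq_on[OF tbasis_words lin_const0 zero that])
  \<comment> \<open>Colours outside \<open>{1..d}\<close> are allowed in \<open>words n0\<close>. On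
    this word, with pairwise different colours, the idempotent is the identity and hence
    nonzero.\<close>
  let ?w = "map (\<lambda>b. (b, I1)) [0..<n0]"
  have "cpattern ?w = {}" "?w \<in> words n0"
    by (auto simp: cpattern_def words_def)
  then have "bt_act ?P (bvec ?w) = bvec ?w"
    using bt_act_proj_all[of "{}" ?w] by simp
  moreover have "(bvec ?w :: vec) \<noteq> 0"
    by (metis lookup_single_eq lookup_zero zero_neq_one)
  ultimately show "?P \<noteq> 0"
    using bt_act_simps(4)[of "bvec ?w"] \<open>?w \<in> words n0\<close> by auto
qed

lemma inj_Psi: "inj_on (Psi d n0) (carrier (BTTL n0)) \<longleftrightarrow> n0 \<le> d"
proof
  assume inj: "inj_on (Psi d n0) (carrier (BTTL n0))"
  show "n0 \<le> d"
  proof (rule ccontr)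
    assume "\<not> n0 \<le> d"
    then obtain x where x: "x \<noteq> 0" "\<And>v. v \<in> tpow d n0 \<Longrightarrow> bt_act x v = 0"
      using not_faithful[of d] by auto
    have "Psi d n0 (Rep_bt x) = Psi d n0 (Rep_bt 0)"
      unfolding Psi_Rep using x(2) bt_act_simps(4) tpow_words by (intro restrict_ext) auto
    then have "Rep_bt x = Rep_bt 0" using inj_onD[OF inj] Rep_bt by blast
    then show False using x(1) by (simp add: Rep_bt_inject)
  qed
next
  assume d: "n0 \<le> d"
  show "inj_on (Psi d n0) (carrier (BTTL n0))"
  proof (rule inj_onI)
    fix X Y assume "X \<in> carrier (BTTL n0)" "Y \<in> carrier (BTTL n0)" and e: "Psi d n0 X = Psi d n0 Y"
    then obtain x y where xy: "X = Rep_bt x" "Y = Rep_bt y" by (metis Rep_bt_cases)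
    have "bt_act x v = bt_act y v" if "v \<in> tpow d n0" for v
      using fun_cong[OF e, of v] that by (simp add: xy Psi_Rep)
    then have "x - y = 0"
      by (intro faithful[OF d]) (simp add: bt_act_simps tpow_words)
    then show "X = Y" by (simp add: xy)
  qed
qed

section \<open>Surjectivity\<close>

lemma lookup_diag: "Poly_Mapping.lookup (diag \<chi> v) u = prod_list (map \<chi> u) * Poly_Mapping.lookup v u"
proof -
  have "Poly_Mapping.lookup (diag \<chi> v) u =
      (\<Sum>w\<in>Poly_Mapping.keys v. if w = u then Poly_Mapping.lookup v w * prod_list (map \<chi> w) else 0)"
    unfolding diag_def lext_def by (simp add: lookup_sum lookup_single when_def if_distrib cong: if_cong)
  then show ?thesis by (auto simp: in_keys_iff)
qed

lemma Fop_other: "b \<notin> fst ` set w \<Longrightarrow> Fop b (bvec w) = 0"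
proof -
  assume "b \<notin> fst ` set w"
  then have "fword b w = 0" by (induction w) auto
  then show ?thesis by (simp add: Fop_def)
qed

lemma Fop_cmod_other: "b \<notin> set f \<Longrightarrow> v \<in> cmod f \<Longrightarrow> Fop b v = 0"
  using lin_eq_on[of "Fop b" "\<lambda>v. 0" "colored f" v] by (force simp: colored_def intro: Fop_other)

definition colproj :: "nat list \<Rightarrow> vec \<Rightarrow> vec" where
  "colproj g = lext (\<lambda>w. if map fst w = g then bvec w else 0)"

lemma lin_colproj [simp]: "lin (colproj g)"
  by (simp add: colproj_def)

lemma colproj_colored: "colproj g v \<in> cmod g"
  by (rule lin_fmod[of _ UNIV]) (auto simp: colproj_def colored_def)

lemma colproj_cmod: "v \<in> cmod f \<Longrightarrow> colproj g v = (if f = g then v else 0)"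
  by (rule lin_eq_on[OF lin_colproj, of "\<lambda>v. if f = g then v else 0" "colored f"])
     (auto simp: colproj_def colored_def lin_def)

lemma colproj_Fop: "colproj g (Fop b v) = Fop b (colproj g v)"
proof (rule fun_cong[where x = v], rule lin_ext)
  fix w :: "vbasis list"
  have "bvec w \<in> cmod (map fst w)" by (simp add: colored_def)
  then show "colproj g (Fop b (bvec w)) = Fop b (colproj g (bvec w))"
    using colproj_cmod[OF Fop_colored] colproj_cmod[of "bvec w" "map fst w"] by simp
qed (simp_all add: lin_comp)

lemma colproj_keys: "u \<in> Poly_Mapping.keys (colproj g v) \<Longrightarrow> u \<in> Poly_Mapping.keys v"
  by (rule keys_lin[OF lin_colproj, of u g v]) (auto simp: colproj_def split: if_splits)

lemma sum_colproj:
  assumes "v \<in> tpow d n"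
  shows "v = (\<Sum>g | set g \<subseteq> {1..d} \<and> length g = n. colproj g v)"
proof (rule lin_eq_on[OF lin_id _ _ assms])
  fix w assume w: "w \<in> tbasis d n"
  have "finite {g. set g \<subseteq> {1..d} \<and> length g = n}" by (rule finite_lists_length_eq) simp
  moreover have "map fst w \<in> {g. set g \<subseteq> {1..d} \<and> length g = n}" using w by (auto simp: tbasis_def)
  ultimately show "bvec w = (\<Sum>g | set g \<subseteq> {1..d} \<and> length g = n. colproj g (bvec w))"
    by (simp add: colproj_def)
qed (simp add: lin_sums)

lemma prod_gwt: "prod_list (map (gwt b a) w) = q ^ count (mset w) (b, a)"
  by (induction w) (auto simp: gwt_def)

lemma q_power_inj:
  assumes "q ^ k = q ^ m"
  shows "k = m"
proof -
  have "\<not> k < m" if "q ^ k = q ^ m" for k m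
  proof
    assume "k < m"
    then have "q ^ m = q ^ k * q ^ (m - k)" by (simp add: power_add[symmetric])
    then have "q ^ (m - k) = 1" using that q_nz by simp
    then show False using q_powers_ne_1[of "m - k"] \<open>k < m\<close> by simp
  qed
  then show ?thesis using assms by (metis linorder_neqE_nat)
qed

text \<open>Commutation with \<open>GK a\<close> of the copy \<open>b\<close> equates the powers of
  \<open>q\<close> whose exponents are the numbers of letters \<open>(b, a)\<close> in the two
  words.\<close>

lemma End_mset:
  assumes \<phi>: "\<phi> \<in> carrier (End_UqS d n)" and w: "w \<in> tbasis d n" and u: "u \<in> Poly_Mapping.keys (\<phi> (bvec w))"
  shows "mset u = mset w"
proof (rule multiset_eqI)
  fix e :: vbasis
  obtain b a where e: "e = (b, a)" by fastforce
  have wt: "(bvec w :: vec) \<in> tpow d n" using w by simp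
  have t: "tlin d n \<phi>" using \<phi> by (rule End_UqS_D)
  have ut: "u \<in> tbasis d n"
  proof -
    have "\<phi> (bvec w) \<in> tpow d n" using t wt by (auto simp: tlin_def)
    then show ?thesis using u by (auto simp: fmod_def)
  qed
  show "count (mset u) e = count (mset w) e"
  proof (cases "b \<in> {1..d}")
    case True
    have "diag (gwt b a) (\<phi> (bvec w)) = \<phi> (diag (gwt b a) (bvec w))"
      using End_UqS_D(2)[OF \<phi> True wt, of "GK a"] by simp
    also have "\<dots> = sc (q ^ count (mset w) e) (\<phi> (bvec w))"
      using t wt unfolding tlin_def diag_bvec prod_gwt e by blast
    finally have "Poly_Mapping.lookup (diag (gwt b a) (\<phi> (bvec w))) u
        = Poly_Mapping.lookup (sc (q ^ count (mset w) e) (\<phi> (bvec w))) u" by simp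
    then have "q ^ count (mset u) e = q ^ count (mset w) e"
      using u by (simp add: lookup_diag prod_gwt e in_keys_iff)
    then show ?thesis by (rule q_power_inj)
  next
    case False
    then have "e \<notin> set u" "e \<notin> set w" using ut w e by (auto simp: tbasis_def)
    then show ?thesis by (metis count_eq_zero_iff set_mset_mset)
  qed
qed

text \<open>The image of a coloured module is decomposed by the colour sequences of the target. Each
  component is an intertwiner between two coloured modules.\<close>

lemma End_SGspan:
  assumes \<phi>: "\<phi> \<in> carrier (End_UqS d n)" and f: "length f = n" "set f \<subseteq> {1..d}"
  shows "SGspan f \<phi>"
proof -
  define L where "L = lext (\<lambda>w. \<phi> (bvec w))"
  have t: "tlin d n \<phi>" using \<phi> by (rule End_UqS_D)
  have L: "\<phi> v = L v" if "v \<in> tpow d n" for v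
    unfolding L_def using tlin_lext[OF t that] .
  have lin: "lin L" by (simp add: L_def)
  have ct: "v \<in> tpow d n" if "v \<in> cmod f" for v using cmod_tpow[OF f(2) that] f(1) by simp
  have cl: "\<phi> v \<in> tpow d n" if "v \<in> tpow d n" for v using t that by (auto simp: tlin_def)
  let ?G = "{g. set g \<subseteq> {1..d} \<and> length g = n}"
  have "intertwiner f g (\<lambda>v. colproj g (L v))" if g: "g \<in> ?G" for g
    unfolding intertwiner_def
  proof (intro conjI allI ballI)
    show "Fop b (colproj g (L v)) = colproj g (L (Fop b v))" if v: "v \<in> cmod f" for b v
    proof (cases "b \<in> {1..d}")
      case True
      have "Fop b (L v) = L (Fop b v)"
        using End_UqS_D(2)[OF \<phi> True ct[OF v], of GF] L[OF ct[OF v]] L[OF ct[OF Fop_colored[OF v]]] by simp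
      then show ?thesis by (simp add: colproj_Fop[symmetric])
    next
      \<comment> \<open>An intertwiner has to commute with the lowering operators of all colours;
        outside \<open>{1..d}\<close> both sides vanish.\<close>
      case False
      then have "b \<notin> set f" "b \<notin> set g" using f(2) g by blast+
      then have "Fop b v = 0" "Fop b (colproj g (L v)) = 0"
        using Fop_cmod_other v colproj_colored by blast+
      then show ?thesis using lin_zero[OF lin] lin_zero[OF lin_colproj] by simp
    qed
    show "mset u = mset w" if w: "w \<in> colored f" and u: "u \<in> Poly_Mapping.keys (colproj g (L (bvec w)))" for w u
    proof -
      have "(bvec w :: vec) \<in> tpow d n" using w by (intro ct) simp
      then show ?thesis
        using End_mset[OF \<phi>, of w u] colproj_keys[OF u] L[of "bvec w"] by simp
    qed
  qed (simp_all add: lin lin_comp colproj_colored)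
  then have "SGspan f (\<lambda>v. colproj g (L v))" if "g \<in> ?G" for g
    using that by (blast intro: intertwiner_SGspan)
  moreover have "finite ?G" by (rule finite_lists_length_eq) simp
  moreover have "\<phi> v = (\<Sum>g\<in>?G. colproj g (L v))" if "v \<in> cmod f" for v
    using sum_colproj[OF cl[OF ct[OF that]]] L[OF ct[OF that]] by simp
  ultimately show ?thesis
    using SGspan_sum[of ?G f "\<lambda>g v. colproj g (L v)" \<phi>] by simp
qed

lemma bt_act_sum_list:
  assumes "v \<in> V0" "\<And>t. t \<in> set ts \<Longrightarrow> set (snd t) \<subseteq> {i. Suc i < n0}"
  shows "bt_act (\<Sum>t\<leftarrow>ts. scl (fst t) (bt.W (snd t))) v = (\<Sum>t\<leftarrow>ts. sc (fst t) (SGs (snd t) v))"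
  using assms(2) by (induction ts) (simp_all add: bt_act_simps assms(1) bt_act_W)

lemma End_on_pattern:
  assumes \<phi>: "\<phi> \<in> carrier (End_UqS d n0)"
  shows "\<exists>x. \<forall>w\<in>tbasis d n0. cpattern w = Y \<longrightarrow> bt_act x (bvec w) = \<phi> (bvec w)"
proof (cases "\<exists>w\<in>tbasis d n0. cpattern w = Y")
  case True
  then obtain w0 where w0: "w0 \<in> tbasis d n0" "cpattern w0 = Y" by blast
  define f where "f = map fst w0"
  have f: "length f = n0" "set f \<subseteq> {1..d}" using w0(1) by (auto simp: f_def tbasis_def)
  obtain ts where ts: "\<And>t. t \<in> set ts \<Longrightarrow> set (snd t) \<subseteq> {i. Suc i < n0}"
    "\<And>v. v \<in> cmod f \<Longrightarrow> \<phi> v = (\<Sum>t\<leftarrow>ts. sc (fst t) (SGs (snd t) v))"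
    using End_SGspan[OF \<phi> f] f(1) unfolding SGspan_def by auto
  let ?x = "\<Sum>t\<leftarrow>ts. scl (fst t) (bt.W (snd t))"
  have x: "bt_act ?x v = \<phi> v" if "v \<in> cmod f" for v
    using bt_act_sum_list[of v ts] ts colored_words[OF that] f(1) that by simp
  have "bt_act ?x (bvec w) = \<phi> (bvec w)" if w: "w \<in> tbasis d n0" "cpattern w = Y" for w
  proof -
    have lw: "length w = n0" "set (map fst w) \<subseteq> {1..d}" using w by (auto simp: tbasis_def)
    have "f ! i = f ! j \<longleftrightarrow> map fst w ! i = map fst w ! j" if ij: "i < n0" "j < n0" for i j
    proof -
      have "fst (w0 ! i) = fst (w0 ! j) \<longleftrightarrow> fst (w ! i) = fst (w ! j)" if "i < j" "j < n0" for i j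
      proof -
        have "(i, j) \<in> cpattern w0 \<longleftrightarrow> (i, j) \<in> cpattern w" using w0(2) w(2) by simp
        then show ?thesis using that by (simp add: cpattern_def)
      qed
      from this[of i j] this[of j i] show ?thesis
        using ij lw f(1) by (cases i j rule: linorder_cases) (auto simp: f_def)
    qed
    then obtain s where s: "s permutes {1..d}" "map s f = map fst w"
      using same_pattern_permutation[of f "map fst w" d] f lw by auto
    \<comment> \<open>\<open>w'\<close> puts the labels of \<open>w\<close> on the colours
      \<open>f\<close>, so that \<open>s\<close> maps it to \<open>w\<close>.\<close>
    define w' where "w' = zip f (map snd w)"
    have w': "w' \<in> colored f" using f(1) lw by (simp add: w'_def colored_def)
    have "map (\<lambda>(b, i). (s b, i)) w' = w"
    proof (rule nth_equalityI)
      fix i assume "i < length (map (\<lambda>(b, i). (s b, i)) w')"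
      then have i: "i < n0" using f(1) lw by (simp add: w'_def)
      have "s (f ! i) = fst (w ! i)" using arg_cong[OF s(2), of "\<lambda>l. l ! i"] i f(1) lw by simp
      then show "map (\<lambda>(b, i). (s b, i)) w' ! i = w ! i"
        using i f(1) lw by (simp add: w'_def)
    qed (use f(1) lw in \<open>simp add: w'_def\<close>)
    then have e: "bvec w = Sact s (bvec w')" by (simp add: Sact_bvec)
    have w't: "(bvec w' :: vec) \<in> tpow d n0" using cmod_tpow[OF f(2), of "bvec w'"] w' f(1) by simp
    have "bt_act ?x (bvec w) = Sact s (bt_act ?x (bvec w'))"
      unfolding e by (rule bt_act_Sact[OF permutes_inj[OF s(1)] tpow_words[OF w't]])
    also have "\<dots> = Sact s (\<phi> (bvec w'))" using x w' by simp
    also have "\<dots> = \<phi> (bvec w)" unfolding e using End_UqS_D(3)[OF \<phi> s(1) w't] by simp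
    finally show ?thesis .
  qed
  then show ?thesis by blast
qed blast

lemma Psi_surj:
  assumes \<phi>: "\<phi> \<in> carrier (End_UqS d n0)"
  shows "\<phi> \<in> Psi d n0 ` carrier (BTTL n0)"
proof -
  obtain x where x: "\<And>Y w. w \<in> tbasis d n0 \<Longrightarrow> cpattern w = Y \<Longrightarrow> bt_act (x Y) (bvec w) = \<phi> (bvec w)"
    using End_on_pattern[OF \<phi>] by metis
  let ?A = "Pow (set bt.all_pairs)"
  \<comment> \<open>The solutions for the single patterns are glued by the idempotents: on a word
    only the idempotent of its own pattern survives.\<close>
  define z where "z = (\<Sum>Y\<in>?A. x Y * bt.proj Y bt.all_pairs)"
  have t: "tlin d n0 \<phi>" using \<phi> by (rule End_UqS_D)
  have "bt_act z (bvec w) = \<phi> (bvec w)" if w: "w \<in> tbasis d n0" for w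
  proof -
    have ww: "w \<in> words n0" "(bvec w :: vec) \<in> V0" using w tbasis_words by auto
    have "bt_act z (bvec w) = (\<Sum>Y\<in>?A. bt_act (x Y) (bt_act (bt.proj Y bt.all_pairs) (bvec w)))"
      using ww by (simp add: z_def bt_act_sum bt_act_simps)
    also have "\<dots> = (\<Sum>Y\<in>?A. if Y = cpattern w then \<phi> (bvec w) else 0)"
    proof (rule sum.cong[OF refl])
      fix Y assume "Y \<in> ?A"
      moreover have "bt_act (x Y) 0 = 0" using bt_act_lin(2)[of 0 0 "x Y" 0] by simp
      ultimately show "bt_act (x Y) (bt_act (bt.proj Y bt.all_pairs) (bvec w)) = (if Y = cpattern w then \<phi> (bvec w) else 0)"
        using bt_act_proj_all[of Y w] ww x[OF w] by auto
    qed
    also have "\<dots> = \<phi> (bvec w)"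
    proof -
      have "cpattern w \<in> ?A" by (auto simp: bt.set_all_pairs cpattern_def)
      then show ?thesis by (subst sum.delta) simp_all
    qed
    finally show ?thesis .
  qed
  then have z: "bt_act z v = \<phi> v" if "v \<in> tpow d n0" for v
    using bt_act_eq_on[OF tbasis_words, of "lext (\<lambda>w. \<phi> (bvec w))" d z v] that tlin_lext[OF t that] by simp
  have "\<phi> = Psi d n0 (Rep_bt z)"
  proof (rule extensionalityI[of _ "tpow d n0"])
    show "\<phi> \<in> extensional (tpow d n0)" using t by (auto simp: tlin_def PiE_def)
  qed (simp_all add: Psi_Rep z)
  then show ?thesis using Rep_bt by blast
qed

lemma main_claim_n0: "main_claim d n0"
proof -
  have "Psi d n0 \<in> carrier (BTTL n0) \<rightarrow> carrier (End_UqS d n0)"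
    using Psi_hom[of d n0] by (auto simp: alg_hom_def ring_hom_def)
  then show ?thesis
    unfolding main_claim_def using inj_Psi[of d] Psi_surj[of _ d] by blast
qed

theorem theorem7p3:
  fixes d n :: nat
  assumes "d \<ge> 1" and "n \<ge> 1"
  shows "\<exists>\<Psi> \<in> alg_hom (BTTL n) (End_UqS d n).
           (\<forall>i\<in>{1..<n}. \<Psi> (BTTL_gen n (TS i)) = sigma d n i \<and>
                        \<Psi> (BTTL_gen n (TE i)) = eps d n i) \<and>
           \<Psi> ` carrier (BTTL n) = carrier (End_UqS d n) \<and>
           (\<Psi> \<in> alg_iso (BTTL n) (End_UqS d n) \<longleftrightarrow> n \<le> d)"
proof (rule bexI[OF _ Psi_hom])
  have "main_claim d n"
    using n0_claim[OF main_claim_n0 assms(2,1)] .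
  then show "(\<forall>i\<in>{1..<n}. Psi d n (BTTL_gen n (TS i)) = sigma d n i \<and> Psi d n (BTTL_gen n (TE i)) = eps d n i) \<and>
      Psi d n ` carrier (BTTL n) = carrier (End_UqS d n) \<and> (Psi d n \<in> alg_iso (BTTL n) (End_UqS d n) \<longleftrightarrow> n \<le> d)"
    using Psi_gens[of _ n d] Psi_hom[of d n] by (simp add: main_claim_def alg_iso_def bij_betw_def)
qed

end
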